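(* Let $n\ge 2$ and $r\ge 1$ be integers. There is an isomorphism of $S_n$-modules (complex representations of the symmetric group $S_n$) $$\mathrm{Pl}(\Delta_r^{n})\;\simeq\; \bigoplus_{a=1}^{n-1} \mathrm{Sym}^{r-a}(\mathbb{C}^n)\otimes \mathrm{Pl}(B_{a,n-a}),$$ where by convention $\mathrm{Sym}^k(\mathbb{C}^n)=0$ if $k<0$.
   Context: For $S\subseteq\{1,\ldots,n\}$ write $x_S=\sum_{i\in S}x_i$. For an ordered set partition $(S_1,\ldots,S_k)$ of $\{1,\ldots,n\}$ into nonempty blocks (called lumps) and an ordered partition $s_1+\cdots+s_k=r$ of a positive integer $r$ into positive integers $s_i$ (called positions), the plate $[[(S_1)_{s_1}\cdots(S_k)_{s_k}]]$ is the characteristic function of the set of $x\in\mathbb{R}^n$ with $x_{S_1}\ge s_1$, $x_{S_1}+x_{S_2}\ge s_1+s_2$, ..., $x_{S_1}+\cdots+x_{S_{k-1}}\ge s_1+\cdots+s_{k-1}$, and $x_{S_1}+\cdots+x_{S_k}= s_1+\cdots+s_k=r$. Let $\Delta_r^n=\{x\in[0,r]^n:\sum_{i=1}^n x_i=r\}$. For positive integers $a,b$ with $a+b=n$, let $B_{a,b}=\{x\in[0,1]^n:\sum_{i=1}^n x_i=a\}$ (the hypersimplex). $\mathrm{Pl}(\Delta_r^n)$ denotes the complex-linear span of the plates in $\Delta_r^n$, i.e. of the functions on $\Delta_r^n$ obtained by restricting to $\Delta_r^n$ all plates $[[(S_1)_{s_1}\cdots(S_k)_{s_k}]]$ with $s_1+\cdots+s_k=r$.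 Similarly $\mathrm{Pl}(B_{a,b})$ denotes the complex-linear span of the plates in $B_{a,b}$, i.e. of the restrictions to $B_{a,b}$ of all plates $[[(S_1)_{s_1}\cdots(S_k)_{s_k}]]$ with $s_1+\cdots+s_k=a$. In both cases functions are identified when they differ only on a finite union of polyhedra of dimension less than $n-1$. The symmetric group $S_n$ acts on these spaces by permuting coordinates, so that $\sigma\cdot[[(S_1)_{s_1}\cdots(S_k)_{s_k}]]=[[(\sigma(S_1))_{s_1}\cdots(\sigma(S_k))_{s_k}]]$. It acts on $\mathbb{C}^n$ by permuting the standard basis, on the symmetric powers $\mathrm{Sym}^{k}(\mathbb{C}^n)$ by the induced action, and diagonally on tensor products. *)

theory Defs
  imports "HOL-Analysis.Analysis" "HOL-Library.Poly_Mapping" "HOL-Algebra.Module" "HOL-Algebra.QuotRing" "HOL-Algebra.Bij"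
begin

definition complex_ring :: "complex ring" where
  "complex_ring = \<lparr>carrier = UNIV, mult = (*), one = 1, zero = 0, add = (+)\<rparr>"

text \<open>
  A module record inherits the fields \<open>mult\<close> and \<open>one\<close> from \<open>ring\<close>. They play no role for a
  module and are \<open>undefined\<close> in all the representations below.
\<close>

record ('g, 'v) rep = "(complex, 'v) module" +
  act :: "'g \<Rightarrow> 'v \<Rightarrow> 'v"

definition representation :: "'g monoid \<Rightarrow> ('g, 'v) rep \<Rightarrow> bool" where
  "representation G V \<longleftrightarrow>
     group G \<and> Module.module complex_ring V \<and>
     (\<forall>g\<in>carrier G. \<forall>v\<in>carrier V. act V g v \<in> carrier V) \<and>
     (\<forall>g\<in>carrier G. \<forall>v\<in>carrier V. \<forall>w\<in>carrier V.
        act V g (v \<oplus>\<^bsub>V\<^esub> w) = act V g v \<oplus>\<^bsub>V\<^esub> act V g w) \<and>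
     (\<forall>g\<in>carrier G. \<forall>c. \<forall>v\<in>carrier V. act V g (c \<odot>\<^bsub>V\<^esub> v) = c \<odot>\<^bsub>V\<^esub> act V g v) \<and>
     (\<forall>v\<in>carrier V. act V \<one>\<^bsub>G\<^esub> v = v) \<and>
     (\<forall>g\<in>carrier G. \<forall>h\<in>carrier G. \<forall>v\<in>carrier V. act V (g \<otimes>\<^bsub>G\<^esub> h) v = act V g (act V h v))"

definition isomorphic_reps :: "'g monoid \<Rightarrow> ('g, 'v) rep \<Rightarrow> ('g, 'w) rep \<Rightarrow> bool" where
  "isomorphic_reps G V W \<longleftrightarrow>
     representation G V \<and> representation G W \<and>
     (\<exists>\<phi>. bij_betw \<phi> (carrier V) (carrier W) \<and>
        (\<forall>v\<in>carrier V. \<forall>w\<in>carrier V. \<phi> (v \<oplus>\<^bsub>V\<^esub> w) = \<phi> v \<oplus>\<^bsub>W\<^esub> \<phi> w) \<and>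
        (\<forall>c. \<forall>v\<in>carrier V. \<phi> (c \<odot>\<^bsub>V\<^esub> v) = c \<odot>\<^bsub>W\<^esub> \<phi> v) \<and>
        (\<forall>g\<in>carrier G. \<forall>v\<in>carrier V. \<phi> (act V g v) = act W g (\<phi> v)))"

definition lin_span :: "('g, 'v) rep \<Rightarrow> 'v set \<Rightarrow> 'v set" where
  "lin_span V A = \<Inter>{H. submodule H complex_ring V \<and> A \<subseteq> H}"

text \<open>
  The quotient by a \<open>G\<close>-stable subspace \<open>N\<close>, with cosets as elements. As in \<^const>\<open>rcoset_mult\<close>,
  an operation is applied to all members of a coset, and the cosets of the results, which all
  coincide, are united.
\<close>

definition quotient_rep :: "('g, 'v) rep \<Rightarrow> 'v set \<Rightarrow> ('g, 'v set) rep" where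
  "quotient_rep V N =
     \<lparr>carrier = a_rcosets\<^bsub>V\<^esub> N, mult = undefined, one = undefined,
      zero = N, add = set_add V,
      smult = (\<lambda>c X. \<Union>x\<in>X. N +>\<^bsub>V\<^esub> (c \<odot>\<^bsub>V\<^esub> x)),
      act = (\<lambda>g X. \<Union>x\<in>X. N +>\<^bsub>V\<^esub> act V g x)\<rparr>"

text \<open>The vector space with basis \<open>X\<close>, where the group acts on basis elements through \<open>\<alpha>\<close>.\<close>

definition free_rep :: "('g \<Rightarrow> 'x \<Rightarrow> 'x) \<Rightarrow> 'x set \<Rightarrow> ('g, 'x \<Rightarrow>\<^sub>0 complex) rep" where
  "free_rep \<alpha> X =
     \<lparr>carrier = {f. Poly_Mapping.keys f \<subseteq> X}, mult = undefined, one = undefined,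
      zero = 0, add = (+),
      smult = (\<lambda>c. Poly_Mapping.map ((*) c)),
      act = (\<lambda>g f. \<Sum>x\<in>Poly_Mapping.keys f.
               Poly_Mapping.single (\<alpha> g x) (Poly_Mapping.lookup f x))\<rparr>"

abbreviation basis_elem :: "'x \<Rightarrow> 'x \<Rightarrow>\<^sub>0 complex" where
  "basis_elem x \<equiv> Poly_Mapping.single x 1"

definition tensor_relations ::
    "('g, 'v) rep \<Rightarrow> ('g, 'w) rep \<Rightarrow> ('v \<times> 'w \<Rightarrow>\<^sub>0 complex) set" where
  "tensor_relations V W =
     {basis_elem (v \<oplus>\<^bsub>V\<^esub> v', w) - basis_elem (v, w) - basis_elem (v', w) | v v' w.
        v \<in> carrier V \<and> v' \<in> carrier V \<and> w \<in> carrier W} \<union>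
     {basis_elem (v, w \<oplus>\<^bsub>W\<^esub> w') - basis_elem (v, w) - basis_elem (v, w') | v w w'.
        v \<in> carrier V \<and> w \<in> carrier W \<and> w' \<in> carrier W} \<union>
     {basis_elem (c \<odot>\<^bsub>V\<^esub> v, w) - Poly_Mapping.single (v, w) c | c v w.
        v \<in> carrier V \<and> w \<in> carrier W} \<union>
     {basis_elem (v, c \<odot>\<^bsub>W\<^esub> w) - Poly_Mapping.single (v, w) c | c v w.
        v \<in> carrier V \<and> w \<in> carrier W}"

definition tensor_rep ::
    "('g, 'v) rep \<Rightarrow> ('g, 'w) rep \<Rightarrow> ('g, ('v \<times> 'w \<Rightarrow>\<^sub>0 complex) set) rep" where
  "tensor_rep V W =
     (let F = free_rep (\<lambda>g (v, w). (act V g v, act W g w)) (carrier V \<times> carrier W)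
      in quotient_rep F (lin_span F (tensor_relations V W)))"

text \<open>
  The \<open>k\<close>-th symmetric power is generated by the formal products \<open>v\<^sub>1 \<cdots> v\<^sub>k\<close>, represented as
  lists, subject to symmetry and multilinearity. For \<open>k < 0\<close> there are no such lists and the
  symmetric power is zero.
\<close>

definition sym_generators :: "('g, 'v) rep \<Rightarrow> int \<Rightarrow> 'v list set" where
  "sym_generators V k = {vs. int (length vs) = k \<and> set vs \<subseteq> carrier V}"

definition sym_relations :: "('g, 'v) rep \<Rightarrow> int \<Rightarrow> ('v list \<Rightarrow>\<^sub>0 complex) set" where
  "sym_relations V k =
     {basis_elem vs - basis_elem ws | vs ws.
        vs \<in> sym_generators V k \<and> mset vs = mset ws} \<union>
     {basis_elem (vs[i := v \<oplus>\<^bsub>V\<^esub> v']) - basis_elem (vs[i := v]) - basis_elem (vs[i := v'])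
        | vs i v v'. vs \<in> sym_generators V k \<and> i < length vs \<and>
            v \<in> carrier V \<and> v' \<in> carrier V} \<union>
     {basis_elem (vs[i := c \<odot>\<^bsub>V\<^esub> v]) - Poly_Mapping.single (vs[i := v]) c
        | vs i c v. vs \<in> sym_generators V k \<and> i < length vs \<and> v \<in> carrier V}"

definition sym_power :: "('g, 'v) rep \<Rightarrow> int \<Rightarrow> ('g, ('v list \<Rightarrow>\<^sub>0 complex) set) rep" where
  "sym_power V k =
     (let F = free_rep (\<lambda>g. map (act V g)) (sym_generators V k)
      in quotient_rep F (lin_span F (sym_relations V k)))"

definition direct_sum :: "'i set \<Rightarrow> ('i \<Rightarrow> ('g, 'v) rep) \<Rightarrow> ('g, 'i \<Rightarrow> 'v) rep" where
  "direct_sum I V =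
     \<lparr>carrier = {f \<in> (\<Pi>\<^sub>E i\<in>I. carrier (V i)). finite {i \<in> I. f i \<noteq> \<zero>\<^bsub>V i\<^esub>}},
      mult = undefined, one = undefined,
      zero = (\<lambda>i\<in>I. \<zero>\<^bsub>V i\<^esub>),
      add = (\<lambda>f g. \<lambda>i\<in>I. f i \<oplus>\<^bsub>V i\<^esub> g i),
      smult = (\<lambda>c f. \<lambda>i\<in>I. c \<odot>\<^bsub>V i\<^esub> f i),
      act = (\<lambda>\<sigma> f. \<lambda>i\<in>I. act (V i) \<sigma> (f i))\<rparr>"

text \<open>
  Coordinates are indexed by a finite type \<open>'n\<close>, in place of \<open>{1, \<dots>, n}\<close> with \<open>n = CARD('n)\<close>,
  so the symmetric group is the group of all bijections of \<open>'n\<close>.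
\<close>

abbreviation Sym_group :: "('n \<Rightarrow> 'n) monoid" where
  "Sym_group \<equiv> BijGroup UNIV"

text \<open>With the inverse, \<open>\<sigma>\<close> sends the standard basis vector \<open>e\<^sub>i\<close> to \<open>e\<^sub>\<sigma>\<^sub>(\<^sub>i\<^sub>)\<close>.\<close>

definition permute_coords :: "('n::finite \<Rightarrow> 'n) \<Rightarrow> 'a ^ 'n \<Rightarrow> 'a ^ 'n" where
  "permute_coords \<sigma> x = (\<chi> i. x $ inv_into UNIV \<sigma> i)"

definition standard_rep :: "('n::finite \<Rightarrow> 'n, complex ^ 'n) rep" where
  "standard_rep =
     \<lparr>carrier = UNIV, mult = undefined, one = undefined,
      zero = 0, add = (+), smult = (*s), act = permute_coords\<rparr>"

definition coord_sum :: "real ^ 'n::finite \<Rightarrow> 'n set \<Rightarrow> real" where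
  "coord_sum x S = (\<Sum>i\<in>S. x $ i)"

definition ordered_set_partition :: "'n set list \<Rightarrow> bool" where
  "ordered_set_partition Ss \<longleftrightarrow>
     (\<forall>S\<in>set Ss. S \<noteq> {}) \<and> \<Union>(set Ss) = UNIV \<and>
     (\<forall>i j. i < j \<longrightarrow> j < length Ss \<longrightarrow> Ss ! i \<inter> Ss ! j = {})"

definition plate_set :: "'n::finite set list \<Rightarrow> nat list \<Rightarrow> (real ^ 'n) set" where
  "plate_set Ss s =
     {x. (\<forall>j. 1 \<le> j \<longrightarrow> j < length Ss \<longrightarrow>
            (\<Sum>i<j. coord_sum x (Ss ! i)) \<ge> real (\<Sum>i<j. s ! i)) \<and>
         (\<Sum>i<length Ss. coord_sum x (Ss ! i)) = real (\<Sum>i<length Ss. s ! i)}"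

definition plate :: "'n::finite set list \<Rightarrow> nat list \<Rightarrow> real ^ 'n \<Rightarrow> complex" where
  "plate Ss s = indicator (plate_set Ss s)"

definition plates :: "nat \<Rightarrow> (real ^ 'n::finite \<Rightarrow> complex) set" where
  "plates r =
     {plate Ss s | Ss s. ordered_set_partition Ss \<and> length s = length Ss \<and>
        (\<forall>t\<in>set s. t > 0) \<and> sum_list s = r}"

definition dilated_simplex :: "nat \<Rightarrow> (real ^ 'n::finite) set" where
  "dilated_simplex r = {x. (\<forall>i. 0 \<le> x $ i \<and> x $ i \<le> real r) \<and> (\<Sum>i\<in>UNIV. x $ i) = real r}"

text \<open>This is \<open>B\<^sub>a\<^sub>,\<^sub>b\<close>, where \<open>b = n - a\<close> is determined by \<open>a\<close>.\<close>

definition hypersimplex :: "nat \<Rightarrow> (real ^ 'n::finite) set" where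
  "hypersimplex a = {x. (\<forall>i. 0 \<le> x $ i \<and> x $ i \<le> 1) \<and> (\<Sum>i\<in>UNIV. x $ i) = real a}"

text \<open>The action on functions is \<open>(\<sigma> \<cdot> f)(x) = f(\<sigma>\<^sup>-\<^sup>1 \<cdot> x)\<close>; it presupposes that \<open>D\<close> is invariant.\<close>

definition function_rep ::
    "(real ^ 'n::finite) set \<Rightarrow> ('n \<Rightarrow> 'n, real ^ 'n \<Rightarrow> complex) rep" where
  "function_rep D =
     \<lparr>carrier = extensional D, mult = undefined, one = undefined,
      zero = (\<lambda>x\<in>D. 0),
      add = (\<lambda>f g. \<lambda>x\<in>D. f x + g x),
      smult = (\<lambda>c f. \<lambda>x\<in>D. c * f x),
      act = (\<lambda>\<sigma> f. \<lambda>x\<in>D. f (permute_coords (inv_into UNIV \<sigma>) x))\<rparr>"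

definition null_functions :: "(real ^ 'n::finite) set \<Rightarrow> (real ^ 'n \<Rightarrow> complex) set" where
  "null_functions D =
     {f \<in> extensional D. \<exists>\<P>. finite \<P> \<and>
        (\<forall>P\<in>\<P>. polyhedron P \<and> aff_dim P < int CARD('n) - 1) \<and>
        {x \<in> D. f x \<noteq> 0} \<subseteq> \<Union>\<P>}"

definition Pl ::
    "(real ^ 'n::finite) set \<Rightarrow> nat \<Rightarrow> ('n \<Rightarrow> 'n, (real ^ 'n \<Rightarrow> complex) set) rep" where
  "Pl D r =
     (let Q = quotient_rep (function_rep D) (null_functions D)
      in Q\<lparr>carrier := lin_span Q
             {null_functions D +>\<^bsub>function_rep D\<^esub> restrict f D | f. f \<in> plates r}\<rparr>)"

end

theory Submission
  imports Defs
begin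

text \<open>
  The cubes \<open>z + [0,1]\<^sup>n\<close> with \<open>z \<in> \<nat>\<^sup>n\<close>, \<open>\<Sum>z = r - a\<close> and \<open>1 \<le> a \<le> n - 1\<close> cut the simplex into translates of
  the hypersimplices \<open>B\<^sub>a\<close>, and the points \<open>z\<close> with \<open>\<Sum>z = r - a\<close> index the monomial basis of the \<open>(r - a)\<close>-th symmetric
  power. So \<open>X\<^sup>z \<otimes> f \<mapsto> f(x - z)\<close>, extended by zero outside the cube, is equivariant, and it is injective because
  distinct cubes overlap in a null set.

  A plate is the indicator of conditions \<open>x\<^sub>U \<ge> T\<close> with \<open>U\<close> running through a chain of sets. Conversely, on a
  simplex or hypersimplex every such indicator with integral \<open>T\<close> is almost everywhere zero or a plate, since
  redundant conditions can be dropped. Hence translation by \<open>z\<close> maps plates to plates. The span of the chain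
  indicators is moreover closed under multiplication by \<open>[x\<^sub>i \<ge> t]\<close>, hence by the indicator of a cube, so the
  map lands in the span of the plates; it is surjective because every plate is the sum of its restrictions to the cubes.
\<close>

section \<open>Representations and quotients\<close>

text \<open>The linear relations among plates are never determined, and no dimensions are compared.
  Injectivity and surjectivity are read off cube by cube, from the normal form of a tensor as a sum
  of \<open>X^z \<otimes> f_z\<close> over the monomials of one degree; the monomial basis of the
  symmetric power is the only basis that enters. The range of \<open>a\<close> comes from generic
  points: if no coordinate is an integer, the fractional parts lie strictly between 0 and 1, so
  their sum is an integer strictly between 0 and n. Two mismatches shape the details. Conditions
  \<open>[x_i \<ge> t]\<close> produce half-open cubes, while hypersimplices are closed; the two are
  compared up to slices \<open>x_i = m\<close>, which are thin. And symmetric powers and tensor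
  products are quotients of free spaces, so a map out of them is given through chosen
  representatives. For this reason the construction works with functions on the whole space,
  compares them up to thin sets, and passes to classes at the very end.\<close>

lemma carrier_complex_ring [simp]: "carrier complex_ring = UNIV"
  and add_complex_ring [simp]: "a \<oplus>\<^bsub>complex_ring\<^esub> b = a + b"
  and mult_complex_ring [simp]: "a \<otimes>\<^bsub>complex_ring\<^esub> b = a * b"
  and one_complex_ring [simp]: "\<one>\<^bsub>complex_ring\<^esub> = 1"
  and zero_complex_ring [simp]: "\<zero>\<^bsub>complex_ring\<^esub> = 0"
  by (simp_all add: complex_ring_def)

lemma cring_complex_ring: "cring complex_ring"
proof (rule cringI)
  show "abelian_group complex_ring"
    by (rule abelian_groupI) (auto intro: exI[of _ "- x" for x] simp: add.assoc add.commute)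
  show "Group.comm_monoid complex_ring"
    by (rule comm_monoidI) (auto simp: mult.assoc mult.commute)
qed (simp add: distrib_right)

lemma uminus_complex_ring [simp]: "\<ominus>\<^bsub>complex_ring\<^esub> a = - a"
proof -
  interpret cring complex_ring by (rule cring_complex_ring)
  show ?thesis by (rule minus_equality) auto
qed

lemma complex_moduleI:
  assumes "abelian_group V"
    and "\<And>c x. x \<in> carrier V \<Longrightarrow> c \<odot>\<^bsub>V\<^esub> x \<in> carrier V"
    and "\<And>a b x. x \<in> carrier V \<Longrightarrow> (a + b) \<odot>\<^bsub>V\<^esub> x = a \<odot>\<^bsub>V\<^esub> x \<oplus>\<^bsub>V\<^esub> b \<odot>\<^bsub>V\<^esub> x"
    and "\<And>c x y. x \<in> carrier V \<Longrightarrow> y \<in> carrier V \<Longrightarrow> c \<odot>\<^bsub>V\<^esub> (x \<oplus>\<^bsub>V\<^esub> y) = c \<odot>\<^bsub>V\<^esub> x \<oplus>\<^bsub>V\<^esub> c \<odot>\<^bsub>V\<^esub> y"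
    and "\<And>a b x. x \<in> carrier V \<Longrightarrow> (a * b) \<odot>\<^bsub>V\<^esub> x = a \<odot>\<^bsub>V\<^esub> (b \<odot>\<^bsub>V\<^esub> x)"
    and "\<And>x. x \<in> carrier V \<Longrightarrow> 1 \<odot>\<^bsub>V\<^esub> x = x"
  shows "Module.module complex_ring V"
  using assms by (intro moduleI) (auto intro: cring_complex_ring)

lemma complex_submoduleI:
  assumes "Module.module complex_ring V"
    and "H \<subseteq> carrier V" and "\<zero>\<^bsub>V\<^esub> \<in> H"
    and "\<And>a b. a \<in> H \<Longrightarrow> b \<in> H \<Longrightarrow> a \<oplus>\<^bsub>V\<^esub> b \<in> H"
    and "\<And>c a. a \<in> H \<Longrightarrow> c \<odot>\<^bsub>V\<^esub> a \<in> H"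
  shows "submodule H complex_ring V"
proof -
  interpret module complex_ring V by fact
  show ?thesis
  proof (rule submoduleI)
    fix a assume "a \<in> H"
    with assms(2) have "\<ominus>\<^bsub>V\<^esub> a = (-1) \<odot>\<^bsub>V\<^esub> a"
      using smult_l_minus[of 1 a] smult_one[of a] by auto
    with \<open>a \<in> H\<close> assms(5) show "\<ominus>\<^bsub>V\<^esub> a \<in> H" by simp
  qed (use assms in auto)
qed

lemma complex_submoduleD:
  assumes "submodule H complex_ring V"
  shows "H \<subseteq> carrier V" and "\<zero>\<^bsub>V\<^esub> \<in> H"
    and "a \<in> H \<Longrightarrow> b \<in> H \<Longrightarrow> a \<oplus>\<^bsub>V\<^esub> b \<in> H"
    and "a \<in> H \<Longrightarrow> c \<odot>\<^bsub>V\<^esub> a \<in> H"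
proof -
  interpret submodule H complex_ring V by fact
  show "H \<subseteq> carrier V" using subset by simp
  show "\<zero>\<^bsub>V\<^esub> \<in> H" using one_closed by simp
  show "a \<in> H \<Longrightarrow> b \<in> H \<Longrightarrow> a \<oplus>\<^bsub>V\<^esub> b \<in> H" using m_closed by simp
  show "a \<in> H \<Longrightarrow> c \<odot>\<^bsub>V\<^esub> a \<in> H" by simp
qed

lemma complex_submodule_carrier:
  assumes "Module.module complex_ring V"
  shows "submodule (carrier V) complex_ring V"
proof -
  interpret module complex_ring V by fact
  show ?thesis by (rule complex_submoduleI) (use assms in auto)
qed

lemma lin_span_superset: "A \<subseteq> lin_span V A"
  by (auto simp: lin_span_def)

lemma lin_span_minimal:
  assumes "submodule H complex_ring V" "A \<subseteq> H"
  shows "lin_span V A \<subseteq> H"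
  using assms by (auto simp: lin_span_def)

lemma submodule_lin_span:
  assumes V: "Module.module complex_ring V" and "A \<subseteq> carrier V"
  shows "submodule (lin_span V A) complex_ring V"
proof (rule complex_submoduleI[OF V])
  show "lin_span V A \<subseteq> carrier V"
    by (rule lin_span_minimal[OF complex_submodule_carrier[OF V] assms(2)])
qed (auto simp: lin_span_def dest: complex_submoduleD)

definition subrep :: "'g monoid \<Rightarrow> ('g, 'v) rep \<Rightarrow> 'v set \<Rightarrow> bool" where
  "subrep G V N \<longleftrightarrow> submodule N complex_ring V \<and> (\<forall>g\<in>carrier G. \<forall>v\<in>N. act V g v \<in> N)"

lemma representationD:
  assumes "representation G V"
  shows "group G" "Module.module complex_ring V" "abelian_group V"
    and "g \<in> carrier G \<Longrightarrow> v \<in> carrier V \<Longrightarrow> act V g v \<in> carrier V"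
    and "g \<in> carrier G \<Longrightarrow> v \<in> carrier V \<Longrightarrow> w \<in> carrier V \<Longrightarrow>
      act V g (v \<oplus>\<^bsub>V\<^esub> w) = act V g v \<oplus>\<^bsub>V\<^esub> act V g w"
    and "g \<in> carrier G \<Longrightarrow> v \<in> carrier V \<Longrightarrow> act V g (c \<odot>\<^bsub>V\<^esub> v) = c \<odot>\<^bsub>V\<^esub> act V g v"
    and "v \<in> carrier V \<Longrightarrow> act V \<one>\<^bsub>G\<^esub> v = v"
    and "g \<in> carrier G \<Longrightarrow> h \<in> carrier G \<Longrightarrow> v \<in> carrier V \<Longrightarrow>
      act V (g \<otimes>\<^bsub>G\<^esub> h) v = act V g (act V h v)"
  using assms by (auto simp: representation_def Module.module_def)

lemma representation_closed:
  assumes "representation G V"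
  shows "\<zero>\<^bsub>V\<^esub> \<in> carrier V"
    and "v \<in> carrier V \<Longrightarrow> w \<in> carrier V \<Longrightarrow> v \<oplus>\<^bsub>V\<^esub> w \<in> carrier V"
    and "v \<in> carrier V \<Longrightarrow> c \<odot>\<^bsub>V\<^esub> v \<in> carrier V"
proof -
  interpret module complex_ring V by (rule representationD(2)[OF assms])
  show "\<zero>\<^bsub>V\<^esub> \<in> carrier V"
    and "v \<in> carrier V \<Longrightarrow> w \<in> carrier V \<Longrightarrow> v \<oplus>\<^bsub>V\<^esub> w \<in> carrier V"
    and "v \<in> carrier V \<Longrightarrow> c \<odot>\<^bsub>V\<^esub> v \<in> carrier V" by auto
qed

lemma act_zero:
  assumes V: "representation G V" and g: "g \<in> carrier G"
  shows "act V g \<zero>\<^bsub>V\<^esub> = \<zero>\<^bsub>V\<^esub>"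
proof -
  interpret module complex_ring V by (rule representationD(2)[OF V])
  have "act V g (0 \<odot>\<^bsub>V\<^esub> \<zero>\<^bsub>V\<^esub>) = 0 \<odot>\<^bsub>V\<^esub> act V g \<zero>\<^bsub>V\<^esub>"
    by (rule representationD(6)[OF V g]) simp
  moreover have "act V g \<zero>\<^bsub>V\<^esub> \<in> carrier V" by (rule representationD(4)[OF V g]) simp
  ultimately show ?thesis using smult_l_null smult_r_null by (metis carrier_complex_ring UNIV_I zero_complex_ring)
qed

text \<open>The vectors that \<open>g\<close> sends into the span form a subspace, so stability can
  be checked on generators. It is applied to the relations of tensor products and of symmetric
  powers.\<close>

lemma subrep_lin_span:
  assumes V: "representation G V" and A: "A \<subseteq> carrier V"
    and stable: "\<And>g a. g \<in> carrier G \<Longrightarrow> a \<in> A \<Longrightarrow> act V g a \<in> lin_span V A"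
  shows "subrep G V (lin_span V A)"
proof -
  note sub = submodule_lin_span[OF representationD(2)[OF V] A]
  note D = complex_submoduleD[OF sub]
  have "act V g v \<in> lin_span V A" if g: "g \<in> carrier G" and v: "v \<in> lin_span V A" for g v
  proof -
    let ?H = "{v \<in> carrier V. act V g v \<in> lin_span V A}"
    have "submodule ?H complex_ring V"
      using D by (intro complex_submoduleI[OF representationD(2)[OF V]])
        (auto simp: representationD[OF V] representation_closed[OF V] act_zero[OF V] g)
    from lin_span_minimal[OF this, of A] A stable g v show ?thesis by auto
  qed
  with sub show ?thesis by (simp add: subrep_def)
qed

lemma representation_subrep:
  assumes V: "representation G V" and H: "subrep G V H"
  shows "representation G (V\<lparr>carrier := H\<rparr>)"
proof -
  have sub: "submodule H complex_ring V" using H by (simp add: subrep_def)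
  have "Module.module complex_ring (V\<lparr>carrier := H\<rparr>)"
    using submodule.submodule_is_module[OF sub representationD(2)[OF V]] .
  moreover have "H \<subseteq> carrier V" by (rule complex_submoduleD(1)[OF sub])
  ultimately show ?thesis
    using H representationD[OF V] by (auto simp: representation_def subrep_def subset_iff)
qed

locale rep_quotient =
  fixes G :: "'g monoid" and V :: "('g, 'v) rep" and N :: "'v set"
  assumes rep: "representation G V" and subrep: "subrep G V N"
begin

sublocale module complex_ring V by (rule representationD(2)[OF rep])

lemma sub: "submodule N complex_ring V" using subrep by (simp add: subrep_def)

sublocale abelian_subgroup N V
  using sub by (intro abelian_subgroupI3 additive_subgroup.intro abelian_group_axioms)
    (simp add: submodule_def)

abbreviation "coset v \<equiv> N +>\<^bsub>V\<^esub> v"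

lemma coset_eq_iff:
  assumes "x \<in> carrier V" "y \<in> carrier V"
  shows "coset x = coset y \<longleftrightarrow> x \<ominus>\<^bsub>V\<^esub> y \<in> N"
  using assms a_rcos_module[of y x] a_repr_independence'[of x y] a_rcos_self[of x]
  by (auto simp: a_minus_def)

lemma coset_eq_zero_iff: "x \<in> carrier V \<Longrightarrow> coset x = N \<longleftrightarrow> x \<in> N"
  by (metis a_rcos_const a_rcos_self)

lemma coset_add:
  "x \<in> carrier V \<Longrightarrow> y \<in> carrier V \<Longrightarrow> coset x <+>\<^bsub>V\<^esub> coset y = coset (x \<oplus>\<^bsub>V\<^esub> y)"
  by (rule a_rcos_sum)

text \<open>Quotient operations are defined as unions over all members of a coset. This collapses
  such a union for an additive map that preserves \<open>N\<close>; scalar multiplication and the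
  group action are the two instances.\<close>

lemma coset_map:
  assumes f: "\<And>v w. v \<in> carrier V \<Longrightarrow> w \<in> carrier V \<Longrightarrow> f (v \<oplus>\<^bsub>V\<^esub> w) = f v \<oplus>\<^bsub>V\<^esub> f w"
    "\<And>v. v \<in> carrier V \<Longrightarrow> f v \<in> carrier V" "\<And>v. v \<in> N \<Longrightarrow> f v \<in> N"
    and x: "x \<in> carrier V"
  shows "(\<Union>y\<in>coset x. coset (f y)) = coset (f x)"
proof -
  have "coset (f y) = coset (f x)" if y: "y \<in> coset x" for y
  proof -
    obtain h where h: "h \<in> N" "y = h \<oplus>\<^bsub>V\<^esub> x"
      using y by (auto simp: a_r_coset_def')
    then have "coset (f y) = coset (f h \<oplus>\<^bsub>V\<^esub> f x)"
      using x a_subset by (auto simp: f)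
    also have "\<dots> = coset (f h) <+>\<^bsub>V\<^esub> coset (f x)"
      using h x a_subset f by (subst coset_add) auto
    also have "coset (f h) = coset \<zero>\<^bsub>V\<^esub>"
      using f(3)[OF h(1)] a_rcos_const a_rcos_const[of "\<zero>\<^bsub>V\<^esub>"] by auto
    also have "coset \<zero>\<^bsub>V\<^esub> <+>\<^bsub>V\<^esub> coset (f x) = coset (f x)"
      using x f by (subst coset_add) auto
    finally show ?thesis .
  qed
  with a_rcos_self[OF x] show ?thesis by blast
qed

abbreviation "Q \<equiv> quotient_rep V N"

lemma carrier_Q: "carrier Q = coset ` carrier V"
  by (auto simp: quotient_rep_def A_RCOSETS_def')

lemma zero_Q: "\<zero>\<^bsub>Q\<^esub> = N" by (simp add: quotient_rep_def)

lemma zero_Q': "\<zero>\<^bsub>Q\<^esub> = coset \<zero>\<^bsub>V\<^esub>"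
  using a_rcos_const[of "\<zero>\<^bsub>V\<^esub>"] by (simp add: zero_Q)

lemma add_Q: "x \<in> carrier V \<Longrightarrow> y \<in> carrier V \<Longrightarrow> coset x \<oplus>\<^bsub>Q\<^esub> coset y = coset (x \<oplus>\<^bsub>V\<^esub> y)"
  by (simp add: quotient_rep_def coset_add)

lemma smult_Q: "x \<in> carrier V \<Longrightarrow> c \<odot>\<^bsub>Q\<^esub> coset x = coset (c \<odot>\<^bsub>V\<^esub> x)"
  using coset_map[of "\<lambda>v. c \<odot>\<^bsub>V\<^esub> v" x] complex_submoduleD(4)[OF sub]
  by (simp add: quotient_rep_def smult_r_distr)

lemma act_Q: "g \<in> carrier G \<Longrightarrow> x \<in> carrier V \<Longrightarrow> act Q g (coset x) = coset (act V g x)"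
  using coset_map[of "act V g" x] subrep
  by (simp add: quotient_rep_def subrep_def representationD[OF rep])

lemma representation_Q: "representation G Q"
proof -
  have "abelian_group Q"
  proof (rule abelian_groupI)
    fix x assume "x \<in> carrier Q"
    then obtain v where v: "v \<in> carrier V" "x = coset v" by (auto simp: carrier_Q)
    then show "\<exists>y\<in>carrier Q. y \<oplus>\<^bsub>Q\<^esub> x = \<zero>\<^bsub>Q\<^esub>"
      by (intro bexI[of _ "coset (\<ominus>\<^bsub>V\<^esub> v)"]) (auto simp: add_Q zero_Q' l_neg carrier_Q)
  qed (auto simp: carrier_Q add_Q zero_Q' a_ac)
  then have "Module.module complex_ring Q"
    by (rule complex_moduleI)
      (auto simp: carrier_Q add_Q smult_Q smult_l_distr smult_r_distr smult_assoc1
        smult_l_distr[simplified] smult_assoc1[simplified] smult_one[simplified])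
  moreover have "\<one>\<^bsub>G\<^esub> \<in> carrier G"
    and "\<And>g h. g \<in> carrier G \<Longrightarrow> h \<in> carrier G \<Longrightarrow> g \<otimes>\<^bsub>G\<^esub> h \<in> carrier G"
    using representationD(1)[OF rep] by (simp_all add: group_def monoid.m_closed)
  ultimately show ?thesis
    using representationD[OF rep]
    by (auto simp: representation_def carrier_Q add_Q smult_Q act_Q)
qed

end

section \<open>Direct sums and inverse isomorphisms\<close>

lemma representation_direct_sum:
  assumes G: "group G" and V: "\<And>i. i \<in> I \<Longrightarrow> representation G (V i)"
  shows "representation G (direct_sum I V)"
proof -
  note D = V[THEN representationD(2)] V[THEN representationD(3)]
  have [simp]: "\<zero>\<^bsub>direct_sum I V\<^esub> = (\<lambda>i\<in>I. \<zero>\<^bsub>V i\<^esub>)"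
    "f \<oplus>\<^bsub>direct_sum I V\<^esub> g = (\<lambda>i\<in>I. f i \<oplus>\<^bsub>V i\<^esub> g i)"
    "c \<odot>\<^bsub>direct_sum I V\<^esub> f = (\<lambda>i\<in>I. c \<odot>\<^bsub>V i\<^esub> f i)"
    "act (direct_sum I V) \<sigma> f = (\<lambda>i\<in>I. act (V i) \<sigma> (f i))" for f g c \<sigma>
    by (simp_all add: direct_sum_def)
  have carr: "f \<in> carrier (direct_sum I V) \<longleftrightarrow>
    f \<in> extensional I \<and> (\<forall>i\<in>I. f i \<in> carrier (V i)) \<and> finite {i \<in> I. f i \<noteq> \<zero>\<^bsub>V i\<^esub>}" for f
    by (auto simp: direct_sum_def PiE_def)
  have [simp]: "f i \<in> carrier (V i)" if "f \<in> carrier (direct_sum I V)" "i \<in> I" for f i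
    using that by (auto simp: carr)
  have ext: "f = g" if "f \<in> carrier (direct_sum I V)" "g \<in> extensional I" "\<And>i. i \<in> I \<Longrightarrow> f i = g i" for f g
    using that by (intro extensionalityI[of f I g]) (auto simp: carr)
  have [simp]: "\<zero>\<^bsub>V i\<^esub> \<in> carrier (V i)" if "i \<in> I" for i
    using representation_closed(1)[OF V[OF that]] .
  have [simp]: "\<ominus>\<^bsub>V i\<^esub> \<zero>\<^bsub>V i\<^esub> = \<zero>\<^bsub>V i\<^esub>" if "i \<in> I" for i
    using abelian_group.r_neg[OF D(2), of i "\<zero>\<^bsub>V i\<^esub>"] abelian_group.a_inv_closed[OF D(2), of i "\<zero>\<^bsub>V i\<^esub>"]
      abelian_monoid.l_zero[of "V i" "\<ominus>\<^bsub>V i\<^esub> \<zero>\<^bsub>V i\<^esub>"] D(2) that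
    by (auto simp: abelian_group_def)
  \<comment> \<open>A componentwise map cannot enlarge the support when each component sends zero to
    zero.\<close>
  have closed: "(\<lambda>i\<in>I. h i (f i)) \<in> carrier (direct_sum I V)"
    if "f \<in> carrier (direct_sum I V)" "\<And>i v. i \<in> I \<Longrightarrow> v \<in> carrier (V i) \<Longrightarrow> h i v \<in> carrier (V i)"
      "\<And>i. i \<in> I \<Longrightarrow> h i \<zero>\<^bsub>V i\<^esub> = \<zero>\<^bsub>V i\<^esub>" for f h
    using that by (auto simp: carr elim!: rev_finite_subset)
  have add_closed: "(\<lambda>i\<in>I. f i \<oplus>\<^bsub>V i\<^esub> g i) \<in> carrier (direct_sum I V)"
    if "f \<in> carrier (direct_sum I V)" "g \<in> carrier (direct_sum I V)" for f g
  proof -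
    have "{i \<in> I. f i \<oplus>\<^bsub>V i\<^esub> g i \<noteq> \<zero>\<^bsub>V i\<^esub>} \<subseteq> {i \<in> I. f i \<noteq> \<zero>\<^bsub>V i\<^esub>} \<union> {i \<in> I. g i \<noteq> \<zero>\<^bsub>V i\<^esub>}"
      using D(2) by (auto simp: abelian_monoid.l_zero abelian_group_def)
    from finite_subset[OF this] that show ?thesis
      using V by (auto simp: carr intro!: representation_closed(2) cong: conj_cong)
  qed
  have smult_closed: "(\<lambda>i\<in>I. c \<odot>\<^bsub>V i\<^esub> f i) \<in> carrier (direct_sum I V)"
    if "f \<in> carrier (direct_sum I V)" for f c
    using D(1) by (intro closed[of f "\<lambda>i v. c \<odot>\<^bsub>V i\<^esub> v"] that representation_closed(3)[OF V])
      (auto intro: module.smult_r_null[OF D(1)])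
  have act_closed: "(\<lambda>i\<in>I. act (V i) \<sigma> (f i)) \<in> carrier (direct_sum I V)"
    if "f \<in> carrier (direct_sum I V)" "\<sigma> \<in> carrier G" for f \<sigma>
    using that V by (intro closed[of f "\<lambda>i v. act (V i) \<sigma> v"]) (auto simp: representationD(4)[OF V] act_zero[OF V])
  have "abelian_group (direct_sum I V)"
  proof (rule abelian_groupI)
    fix f assume f: "f \<in> carrier (direct_sum I V)"
    show "\<exists>g\<in>carrier (direct_sum I V). g \<oplus>\<^bsub>direct_sum I V\<^esub> f = \<zero>\<^bsub>direct_sum I V\<^esub>"
      using f D(2)
      by (intro bexI[of _ "\<lambda>i\<in>I. \<ominus>\<^bsub>V i\<^esub> f i"] closed[of f "\<lambda>i v. \<ominus>\<^bsub>V i\<^esub> v"])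
        (auto intro!: restrict_ext simp: abelian_group.l_neg abelian_group.a_inv_closed)
    show "\<zero>\<^bsub>direct_sum I V\<^esub> \<oplus>\<^bsub>direct_sum I V\<^esub> f = f"
      using f D(2) by (intro ext[symmetric]) (auto simp: abelian_monoid.l_zero abelian_group_def)
  next
    show "\<zero>\<^bsub>direct_sum I V\<^esub> \<in> carrier (direct_sum I V)" by (simp add: carr cong: conj_cong)
  next
    fix f g h assume "f \<in> carrier (direct_sum I V)" "g \<in> carrier (direct_sum I V)" "h \<in> carrier (direct_sum I V)"
    with D(2) show "f \<oplus>\<^bsub>direct_sum I V\<^esub> g \<oplus>\<^bsub>direct_sum I V\<^esub> h = f \<oplus>\<^bsub>direct_sum I V\<^esub> (g \<oplus>\<^bsub>direct_sum I V\<^esub> h)"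
      by (auto intro!: restrict_ext simp: abelian_monoid.a_assoc abelian_group_def)
  next
    fix f g assume "f \<in> carrier (direct_sum I V)" "g \<in> carrier (direct_sum I V)"
    with D(2) show "f \<oplus>\<^bsub>direct_sum I V\<^esub> g = g \<oplus>\<^bsub>direct_sum I V\<^esub> f"
      by (auto intro!: restrict_ext simp: abelian_monoid.a_comm abelian_group_def)
  qed (simp add: add_closed)
  then have "Module.module complex_ring (direct_sum I V)"
  proof (rule complex_moduleI)
    fix f assume f: "f \<in> carrier (direct_sum I V)"
    show "1 \<odot>\<^bsub>direct_sum I V\<^esub> f = f"
      using f module.smult_one[OF D(1), simplified] by (intro ext[symmetric]) auto
    show "(a + b) \<odot>\<^bsub>direct_sum I V\<^esub> f = a \<odot>\<^bsub>direct_sum I V\<^esub> f \<oplus>\<^bsub>direct_sum I V\<^esub> b \<odot>\<^bsub>direct_sum I V\<^esub> f" for a b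
      using f module.smult_l_distr[OF D(1), simplified] by (auto intro!: restrict_ext)
    show "(a * b) \<odot>\<^bsub>direct_sum I V\<^esub> f = a \<odot>\<^bsub>direct_sum I V\<^esub> (b \<odot>\<^bsub>direct_sum I V\<^esub> f)" for a b
      using f module.smult_assoc1[OF D(1), simplified] by (auto intro!: restrict_ext)
    fix g c assume "g \<in> carrier (direct_sum I V)"
    then show "c \<odot>\<^bsub>direct_sum I V\<^esub> (f \<oplus>\<^bsub>direct_sum I V\<^esub> g) = c \<odot>\<^bsub>direct_sum I V\<^esub> f \<oplus>\<^bsub>direct_sum I V\<^esub> c \<odot>\<^bsub>direct_sum I V\<^esub> g"
      using f module.smult_r_distr[OF D(1), simplified] by (auto intro!: restrict_ext)
  qed (simp add: smult_closed)
  moreover have "act (direct_sum I V) \<one>\<^bsub>G\<^esub> f = f" if "f \<in> carrier (direct_sum I V)" for f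
    using that by (intro ext[symmetric]) (auto simp: representationD(7)[OF V])
  ultimately show ?thesis
    using G by (auto simp: representation_def[of G "direct_sum I V"] act_closed representationD(5,6,8)[OF V] intro!: restrict_ext)
qed

text \<open>The isomorphism is constructed out of the direct sum, whose elements are tuples of
  tensors; this turns it around to the direction of the theorem.\<close>

lemma isomorphic_reps_sym:
  assumes "isomorphic_reps G V W"
  shows "isomorphic_reps G W V"
proof -
  from assms have V: "representation G V" and W: "representation G W"
    by (auto simp: isomorphic_reps_def)
  from assms obtain \<phi> where bij: "bij_betw \<phi> (carrier V) (carrier W)"
    and add: "\<And>v w. v \<in> carrier V \<Longrightarrow> w \<in> carrier V \<Longrightarrow> \<phi> (v \<oplus>\<^bsub>V\<^esub> w) = \<phi> v \<oplus>\<^bsub>W\<^esub> \<phi> w"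
    and smult: "\<And>c v. v \<in> carrier V \<Longrightarrow> \<phi> (c \<odot>\<^bsub>V\<^esub> v) = c \<odot>\<^bsub>W\<^esub> \<phi> v"
    and act: "\<And>g v. g \<in> carrier G \<Longrightarrow> v \<in> carrier V \<Longrightarrow> \<phi> (act V g v) = act W g (\<phi> v)"
    by (auto simp: isomorphic_reps_def)
  define \<psi> where "\<psi> = the_inv_into (carrier V) \<phi>"
  have \<psi>: "\<psi> (\<phi> v) = v" if "v \<in> carrier V" for v
    using bij that by (simp add: \<psi>_def bij_betw_def the_inv_into_f_f)
  have surj: "\<exists>v\<in>carrier V. w = \<phi> v" if "w \<in> carrier W" for w
    using bij that by (auto simp: bij_betw_def)
  have "bij_betw \<psi> (carrier W) (carrier V)"
    using bij by (simp add: \<psi>_def bij_betw_the_inv_into)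
  moreover have "\<psi> (x \<oplus>\<^bsub>W\<^esub> y) = \<psi> x \<oplus>\<^bsub>V\<^esub> \<psi> y" if "x \<in> carrier W" "y \<in> carrier W" for x y
    using surj[OF that(1)] surj[OF that(2)]
    by (auto simp: \<psi> representation_closed[OF V] simp flip: add)
  moreover have "\<psi> (c \<odot>\<^bsub>W\<^esub> x) = c \<odot>\<^bsub>V\<^esub> \<psi> x" if "x \<in> carrier W" for x c
    using surj[OF that] by (auto simp: \<psi> representation_closed[OF V] simp flip: smult)
  moreover have "\<psi> (act W g x) = act V g (\<psi> x)" if "g \<in> carrier G" "x \<in> carrier W" for x g
    using surj[OF that(2)] that(1) by (auto simp: \<psi> representationD[OF V] simp flip: act)
  ultimately show ?thesis using V W unfolding isomorphic_reps_def by blast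
qed

section \<open>Free representations, tensor products and symmetric powers\<close>

text \<open>\<open>lin_span\<close> is an intersection of submodules. Induction is available because
  the members of the span that satisfy \<open>P\<close> again form a submodule containing
  \<open>A\<close>.\<close>

lemma lin_span_induct [consumes 3, case_names zero base add smult]:
  assumes f: "f \<in> lin_span V A" and V: "Module.module complex_ring V" and A: "A \<subseteq> carrier V"
    and "P \<zero>\<^bsub>V\<^esub>" and "\<And>a. a \<in> A \<Longrightarrow> P a"
    and "\<And>a b. a \<in> lin_span V A \<Longrightarrow> b \<in> lin_span V A \<Longrightarrow> P a \<Longrightarrow> P b \<Longrightarrow> P (a \<oplus>\<^bsub>V\<^esub> b)"
    and "\<And>c a. a \<in> lin_span V A \<Longrightarrow> P a \<Longrightarrow> P (c \<odot>\<^bsub>V\<^esub> a)"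
  shows "P f"
proof -
  note D = complex_submoduleD[OF submodule_lin_span[OF V A]]
  have "submodule {f \<in> lin_span V A. P f} complex_ring V"
    using D assms by (intro complex_submoduleI[OF V]) auto
  from lin_span_minimal[OF this, of A] f lin_span_superset[of A V] assms(5) show ?thesis by auto
qed

section \<open>Free vector spaces of finitely supported functions\<close>

lemma lookup_map_times [simp]: "Poly_Mapping.lookup (Poly_Mapping.map ((*) c) f) x = c * Poly_Mapping.lookup f x"
  for f :: "'x \<Rightarrow>\<^sub>0 'a::mult_zero"
  by (simp add: Poly_Mapping.map.rep_eq when_def)

lemma map_times_zero [simp]: "Poly_Mapping.map ((*) c) 0 = (0 :: 'x \<Rightarrow>\<^sub>0 complex)"
  by (rule poly_mapping_eqI) simp

lemma map_times_add: "Poly_Mapping.map ((*) c) (f + g) = Poly_Mapping.map ((*) c) f + Poly_Mapping.map ((*) c) g"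
  for f g :: "'x \<Rightarrow>\<^sub>0 complex"
  by (rule poly_mapping_eqI) (simp add: lookup_add distrib_left)

lemma keys_diff_subset: "Poly_Mapping.keys (f - g) \<subseteq> Poly_Mapping.keys f \<union> Poly_Mapping.keys g"
  for f g :: "'x \<Rightarrow>\<^sub>0 'a::cancel_comm_monoid_add"
  by (auto simp: in_keys_iff lookup_minus)

lemma poly_mapping_sum_single:
  "(\<Sum>x\<in>Poly_Mapping.keys f. Poly_Mapping.single x (Poly_Mapping.lookup f x)) = f"
  for f :: "'x \<Rightarrow>\<^sub>0 complex"
  by (rule poly_mapping_eqI)
    (auto simp: lookup_sum lookup_single when_def in_keys_iff sum.delta)

lemma free_carrier_add: "Poly_Mapping.keys f \<subseteq> X \<Longrightarrow> Poly_Mapping.keys g \<subseteq> X \<Longrightarrow> Poly_Mapping.keys (f + g) \<subseteq> X"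
  using Poly_Mapping.keys_add[of f g] by auto

lemma free_induct [consumes 1, case_names zero single add]:
  fixes f :: "'x \<Rightarrow>\<^sub>0 complex"
  assumes "Poly_Mapping.keys f \<subseteq> X"
    and "P 0" and single: "\<And>x c. x \<in> X \<Longrightarrow> P (Poly_Mapping.single x c)"
    and add: "\<And>f g. Poly_Mapping.keys f \<subseteq> X \<Longrightarrow> Poly_Mapping.keys g \<subseteq> X \<Longrightarrow> P f \<Longrightarrow> P g \<Longrightarrow> P (f + g)"
  shows "P f"
proof -
  let ?S = "\<lambda>A. \<Sum>x\<in>A. Poly_Mapping.single x (Poly_Mapping.lookup f x)"
  have "Poly_Mapping.keys (?S A) \<subseteq> X \<and> P (?S A)" if "finite A" "A \<subseteq> X" for A
    using that
  proof (induction A)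
    case (insert a A)
    then show ?case
      by (simp add: free_carrier_add single add)
  qed (simp add: \<open>P 0\<close>)
  from this[of "Poly_Mapping.keys f"] assms(1) show ?thesis by (simp add: poly_mapping_sum_single)
qed

text \<open>Linear extension from the basis to the free space. Both the coefficient functionals of
  symmetric powers and the function attached to a tensor arise from it.\<close>

definition lext :: "('x \<Rightarrow> complex) \<Rightarrow> ('x \<Rightarrow>\<^sub>0 complex) \<Rightarrow> complex" where
  "lext \<phi> f = (\<Sum>x\<in>Poly_Mapping.keys f. Poly_Mapping.lookup f x * \<phi> x)"

lemma lext_zero [simp]: "lext \<phi> 0 = 0"
  by (simp add: lext_def)

lemma lext_single [simp]: "lext \<phi> (Poly_Mapping.single x c) = c * \<phi> x"
  by (simp add: lext_def)

lemma lext_add: "lext \<phi> (f + g) = lext \<phi> f + lext \<phi> g"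
  unfolding lext_def
  by (rule setsum_keys_plus_distrib[where f = "\<lambda>x c. c * \<phi> x"]) (auto simp: distrib_right)

lemma lext_diff: "lext \<phi> (f - g) = lext \<phi> f - lext \<phi> g"
  using lext_add[of \<phi> "f - g" g] by simp

lemma lext_map_times: "lext \<phi> (Poly_Mapping.map ((*) c) f) = c * lext \<phi> f"
proof -
  have "lext \<phi> (Poly_Mapping.map ((*) c) f) = (\<Sum>x\<in>Poly_Mapping.keys f. c * Poly_Mapping.lookup f x * \<phi> x)"
    unfolding lext_def by (rule sum.mono_neutral_cong_left) (auto simp: in_keys_iff)
  then show ?thesis by (simp add: lext_def sum_distrib_left mult.assoc)
qed

lemma lext_sum: "lext \<phi> (\<Sum>i\<in>I. f i) = (\<Sum>i\<in>I. lext \<phi> (f i))"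
  by (induction I rule: infinite_finite_induct) (auto simp: lext_add)

lemma carrier_free_rep [simp]: "carrier (free_rep \<alpha> X) = {f. Poly_Mapping.keys f \<subseteq> X}"
  and zero_free_rep [simp]: "\<zero>\<^bsub>free_rep \<alpha> X\<^esub> = 0"
  and add_free_rep [simp]: "f \<oplus>\<^bsub>free_rep \<alpha> X\<^esub> g = f + g"
  and smult_free_rep [simp]: "c \<odot>\<^bsub>free_rep \<alpha> X\<^esub> f = Poly_Mapping.map ((*) c) f"
  by (simp_all add: free_rep_def)

lemma act_free_rep_zero [simp]: "act (free_rep \<alpha> X) g 0 = 0"
  by (simp add: free_rep_def)

lemma act_free_rep_single [simp]:
  "act (free_rep \<alpha> X) g (Poly_Mapping.single x c) = Poly_Mapping.single (\<alpha> g x) c"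
  by (simp add: free_rep_def)

lemma act_free_rep_add:
  "act (free_rep \<alpha> X) g (f + f') = act (free_rep \<alpha> X) g f + act (free_rep \<alpha> X) g f'"
  unfolding free_rep_def rep.simps
  by (rule setsum_keys_plus_distrib[where f = "\<lambda>x c. Poly_Mapping.single (\<alpha> g x) c"]) (auto simp: single_add)

lemma act_free_rep_diff:
  "act (free_rep \<alpha> X) g (f - f') = act (free_rep \<alpha> X) g f - act (free_rep \<alpha> X) g f'"
  using act_free_rep_add[of \<alpha> X g "f - f'" f'] by simp

lemma lext_act_free_rep: "lext \<phi> (act (free_rep \<alpha> X) g f) = lext (\<lambda>x. \<phi> (\<alpha> g x)) f"
  by (simp add: free_rep_def lext_sum) (simp add: lext_def)

lemma free_carrier_diff: "Poly_Mapping.keys f \<subseteq> X \<Longrightarrow> Poly_Mapping.keys g \<subseteq> X \<Longrightarrow> Poly_Mapping.keys (f - g) \<subseteq> X"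
  for f :: "'x \<Rightarrow>\<^sub>0 'a::cancel_comm_monoid_add"
  using keys_diff_subset[of f g] by auto

lemma abelian_group_free_rep: "abelian_group (free_rep \<alpha> X)"
proof (rule abelian_groupI)
  fix f assume "f \<in> carrier (free_rep \<alpha> X)"
  then show "\<exists>g\<in>carrier (free_rep \<alpha> X). g \<oplus>\<^bsub>free_rep \<alpha> X\<^esub> f = \<zero>\<^bsub>free_rep \<alpha> X\<^esub>"
    by (intro bexI[of _ "- f"]) (auto simp: in_keys_iff)
qed (simp_all add: free_carrier_add ac_simps)

lemma module_free_rep: "Module.module complex_ring (free_rep \<alpha> X)"
  using abelian_group_free_rep
  by (rule complex_moduleI)
    (auto simp: in_keys_iff lookup_add algebra_simps intro!: poly_mapping_eqI)

lemma minus_free_rep: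
  assumes "Poly_Mapping.keys f \<subseteq> X" "Poly_Mapping.keys g \<subseteq> X"
  shows "f \<ominus>\<^bsub>free_rep \<alpha> X\<^esub> g = f - g"
proof -
  interpret abelian_group "free_rep \<alpha> X" by (rule abelian_group_free_rep)
  have "\<ominus>\<^bsub>free_rep \<alpha> X\<^esub> g = - g"
    using assms by (intro minus_equality) (auto simp: in_keys_iff)
  then show ?thesis by (simp add: a_minus_def)
qed

lemma representation_free_rep:
  assumes G: "group G"
    and closed: "\<And>g x. g \<in> carrier G \<Longrightarrow> x \<in> X \<Longrightarrow> \<alpha> g x \<in> X"
    and one: "\<And>x. x \<in> X \<Longrightarrow> \<alpha> \<one>\<^bsub>G\<^esub> x = x"
    and mult: "\<And>g h x. g \<in> carrier G \<Longrightarrow> h \<in> carrier G \<Longrightarrow> x \<in> X \<Longrightarrow> \<alpha> (g \<otimes>\<^bsub>G\<^esub> h) x = \<alpha> g (\<alpha> h x)"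
  shows "representation G (free_rep \<alpha> X)"
proof -
  let ?F = "free_rep \<alpha> X"
  have "Poly_Mapping.keys (act ?F g f) \<subseteq> X" if "g \<in> carrier G" "Poly_Mapping.keys f \<subseteq> X" for g f
    using that(2)
    by (induction rule: free_induct)
      (use that closed in \<open>simp_all add: act_free_rep_add free_carrier_add\<close>)
  moreover have "act ?F g (Poly_Mapping.map ((*) c) f) = Poly_Mapping.map ((*) c) (act ?F g f)" 
    if "g \<in> carrier G" "Poly_Mapping.keys f \<subseteq> X" for g c f
    using that(2)
    by (induction rule: free_induct) (use that closed in \<open>auto simp: act_free_rep_add map_times_add\<close>)
  moreover have "act ?F \<one>\<^bsub>G\<^esub> f = f" if "Poly_Mapping.keys f \<subseteq> X" for f
    using that by (induction rule: free_induct) (use one in \<open>auto simp: act_free_rep_add\<close>)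
  moreover have "act ?F (g \<otimes>\<^bsub>G\<^esub> h) f = act ?F g (act ?F h f)" 
    if "g \<in> carrier G" "h \<in> carrier G" "Poly_Mapping.keys f \<subseteq> X" for g h f
    using that(3) by (induction rule: free_induct) (use that mult in \<open>auto simp: act_free_rep_add\<close>)
  ultimately show ?thesis
    using G by (simp add: representation_def module_free_rep act_free_rep_add)
qed

text \<open>The zeros of a functional form a subspace, so it descends to the quotient as soon as it
  kills the relations.\<close>

lemma lext_lin_span_eq_0:
  assumes "f \<in> lin_span (free_rep \<alpha> X) R" "R \<subseteq> carrier (free_rep \<alpha> X)"
    and "\<And>a. a \<in> R \<Longrightarrow> lext \<phi> a = 0"
  shows "lext \<phi> f = 0"
  using assms(1) module_free_rep assms(2)
  by (induction rule: lin_span_induct) (auto simp: assms lext_add lext_map_times)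

section \<open>Tensor products\<close>

definition tensor_free where
  "tensor_free V W = free_rep (\<lambda>g (v, w). (act V g v, act W g w)) (carrier V \<times> carrier W)"

definition tensor_kernel where
  "tensor_kernel V W = lin_span (tensor_free V W) (tensor_relations V W)"

lemma tensor_rep_eq: "tensor_rep V W = quotient_rep (tensor_free V W) (tensor_kernel V W)"
  by (simp add: tensor_rep_def tensor_kernel_def tensor_free_def Let_def)

lemma tensor_relationsI:
  shows "v \<in> carrier V \<Longrightarrow> v' \<in> carrier V \<Longrightarrow> w \<in> carrier W \<Longrightarrow>
      basis_elem (v \<oplus>\<^bsub>V\<^esub> v', w) - basis_elem (v, w) - basis_elem (v', w) \<in> tensor_relations V W"
    and "v \<in> carrier V \<Longrightarrow> w \<in> carrier W \<Longrightarrow> w' \<in> carrier W \<Longrightarrow>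
      basis_elem (v, w \<oplus>\<^bsub>W\<^esub> w') - basis_elem (v, w) - basis_elem (v, w') \<in> tensor_relations V W"
    and "v \<in> carrier V \<Longrightarrow> w \<in> carrier W \<Longrightarrow>
      basis_elem (c \<odot>\<^bsub>V\<^esub> v, w) - Poly_Mapping.single (v, w) c \<in> tensor_relations V W"
    and "v \<in> carrier V \<Longrightarrow> w \<in> carrier W \<Longrightarrow>
      basis_elem (v, c \<odot>\<^bsub>W\<^esub> w) - Poly_Mapping.single (v, w) c \<in> tensor_relations V W"
  unfolding tensor_relations_def by blast+

lemma tensor_relations_cases:
  assumes "a \<in> tensor_relations V W"
  obtains v v' w where "a = basis_elem (v \<oplus>\<^bsub>V\<^esub> v', w) - basis_elem (v, w) - basis_elem (v', w)"
      "v \<in> carrier V" "v' \<in> carrier V" "w \<in> carrier W"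
  | v w w' where "a = basis_elem (v, w \<oplus>\<^bsub>W\<^esub> w') - basis_elem (v, w) - basis_elem (v, w')"
      "v \<in> carrier V" "w \<in> carrier W" "w' \<in> carrier W"
  | c v w where "a = basis_elem (c \<odot>\<^bsub>V\<^esub> v, w) - Poly_Mapping.single (v, w) c"
      "v \<in> carrier V" "w \<in> carrier W"
  | c v w where "a = basis_elem (v, c \<odot>\<^bsub>W\<^esub> w) - Poly_Mapping.single (v, w) c"
      "v \<in> carrier V" "w \<in> carrier W"
  by (insert assms, unfold tensor_relations_def, elim UnE CollectE exE conjE; (rule that; assumption))

lemma tensor_relations_carrier:
  assumes V: "representation G V" and W: "representation G W"
  shows "tensor_relations V W \<subseteq> carrier (tensor_free V W)"
proof
  fix a assume "a \<in> tensor_relations V W"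
  then show "a \<in> carrier (tensor_free V W)"
    by (cases rule: tensor_relations_cases)
      (simp_all add: tensor_free_def representation_closed[OF V] representation_closed[OF W] free_carrier_diff)
qed

text \<open>The group acts linearly on both factors, hence sends each relation to a relation of the
  same kind, and the kernel is stable.\<close>

lemma rep_quotient_tensor:
  assumes V: "representation G V" and W: "representation G W"
  shows "rep_quotient G (tensor_free V W) (tensor_kernel V W)"
proof
  show F: "representation G (tensor_free V W)"
    unfolding tensor_free_def
  proof (rule representation_free_rep[OF representationD(1)[OF V]])
    fix x assume x: "x \<in> carrier V \<times> carrier W"
    show "(case x of (v, w) \<Rightarrow> (act V \<one>\<^bsub>G\<^esub> v, act W \<one>\<^bsub>G\<^esub> w)) = x"
      using x by (auto simp: representationD(7)[OF V] representationD(7)[OF W])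
    fix g assume g: "g \<in> carrier G"
    show "(case x of (v, w) \<Rightarrow> (act V g v, act W g w)) \<in> carrier V \<times> carrier W"
      using x by (auto simp: representationD(4)[OF V g] representationD(4)[OF W g])
    fix h assume h: "h \<in> carrier G"
    show "(case x of (v, w) \<Rightarrow> (act V (g \<otimes>\<^bsub>G\<^esub> h) v, act W (g \<otimes>\<^bsub>G\<^esub> h) w)) =
      (case (case x of (v, w) \<Rightarrow> (act V h v, act W h w)) of (v, w) \<Rightarrow> (act V g v, act W g w))"
      using x by (auto simp: representationD(8)[OF V g h] representationD(8)[OF W g h])
  qed
  show "subrep G (tensor_free V W) (tensor_kernel V W)"
    unfolding tensor_kernel_def
  proof (rule subrep_lin_span[OF F tensor_relations_carrier[OF V W]])
    fix g a assume g: "g \<in> carrier G" and "a \<in> tensor_relations V W"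
    from this(2) have "act (tensor_free V W) g a \<in> tensor_relations V W"
    proof (cases rule: tensor_relations_cases)
      case (1 v v' w)
      show ?thesis
        unfolding 1(1) tensor_free_def act_free_rep_diff act_free_rep_single prod.case representationD(5)[OF V g 1(2,3)]
        by (intro tensor_relationsI representationD(4)[OF V g] representationD(4)[OF W g] 1(2-))
    next
      case (2 v w w')
      show ?thesis
        unfolding 2(1) tensor_free_def act_free_rep_diff act_free_rep_single prod.case representationD(5)[OF W g 2(3,4)]
        by (intro tensor_relationsI representationD(4)[OF V g] representationD(4)[OF W g] 2(2-))
    next
      case (3 c v w)
      show ?thesis
        unfolding 3(1) tensor_free_def act_free_rep_diff act_free_rep_single prod.case representationD(6)[OF V g 3(2)]
        by (intro tensor_relationsI representationD(4)[OF V g] representationD(4)[OF W g] 3(2-))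
    next
      case (4 c v w)
      show ?thesis
        unfolding 4(1) tensor_free_def act_free_rep_diff act_free_rep_single prod.case representationD(6)[OF W g 4(3)]
        by (intro tensor_relationsI representationD(4)[OF V g] representationD(4)[OF W g] 4(2-))
    qed
    then show "act (tensor_free V W) g a \<in> lin_span (tensor_free V W) (tensor_relations V W)"
      by (rule subsetD[OF lin_span_superset])
  qed
qed

section \<open>Symmetric powers\<close>

definition sym_free where
  "sym_free V k = free_rep (\<lambda>g. map (act V g)) (sym_generators V k)"

definition sym_kernel where
  "sym_kernel V k = lin_span (sym_free V k) (sym_relations V k)"

lemma sym_power_eq: "sym_power V k = quotient_rep (sym_free V k) (sym_kernel V k)"
  by (simp add: sym_power_def sym_kernel_def sym_free_def Let_def)

lemma sym_generators_update:
  "vs \<in> sym_generators V k \<Longrightarrow> v \<in> carrier V \<Longrightarrow> vs[i := v] \<in> sym_generators V k"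
  unfolding sym_generators_def using set_update_subset_insert[of vs i v]
  by (simp, meson dual_order.trans insert_subsetI)

lemma sym_generators_mset: "vs \<in> sym_generators V k \<Longrightarrow> mset vs = mset ws \<Longrightarrow> ws \<in> sym_generators V k"
  unfolding sym_generators_def by (metis (mono_tags, lifting) mem_Collect_eq mset_eq_length mset_eq_setD)

lemma sym_relationsI:
  assumes "vs \<in> sym_generators V k"
  shows "mset vs = mset ws \<Longrightarrow> basis_elem vs - basis_elem ws \<in> sym_relations V k"
    and "i < length vs \<Longrightarrow> v \<in> carrier V \<Longrightarrow> v' \<in> carrier V \<Longrightarrow>
      basis_elem (vs[i := v \<oplus>\<^bsub>V\<^esub> v']) - basis_elem (vs[i := v]) - basis_elem (vs[i := v']) \<in> sym_relations V k"
    and "i < length vs \<Longrightarrow> v \<in> carrier V \<Longrightarrow>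
      basis_elem (vs[i := c \<odot>\<^bsub>V\<^esub> v]) - Poly_Mapping.single (vs[i := v]) c \<in> sym_relations V k"
  by (insert assms, unfold sym_relations_def)
    ((rule UnI1, rule UnI1, rule CollectI, intro exI conjI, rule refl, assumption+),
     (rule UnI1, rule UnI2, rule CollectI, intro exI conjI, rule refl, assumption+),
     (rule UnI2, rule CollectI, intro exI conjI, rule refl, assumption+))

lemma sym_relations_cases:
  assumes "a \<in> sym_relations V k"
  obtains vs ws where "a = basis_elem vs - basis_elem ws" "vs \<in> sym_generators V k" "mset vs = mset ws"
  | vs i v v' where "a = basis_elem (vs[i := v \<oplus>\<^bsub>V\<^esub> v']) - basis_elem (vs[i := v]) - basis_elem (vs[i := v'])"
      "vs \<in> sym_generators V k" "i < length vs" "v \<in> carrier V" "v' \<in> carrier V"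
  | vs i c v where "a = basis_elem (vs[i := c \<odot>\<^bsub>V\<^esub> v]) - Poly_Mapping.single (vs[i := v]) c"
      "vs \<in> sym_generators V k" "i < length vs" "v \<in> carrier V"
  by (insert assms, unfold sym_relations_def, elim UnE CollectE exE conjE; (rule that; assumption))

lemma sym_relations_carrier:
  assumes V: "representation G V"
  shows "sym_relations V k \<subseteq> carrier (sym_free V k)"
proof
  fix a assume "a \<in> sym_relations V k"
  then show "a \<in> carrier (sym_free V k)"
  proof (cases rule: sym_relations_cases)
    case (1 vs ws)
    then show ?thesis using sym_generators_mset[OF 1(2-3)] by (simp add: sym_free_def free_carrier_diff)
  qed (simp_all add: sym_free_def representation_closed[OF V] sym_generators_update free_carrier_diff)
qed

text \<open>Applying \<open>g\<close> to every entry of a list commutes with reordering the entries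
  and with updating one of them, so relations go to relations.\<close>

lemma rep_quotient_sym:
  assumes V: "representation G V"
  shows "rep_quotient G (sym_free V k) (sym_kernel V k)"
proof
  have map_closed: "map (act V g) vs \<in> sym_generators V k" if "g \<in> carrier G" "vs \<in> sym_generators V k" for g vs
    using that representationD(4)[OF V] by (auto simp: sym_generators_def)
  show F: "representation G (sym_free V k)"
    unfolding sym_free_def
  proof (rule representation_free_rep[OF representationD(1)[OF V]])
    show "map (act V \<one>\<^bsub>G\<^esub>) vs = vs" if "vs \<in> sym_generators V k" for vs
      using that by (intro map_idI) (auto simp: sym_generators_def intro: representationD(7)[OF V])
    show "map (act V (g \<otimes>\<^bsub>G\<^esub> h)) vs = map (act V g) (map (act V h) vs)"
      if "g \<in> carrier G" "h \<in> carrier G" "vs \<in> sym_generators V k" for g h vs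
      using that by (auto simp: sym_generators_def intro: representationD(8)[OF V])
  qed (rule map_closed)
  show "subrep G (sym_free V k) (sym_kernel V k)"
    unfolding sym_kernel_def
  proof (rule subrep_lin_span[OF F sym_relations_carrier[OF V]])
    fix g a assume g: "g \<in> carrier G" and "a \<in> sym_relations V k"
    from this(2) have "act (sym_free V k) g a \<in> sym_relations V k"
    proof (cases rule: sym_relations_cases)
      case (1 vs ws)
      then show ?thesis using sym_relationsI(1)[OF map_closed[OF g 1(2)], of "map (act V g) ws"]
        by (simp add: sym_free_def act_free_rep_diff)
    next
      case (2 vs i v v')
      then show ?thesis
        using sym_relationsI(2)[OF map_closed[OF g 2(2)], of i "act V g v" "act V g v'"] representationD(4-5)[OF V g]
        by (simp add: sym_free_def act_free_rep_diff map_update)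
    next
      case (3 vs i c v)
      then show ?thesis
        using sym_relationsI(3)[OF map_closed[OF g 3(2)], of i "act V g v" c] representationD(4,6)[OF V g]
        by (simp add: sym_free_def act_free_rep_diff map_update)
    qed
    then show "act (sym_free V k) g a \<in> lin_span (sym_free V k) (sym_relations V k)"
      by (rule subsetD[OF lin_span_superset])
  qed
qed

section \<open>Functions up to thin sets\<close>

lemma aff_dim_linear_image_le:
  fixes f :: "'a::euclidean_space \<Rightarrow> 'b::euclidean_space"
  assumes "linear f"
  shows "aff_dim (f ` S) \<le> aff_dim S"
proof (cases "S = {}")
  case False
  then obtain a where a: "a \<in> S" by auto
  have "aff_dim (f ` S) = int (dim ((\<lambda>x. x - f a) ` f ` S))"
    using a by (intro aff_dim_eq_dim_subtract hull_inc) auto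
  also have "(\<lambda>x. x - f a) ` f ` S = f ` (\<lambda>x. x - a) ` S"
    using assms by (simp add: image_image linear_diff)
  also have "int (dim \<dots>) \<le> int (dim ((\<lambda>x. x - a) ` S))"
    using dim_image_le[OF assms] by simp
  also have "\<dots> = aff_dim S"
    using a by (intro aff_dim_eq_dim_subtract[symmetric] hull_inc)
  finally show ?thesis .
qed simp

text \<open>These are the exceptional sets of \<open>null_functions\<close>. The bound
  \<open>CARD('n) - 1\<close> is the dimension of a hyperplane of fixed coordinate sum, in which
  each simplex or hypersimplex lies.\<close>

definition thin :: "(real ^ 'n::finite) set \<Rightarrow> bool" where
  "thin S \<longleftrightarrow> (\<exists>\<P>. finite \<P> \<and> (\<forall>P\<in>\<P>. polyhedron P \<and> aff_dim P < int CARD('n) - 1) \<and> S \<subseteq> \<Union>\<P>)"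

lemma thin_empty [simp]: "thin {}"
  by (auto simp: thin_def intro!: exI[of _ "{}"])

lemma thin_subset: "thin T \<Longrightarrow> S \<subseteq> T \<Longrightarrow> thin S"
  unfolding thin_def by (meson subset_trans)

lemma thin_polyhedron: "polyhedron S \<Longrightarrow> aff_dim S < int CARD('n) - 1 \<Longrightarrow> thin S"
  for S :: "(real ^ 'n::finite) set"
  by (auto simp: thin_def intro!: exI[of _ "{S}"])

lemma thin_Un: "thin S \<Longrightarrow> thin T \<Longrightarrow> thin (S \<union> T)"
  for S T :: "(real ^ 'n::finite) set"
  unfolding thin_def
proof (elim exE conjE)
  fix \<P> \<Q> :: "(real ^ 'n) set set"
  assume "finite \<P>" "finite \<Q>" "\<forall>P\<in>\<P>. polyhedron P \<and> aff_dim P < int CARD('n) - 1"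
    "\<forall>P\<in>\<Q>. polyhedron P \<and> aff_dim P < int CARD('n) - 1" "S \<subseteq> \<Union>\<P>" "T \<subseteq> \<Union>\<Q>"
  then show "\<exists>\<P>. finite \<P> \<and> (\<forall>P\<in>\<P>. polyhedron P \<and> aff_dim P < int CARD('n) - 1) \<and> S \<union> T \<subseteq> \<Union>\<P>"
    by (intro exI[of _ "\<P> \<union> \<Q>"]) auto
qed

lemma thin_UN: "finite I \<Longrightarrow> (\<And>i. i \<in> I \<Longrightarrow> thin (S i)) \<Longrightarrow> thin (\<Union>i\<in>I. S i)"
  by (induction I rule: finite_induct) (auto intro: thin_Un)

text \<open>The image of a polyhedron is covered by its affine hull, which has the same affine
  dimension and is a polyhedron whatever \<open>f\<close> is.\<close>

lemma thin_image:
  fixes S :: "(real ^ 'n::finite) set" and f :: "real ^ 'n \<Rightarrow> real ^ 'n"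
  assumes "thin S" and f: "\<And>P. aff_dim (f ` P) \<le> aff_dim P"
  shows "thin (f ` S)"
proof -
  from assms obtain \<P> where "finite \<P>" "S \<subseteq> \<Union>\<P>"
    and dim: "\<And>P. P \<in> \<P> \<Longrightarrow> aff_dim P < int CARD('n) - 1"
    by (auto simp: thin_def)
  then have "f ` S \<subseteq> (\<Union>P\<in>\<P>. affine hull (f ` P))"
    using hull_subset[of "f ` P" affine for P] by blast
  moreover have "thin (\<Union>P\<in>\<P>. affine hull (f ` P))"
    using \<open>finite \<P>\<close> dim f
    by (intro thin_UN thin_polyhedron) (auto simp: polyhedron_affine_hull intro: le_less_trans)
  ultimately show ?thesis by (rule thin_subset[rotated])
qed

lemma thin_translation: "thin S \<Longrightarrow> thin ((+) a ` S)"
  by (rule thin_image) (simp_all add: aff_dim_translation_eq)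

lemma thin_linear_image: "thin S \<Longrightarrow> linear f \<Longrightarrow> thin (f ` S)"
  for f :: "real ^ 'n::finite \<Rightarrow> real ^ 'n"
  by (intro thin_image aff_dim_linear_image_le)

text \<open>A second coordinate makes the two hyperplanes non-parallel, so their intersection drops
  one more dimension. The walls of the cubes are slices of this kind.\<close>

lemma thin_slice:
  assumes "CARD('n::finite) \<ge> 2"
  shows "thin {x :: real ^ 'n. (\<Sum>j\<in>UNIV. x $ j) = c \<and> x $ i = d}"
proof -
  let ?e = "(\<chi> j. 1) :: real ^ 'n" and ?a = "axis i 1 :: real ^ 'n"
  let ?S = "{x. ?e \<bullet> x = c}"
  have eq: "{x :: real ^ 'n. (\<Sum>j\<in>UNIV. x $ j) = c \<and> x $ i = d} = ?S \<inter> {x. ?a \<bullet> x = d}"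
  proof -
    have "?e \<bullet> x = (\<Sum>j\<in>UNIV. x $ j)" for x by (simp add: inner_vec_def)
    then show ?thesis by (auto simp: inner_axis')
  qed
  have "\<exists>j. j \<noteq> i"
  proof (rule ccontr)
    assume "\<not> (\<exists>j. j \<noteq> i)"
    then have "(UNIV :: 'n set) = {i}" by auto
    then have "CARD('n) = 1" by (metis card.empty card.insert empty_iff finite.emptyI One_nat_def)
    with assms show False by simp
  qed
  then obtain j where j: "j \<noteq> i" by auto
  \<comment> \<open>A point of coordinate sum \<open>c\<close> whose coordinate \<open>i\<close> is
    \<open>d + 1\<close>; it shows that the first hyperplane is not contained in the second.\<close>
  let ?x = "axis i (d + 1) + axis j (c - d - 1) :: real ^ 'n"
  have "?x \<in> ?S"
    by (simp add: inner_add_right inner_axis)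
  moreover have "?a \<bullet> ?x \<noteq> d"
  proof -
    have "?a \<bullet> ?x = ?x $ i" by (simp only: inner_axis' inner_real_def mult_1)
    then show ?thesis using j by (simp add: axis_def)
  qed
  ultimately have "\<not> ?S \<subseteq> {x. ?a \<bullet> x = d}" by blast
  moreover have "?e \<noteq> 0" by (simp add: vec_eq_iff)
  then have "aff_dim ?S = int CARD('n) - 1" by (simp add: aff_dim_hyperplane)
  ultimately have "aff_dim (?S \<inter> {x. ?a \<bullet> x = d}) < int CARD('n) - 1"
    using assms by (simp add: aff_dim_affine_Int_hyperplane affine_hyperplane)
  then show ?thesis unfolding eq by (intro thin_polyhedron) (auto simp: polyhedron_hyperplane)
qed

section \<open>The symmetric group acting on coordinates and on functions modulo thin sets\<close>

lemma carrier_Sym_group: "carrier Sym_group = {\<sigma>. bij \<sigma>}"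
  by (simp add: BijGroup_def Bij_def)

lemma one_Sym_group [simp]: "\<one>\<^bsub>Sym_group\<^esub> = (\<lambda>x. x)"
  by (simp add: BijGroup_def fun_eq_iff)

lemma mult_Sym_group: "bij \<sigma> \<Longrightarrow> bij \<tau> \<Longrightarrow> \<sigma> \<otimes>\<^bsub>Sym_group\<^esub> \<tau> = \<sigma> \<circ> \<tau>"
  by (simp add: BijGroup_def Bij_def compose_def fun_eq_iff)

lemma permute_coords_nth [simp]: "permute_coords \<sigma> x $ i = x $ inv_into UNIV \<sigma> i"
  by (simp add: permute_coords_def)

lemma permute_coords_id [simp]: "permute_coords (\<lambda>x. x) x = x"
  using inv_id by (simp add: vec_eq_iff id_def)

lemma permute_coords_comp:
  "bij \<sigma> \<Longrightarrow> bij \<tau> \<Longrightarrow> permute_coords (\<sigma> \<circ> \<tau>) x = permute_coords \<sigma> (permute_coords \<tau> x)"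
  by (simp add: vec_eq_iff o_inv_distrib bij_is_inj bij_is_surj)

lemma permute_coords_inv [simp]:
  "bij \<sigma> \<Longrightarrow> permute_coords (inv_into UNIV \<sigma>) (permute_coords \<sigma> x) = x"
  "bij \<sigma> \<Longrightarrow> permute_coords \<sigma> (permute_coords (inv_into UNIV \<sigma>) x) = x"
  by (simp_all add: vec_eq_iff inv_inv_eq bij_is_inj bij_is_surj surj_f_inv_f)

lemma linear_permute_coords: "linear (permute_coords \<sigma> :: real ^ 'n::finite \<Rightarrow> real ^ 'n)"
  by (rule linearI) (simp_all add: vec_eq_iff)

lemma representation_standard_rep: "representation Sym_group standard_rep"
proof -
  have [simp]: "carrier standard_rep = UNIV" "\<zero>\<^bsub>standard_rep\<^esub> = 0" 
    "v \<oplus>\<^bsub>standard_rep\<^esub> w = v + w" "c \<odot>\<^bsub>standard_rep\<^esub> v = c *s v"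
    "act standard_rep \<sigma> = permute_coords \<sigma>" for v w :: "complex ^ 'n" and c \<sigma>
    by (simp_all add: standard_rep_def)
  have "abelian_group (standard_rep :: ('n \<Rightarrow> 'n, complex ^ 'n) rep)"
    by (rule abelian_groupI) (auto simp: ac_simps intro: exI[of _ "- x" for x])
  then have "Module.module complex_ring (standard_rep :: ('n \<Rightarrow> 'n, complex ^ 'n) rep)"
    by (rule complex_moduleI) (auto simp: vec_eq_iff algebra_simps)
  then show ?thesis
    by (auto simp: representation_def group_BijGroup carrier_Sym_group mult_Sym_group
        permute_coords_comp vec_eq_iff)
qed

lemma function_rep_simps [simp]:
  "carrier (function_rep D) = extensional D"
  "\<zero>\<^bsub>function_rep D\<^esub> = (\<lambda>x\<in>D. 0)"
  "f \<oplus>\<^bsub>function_rep D\<^esub> g = (\<lambda>x\<in>D. f x + g x)"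
  "c \<odot>\<^bsub>function_rep D\<^esub> f = (\<lambda>x\<in>D. c * f x)"
  "act (function_rep D) \<sigma> f = (\<lambda>x\<in>D. f (permute_coords (inv_into UNIV \<sigma>) x))"
  by (simp_all add: function_rep_def)

lemma null_functions_iff: "f \<in> null_functions D \<longleftrightarrow> f \<in> extensional D \<and> thin {x \<in> D. f x \<noteq> 0}"
  by (auto simp: null_functions_def thin_def)

lemma module_function_rep: "Module.module complex_ring (function_rep D)"
  for D :: "(real ^ 'n::finite) set"
proof (rule complex_moduleI)
  show "abelian_group (function_rep D)"
  proof (rule abelian_groupI)
    fix f :: "real ^ 'n \<Rightarrow> complex" assume "f \<in> carrier (function_rep D)"
    then show "\<exists>g\<in>carrier (function_rep D). g \<oplus>\<^bsub>function_rep D\<^esub> f = \<zero>\<^bsub>function_rep D\<^esub>"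
      by (intro bexI[of _ "\<lambda>x\<in>D. - f x"]) (auto intro!: restrict_ext)
  qed (auto simp: add.assoc add.commute intro!: restrict_ext extensionalityI[of _ D])
qed (auto simp: algebra_simps intro!: restrict_ext extensionalityI[of _ D])

locale symmetric_domain =
  fixes D :: "(real ^ 'n::finite) set"
  assumes permute_coords_closed: "bij \<sigma> \<Longrightarrow> x \<in> D \<Longrightarrow> permute_coords \<sigma> x \<in> D"
begin

lemma representation_function_rep: "representation Sym_group (function_rep D)"
  unfolding representation_def
proof (intro conjI ballI allI)
  fix g h :: "'n \<Rightarrow> 'n" and f :: "real ^ 'n \<Rightarrow> complex"
  assume gh: "g \<in> carrier Sym_group" "h \<in> carrier Sym_group" and "f \<in> carrier (function_rep D)"
  then show "act (function_rep D) (g \<otimes>\<^bsub>Sym_group\<^esub> h) f = act (function_rep D) g (act (function_rep D) h f)"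
    by (auto simp: carrier_Sym_group mult_Sym_group o_inv_distrib permute_coords_comp bij_imp_bij_inv
        permute_coords_closed intro!: restrict_ext)
qed (auto simp: group_BijGroup module_function_rep carrier_Sym_group permute_coords_closed bij_imp_bij_inv
      inv_id[unfolded id_def] intro!: restrict_ext extensionalityI[of _ D])

lemma subrep_null_functions: "subrep Sym_group (function_rep D) (null_functions D)"
  unfolding subrep_def
proof (intro conjI ballI)
  show "submodule (null_functions D) complex_ring (function_rep D)"
  proof (rule complex_submoduleI[OF module_function_rep])
    fix f g assume "f \<in> null_functions D" "g \<in> null_functions D"
    then have "thin ({x \<in> D. f x \<noteq> 0} \<union> {x \<in> D. g x \<noteq> 0})"
      by (intro thin_Un) (auto simp: null_functions_iff)
    then have "thin {x \<in> D. f x + g x \<noteq> 0}" by (rule thin_subset) auto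
    then show "f \<oplus>\<^bsub>function_rep D\<^esub> g \<in> null_functions D"
      by (simp add: null_functions_iff cong: conj_cong)
  next
    fix f c assume "f \<in> null_functions D"
    then have "thin {x \<in> D. c * f x \<noteq> 0}" by (auto simp: null_functions_iff elim: thin_subset)
    then show "c \<odot>\<^bsub>function_rep D\<^esub> f \<in> null_functions D"
      by (simp add: null_functions_iff cong: conj_cong)
  qed (auto simp: null_functions_iff cong: conj_cong)
next
  fix g :: "'n \<Rightarrow> 'n" and f assume g: "g \<in> carrier Sym_group" and "f \<in> null_functions D"
  then have "thin (permute_coords g ` {x \<in> D. f x \<noteq> 0})"
    by (intro thin_linear_image linear_permute_coords) (auto simp: null_functions_iff)
  moreover have "{x \<in> D. f (permute_coords (inv_into UNIV g) x) \<noteq> 0} \<subseteq> permute_coords g ` {x \<in> D. f x \<noteq> 0}"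
  proof
    fix x assume "x \<in> {x \<in> D. f (permute_coords (inv_into UNIV g) x) \<noteq> 0}"
    then show "x \<in> permute_coords g ` {x \<in> D. f x \<noteq> 0}"
      using g by (intro image_eqI[of _ _ "permute_coords (inv_into UNIV g) x"])
        (auto simp: carrier_Sym_group permute_coords_closed bij_imp_bij_inv)
  qed
  ultimately have "thin {x \<in> D. f (permute_coords (inv_into UNIV g) x) \<noteq> 0}" by (rule thin_subset)
  then show "act (function_rep D) g f \<in> null_functions D"
    by (simp add: null_functions_iff cong: conj_cong)
qed

sublocale rep_quotient Sym_group "function_rep D" "null_functions D"
  by standard (rule representation_function_rep subrep_null_functions)+

text \<open>The argument is a function on the whole space and is restricted here, so that plates,
  chain functions and translates can be written without mentioning the domain.\<close>

definition cls :: "(real ^ 'n \<Rightarrow> complex) \<Rightarrow> (real ^ 'n \<Rightarrow> complex) set" where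
  "cls f = null_functions D +>\<^bsub>function_rep D\<^esub> restrict f D"

lemma cls_eq_iff: "cls f = cls g \<longleftrightarrow> thin {x \<in> D. f x \<noteq> g x}"
proof -
  have "\<ominus>\<^bsub>function_rep D\<^esub> restrict g D = (\<lambda>x\<in>D. - g x)"
    by (rule minus_equality) (auto intro!: restrict_ext)
  then have "restrict f D \<ominus>\<^bsub>function_rep D\<^esub> restrict g D = (\<lambda>x\<in>D. f x - g x)"
    by (auto simp: a_minus_def intro!: restrict_ext)
  then show ?thesis
    unfolding cls_def by (subst coset_eq_iff) (auto simp: null_functions_iff cong: conj_cong)
qed

lemma cls_cong: "(\<And>x. x \<in> D \<Longrightarrow> f x = g x) \<Longrightarrow> cls f = cls g"
  by (simp add: cls_eq_iff cong: conj_cong)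

lemma carrier_cls: "carrier Q = range cls"
proof -
  have "coset f = cls f" if "f \<in> extensional D" for f
    using that by (simp add: cls_def extensional_restrict)
  then have "carrier Q \<subseteq> range cls" by (auto simp: carrier_Q)
  moreover have "cls f \<in> carrier Q" for f by (simp add: carrier_Q cls_def)
  ultimately show ?thesis by blast
qed

lemma zero_cls: "\<zero>\<^bsub>Q\<^esub> = cls (\<lambda>x. 0)"
  by (simp add: zero_Q' cls_def)

lemma add_cls: "cls f \<oplus>\<^bsub>Q\<^esub> cls g = cls (\<lambda>x. f x + g x)"
  by (simp add: cls_def add_Q cong: restrict_cong)

lemma smult_cls: "c \<odot>\<^bsub>Q\<^esub> cls f = cls (\<lambda>x. c * f x)"
  by (simp add: cls_def smult_Q cong: restrict_cong)

lemma act_cls: "bij \<sigma> \<Longrightarrow> act Q \<sigma> (cls f) = cls (\<lambda>x. f (permute_coords (inv_into UNIV \<sigma>) x))"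
  by (simp add: cls_def act_Q carrier_Sym_group permute_coords_closed bij_imp_bij_inv cong: restrict_cong)

end

section \<open>Plates as chain functions\<close>

text \<open>The inequalities of a plate, indexed by unions of initial lumps; the closing equality of
  a plate holds throughout the domains considered. Thresholds are integers of either sign because
  translations shift them.\<close>

definition chain_fun :: "('n::finite set \<times> int) set \<Rightarrow> real ^ 'n \<Rightarrow> complex" where
  "chain_fun F x = of_bool (\<forall>(U, T)\<in>F. real_of_int T \<le> coord_sum x U)"

text \<open>Two members may share the set and differ in the threshold. Multiplication by
  \<open>[x_i \<ge> t]\<close> can create such pairs, and \<open>thin_or_strict_chain\<close>
  removes the redundancy.\<close>

definition is_chain :: "('n set \<times> int) set \<Rightarrow> bool" where
  "is_chain F \<longleftrightarrow> finite F \<and> (\<forall>p\<in>F. \<forall>q\<in>F. fst p \<subseteq> fst q \<or> fst q \<subseteq> fst p)"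

lemma is_chain_subset: "is_chain F \<Longrightarrow> G \<subseteq> F \<Longrightarrow> is_chain G"
  by (auto simp: is_chain_def intro: finite_subset)

lemma chain_fun_insert: "chain_fun (insert (U, T) F) x = of_bool (real_of_int T \<le> coord_sum x U) * chain_fun F x"
  by (auto simp: chain_fun_def)

lemma coord_sum_empty [simp]: "coord_sum x {} = 0"
  and coord_sum_insert: "i \<notin> U \<Longrightarrow> coord_sum x (insert i U) = x $ i + coord_sum x U"
  by (simp_all add: coord_sum_def)

text \<open>The span is formed on the whole space before any restriction or quotient, so that
  translations, permutations and products with coordinate conditions act on it exactly; only its
  classes on a domain are identified with spans of plates.\<close>

inductive_set chain_span :: "(real ^ 'n::finite \<Rightarrow> complex) set" where
  chain: "is_chain F \<Longrightarrow> chain_fun F \<in> chain_span"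
| add: "f \<in> chain_span \<Longrightarrow> g \<in> chain_span \<Longrightarrow> (\<lambda>x. f x + g x) \<in> chain_span"
| scale: "f \<in> chain_span \<Longrightarrow> (\<lambda>x. c * f x) \<in> chain_span"

lemma chain_span_zero: "(\<lambda>x. 0) \<in> chain_span"
  using chain_span.scale[OF chain_span.chain[of "{}"], of 0] by (simp add: is_chain_def)

lemma chain_span_diff: "f \<in> chain_span \<Longrightarrow> g \<in> chain_span \<Longrightarrow> (\<lambda>x. f x - g x) \<in> chain_span"
  using chain_span.add[OF _ chain_span.scale[of g "-1"]] by simp

lemma chain_span_sum: "(\<And>i. i \<in> I \<Longrightarrow> f i \<in> chain_span) \<Longrightarrow> (\<lambda>x. \<Sum>i\<in>I. f i x) \<in> chain_span"
  by (induction I rule: infinite_finite_induct) (auto intro: chain_span_zero chain_span.add)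

text \<open>
  With \<open>A = [x\<^sub>i \<ge> t]\<close>, \<open>B = [x\<^sub>U \<ge> T]\<close> and \<open>C = [x\<^sub>U + x\<^sub>i \<ge> T + t]\<close>, where \<open>U\<close> is the largest set of the
  chain avoiding \<open>i\<close>, we have \<open>A B = A C + B C - C\<close>; this moves the incomparable set \<open>{i}\<close> down the chain.
\<close>

lemma chain_fun_mult_ge:
  fixes F :: "('n::finite set \<times> int) set"
  assumes "is_chain F"
  shows "(\<lambda>x. of_bool (real_of_int t \<le> x $ i) * chain_fun F x) \<in> chain_span"
  using assms
\<comment> \<open>The measure counts the members of the chain that avoid \<open>i\<close>. When none
  is left, \<open>{i}\<close> lies in every set and the new condition just extends the
  chain.\<close>
proof (induction "card {p \<in> F. i \<notin> fst p}" arbitrary: F rule: less_induct)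
  case less
  have fin: "finite F" using less.prems by (simp add: is_chain_def)
  let ?N = "{p \<in> F. i \<notin> fst p}"
  show ?case
  proof (cases "?N = {}")
    case True
    have "is_chain (insert ({i}, t) F)"
      using less.prems True by (auto simp: is_chain_def)
    from chain_span.chain[OF this] show ?thesis
      by (simp add: chain_fun_insert[abs_def] coord_sum_def)
  next
    case False
    let ?c = "\<lambda>p. card (fst p)"
    have "Max (?c ` ?N) \<in> ?c ` ?N" using fin False by (intro Max_in) auto
    then obtain p where p: "p \<in> ?N" and "?c p = Max (?c ` ?N)" by auto
    with fin have max: "?c q \<le> ?c p" if "q \<in> ?N" for q using that by auto
    obtain U T where UT: "p = (U, T)" by (cases p)
    have iU: "i \<notin> U" "(U, T) \<in> F" using p UT by auto
    define F' where "F' = F - {p}"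
    define C where "C = (insert i U, T + t)"
    have F: "F = insert (U, T) F'" using p UT by (auto simp: F'_def)
    \<comment> \<open>A set containing \<open>i\<close> is comparable with \<open>U\<close> and
      therefore contains it; a set avoiding \<open>i\<close> lies inside \<open>U\<close> by the
      maximal cardinality of \<open>U\<close>.\<close>
    have cmp: "insert i U \<subseteq> fst q \<or> fst q \<subseteq> insert i U" if q: "q \<in> F" for q
    proof (cases "i \<in> fst q")
      case True
      with q iU less.prems show ?thesis by (fastforce simp: is_chain_def)
    next
      case False
      with q have "card (fst q) \<le> card U" using max[of q] UT by simp
      moreover have "fst q \<subseteq> U \<or> U \<subseteq> fst q" using less.prems q iU by (fastforce simp: is_chain_def)
      ultimately have "fst q \<subseteq> U" using card_seteq[of "fst q" U] by auto
      then show ?thesis by auto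
    qed
    have chain: "is_chain (insert C F)"
      using less.prems cmp by (auto simp: is_chain_def C_def)
    then have chain': "is_chain (insert C F')"
      by (rule is_chain_subset) (auto simp: F'_def)
    have "{q \<in> insert C F'. i \<notin> fst q} \<subseteq> ?N - {p}" by (auto simp: C_def F'_def)
    with p have "{q \<in> insert C F'. i \<notin> fst q} \<subset> ?N" by blast
    then have "card {q \<in> insert C F'. i \<notin> fst q} < card ?N" using fin by (intro psubset_card_mono) auto
    \<comment> \<open>The induction hypothesis serves the product with the chain of \<open>C\<close>
      and \<open>F'\<close>, in which the pair of \<open>U\<close> has been traded for one whose set
      contains \<open>i\<close>. The other two terms are chain functions already.\<close>
    from chain_span_diff[OF chain_span.add[OF less.hyps[OF this chain'] chain_span.chain[OF chain]]
        chain_span.chain[OF chain']]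
    show ?thesis
    proof (rule back_subst[of "\<lambda>f. f \<in> chain_span"], intro ext)
      fix x
      let ?A = "real_of_int t \<le> x $ i" and ?B = "real_of_int T \<le> coord_sum x U"
      let ?C = "real_of_int (T + t) \<le> coord_sum x (insert i U)"
      have "?A \<and> ?B \<longrightarrow> ?C" "?C \<longrightarrow> ?A \<or> ?B" using iU by (auto simp: coord_sum_insert)
      then show "of_bool ?A * chain_fun (insert C F') x + chain_fun (insert C F) x - chain_fun (insert C F') x
          = of_bool ?A * chain_fun F x"
        unfolding F C_def chain_fun_insert by (auto simp: of_bool_def)
    qed
  qed
qed

lemma chain_span_mult_ge:
  "f \<in> chain_span \<Longrightarrow> (\<lambda>x. of_bool (real_of_int t \<le> x $ i) * f x) \<in> chain_span"
proof (induction rule: chain_span.induct)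
  case (add f g)
  from chain_span.add[OF add.IH] show ?case by (simp add: distrib_left)
next
  case (scale f c)
  from chain_span.scale[OF scale.IH, of c] show ?case by (simp add: mult.left_commute)
qed (rule chain_fun_mult_ge)

text \<open>The box is half-open because the indicator of \<open>a \<le> x_i < a + 1\<close> is a
  difference of two conditions \<open>[x_i \<ge> t]\<close>, and multiplying by those preserves the
  span. Coordinates are treated one after another.\<close>

lemma chain_span_mult_box:
  fixes f :: "real ^ 'n::finite \<Rightarrow> complex"
  assumes "f \<in> chain_span"
  shows "(\<lambda>x. of_bool (\<forall>i. real_of_int (a i) \<le> x $ i \<and> x $ i < real_of_int (a i + 1)) * f x) \<in> chain_span"
proof -
  have "(\<lambda>x. of_bool (\<forall>i\<in>I. real_of_int (a i) \<le> x $ i \<and> x $ i < real_of_int (a i + 1)) * f x) \<in> chain_span"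
    if "finite I" for I
    using that
  proof (induction I)
    case (insert i I)
    from chain_span_diff[OF chain_span_mult_ge[OF insert.IH, of "a i" i] chain_span_mult_ge[OF insert.IH, of "a i + 1" i]]
    show ?case
      by (rule back_subst[of "\<lambda>f. f \<in> chain_span"], intro ext) (auto simp: of_bool_def)
  qed (use assms in simp)
  from this[of UNIV] show ?thesis by simp
qed

text \<open>A translation changes only the thresholds, and integrality of the vector keeps them
  integral.\<close>

lemma chain_span_translate:
  fixes f :: "real ^ 'n::finite \<Rightarrow> complex"
  assumes "f \<in> chain_span" and z: "\<And>i. z $ i = real_of_int (a i)"
  shows "(\<lambda>x. f (x + z)) \<in> chain_span"
  using assms(1)
proof (induction rule: chain_span.induct)
  case (chain F)
  let ?h = "\<lambda>p. (fst p, snd p - (\<Sum>i\<in>fst p. a i))"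
  have "coord_sum (x + z) U = coord_sum x U + real_of_int (\<Sum>i\<in>U. a i)" for x U
    by (simp add: coord_sum_def sum.distrib z)
  then have "chain_fun F (x + z) = chain_fun (?h ` F) x" for x
    by (simp add: chain_fun_def case_prod_beta diff_le_eq)
  moreover have "is_chain (?h ` F)" using chain by (auto simp: is_chain_def)
  ultimately show ?case using chain_span.chain by simp
qed (auto intro: chain_span.intros)

lemma coord_sum_permute:
  assumes "bij \<sigma>"
  shows "coord_sum (permute_coords \<sigma> x) U = coord_sum x (inv_into UNIV \<sigma> ` U)"
proof -
  have "inj_on (inv_into UNIV \<sigma>) U"
    using bij_imp_bij_inv[OF assms] by (auto intro: inj_on_subset simp: bij_def)
  then show ?thesis by (simp add: coord_sum_def sum.reindex)
qed

lemma chain_span_permute: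
  assumes "f \<in> chain_span" and \<sigma>: "bij \<sigma>"
  shows "(\<lambda>x. f (permute_coords \<sigma> x)) \<in> chain_span"
  using assms(1)
proof (induction rule: chain_span.induct)
  case (chain F)
  let ?h = "\<lambda>(U, T). (inv_into UNIV \<sigma> ` U, T)"
  have "chain_fun F (permute_coords \<sigma> x) = chain_fun (?h ` F) x" for x
    by (auto simp: chain_fun_def coord_sum_permute[OF \<sigma>])
  moreover have "is_chain (?h ` F)" using chain by (fastforce simp: is_chain_def split: prod.splits)
  ultimately show ?case using chain_span.chain by simp
qed (auto intro: chain_span.intros)

text \<open>The exact shape of the inner inequalities of a plate: strictly growing proper nonempty
  sets give nonempty lumps, and thresholds growing strictly between 0 and \<open>r\<close> give
  positive positions.\<close>

definition strict_chain :: "nat \<Rightarrow> ('n set \<times> int) set \<Rightarrow> bool" where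
  "strict_chain r F \<longleftrightarrow> finite F \<and> (\<forall>(U, T)\<in>F. U \<noteq> {} \<and> U \<noteq> UNIV \<and> 0 < T \<and> T < int r) \<and>
     (\<forall>p\<in>F. \<forall>q\<in>F. p \<noteq> q \<longrightarrow> fst p \<subset> fst q \<and> snd p < snd q \<or> fst q \<subset> fst p \<and> snd q < snd p)"

text \<open>Captures what the dilated simplex and the hypersimplex (with \<open>a\<close> in place
  of \<open>r\<close>) have in common, so that both plate spaces are described by one
  argument.\<close>

locale plate_domain = symmetric_domain D for D :: "(real ^ 'n::finite) set" +
  fixes r :: nat
  assumes card_ge: "CARD('n) \<ge> 2" and pos: "r > 0"
    and nonneg: "x \<in> D \<Longrightarrow> 0 \<le> x $ i" and sum_eq: "x \<in> D \<Longrightarrow> (\<Sum>i\<in>UNIV. x $ i) = real r"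
begin

lemma coord_sum_mono: "x \<in> D \<Longrightarrow> U \<subseteq> V \<Longrightarrow> coord_sum x U \<le> coord_sum x V"
  unfolding coord_sum_def by (rule sum_mono2) (auto intro: nonneg)

lemma coord_sum_UNIV: "x \<in> D \<Longrightarrow> coord_sum x UNIV = real r"
  by (simp add: coord_sum_def sum_eq)

lemma chain_fun_remove:
  assumes "(U, T) \<in> F" and "\<And>x. x \<in> D \<Longrightarrow> chain_fun (F - {(U, T)}) x \<noteq> 0 \<Longrightarrow> real_of_int T \<le> coord_sum x U"
    and "x \<in> D"
  shows "chain_fun F x = chain_fun (F - {(U, T)}) x"
  using chain_fun_insert[of U T "F - {(U, T)}" x] assms by (auto simp: insert_absorb of_bool_def)

text \<open>Every violation of strictness either makes one condition redundant on \<open>D\<close>,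
  and the smaller chain is covered by induction, or confines the support to a thin set.\<close>

lemma thin_or_strict_chain:
  assumes "is_chain F"
  shows "thin {x \<in> D. chain_fun F x \<noteq> 0} \<or> (\<exists>G. strict_chain r G \<and> (\<forall>x\<in>D. chain_fun F x = chain_fun G x))"
proof -
  have "finite F" using assms by (simp add: is_chain_def)
  then show ?thesis using assms
  proof (induction F rule: finite_psubset_induct)
    case (psubset F)
    have remove: ?case
      if UT: "(U, T) \<in> F"
        and red: "\<And>x. x \<in> D \<Longrightarrow> chain_fun (F - {(U, T)}) x \<noteq> 0 \<Longrightarrow> real_of_int T \<le> coord_sum x U" for U T
    proof -
      have "is_chain (F - {(U, T)})" using psubset.prems by (rule is_chain_subset) auto
      with UT have "thin {x \<in> D. chain_fun (F - {(U, T)}) x \<noteq> 0} \<or>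
        (\<exists>G. strict_chain r G \<and> (\<forall>x\<in>D. chain_fun (F - {(U, T)}) x = chain_fun G x))"
        by (intro psubset.IH) auto
      with chain_fun_remove[OF UT red] show ?thesis by (simp cong: conj_cong)
    qed
    have leD: "real_of_int T \<le> coord_sum x U" if "chain_fun G x \<noteq> 0" "(U, T) \<in> G" for G x U T
      using that by (auto simp: chain_fun_def)
    show ?case
    proof (cases "strict_chain r F")
      case False
      \<comment> \<open>The possible violations: a threshold of at most 0, the empty set with a
        positive threshold, \<open>UNIV\<close> with a condition that always or never holds, a
        threshold of at least \<open>r\<close> on a proper set, and two members in the wrong
        relative position.\<close>
      then consider U T where "(U, T) \<in> F" "T \<le> 0" | U T where "(U, T) \<in> F" "0 < T" "U = {}"
        | U T where "(U, T) \<in> F" "U = UNIV" "T \<le> int r" | U T where "(U, T) \<in> F" "int r \<le> T" "U \<noteq> UNIV"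
        | U T where "(U, T) \<in> F" "int r < T" "U = UNIV"
        | p q where "p \<in> F" "q \<in> F" "p \<noteq> q" "\<not> (fst p \<subset> fst q \<and> snd p < snd q)" "\<not> (fst q \<subset> fst p \<and> snd q < snd p)"
        using \<open>finite F\<close> unfolding strict_chain_def by (smt (verit) case_prodI2)
      then show ?thesis
      proof cases
        case (1 U T)
        show ?thesis
        proof (rule remove[OF 1(1)])
          fix x assume "x \<in> D"
          from coord_sum_mono[OF this, of "{}" U] 1 show "real_of_int T \<le> coord_sum x U" by simp
        qed
      next
        case (2 U T)
        then have "{x \<in> D. chain_fun F x \<noteq> 0} = {}" using leD[of F _ U T] by fastforce
        then show ?thesis by (simp only: thin_empty simp_thms)
      next
        case (3 U T)
        show ?thesis by (rule remove[OF 3(1)]) (use 3 in \<open>auto simp: coord_sum_UNIV\<close>)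
      next
        case (4 U T)
        then obtain i where i: "i \<notin> U" by auto
        \<comment> \<open>The coordinates in \<open>U\<close> already exhaust the total
          \<open>r\<close>, so a coordinate outside \<open>U\<close> has to vanish.\<close>
        have "{x \<in> D. chain_fun F x \<noteq> 0} \<subseteq> {x. (\<Sum>j\<in>UNIV. x $ j) = real r \<and> x $ i = 0}"
        proof
          fix x assume x: "x \<in> {x \<in> D. chain_fun F x \<noteq> 0}"
          then have "real_of_int (int r) \<le> coord_sum x U" using leD[of F x U T] 4 by fastforce
          moreover have "x $ i + coord_sum x U \<le> real r"
            using coord_sum_mono[of x "insert i U" UNIV] x i by (simp add: coord_sum_UNIV coord_sum_insert)
          ultimately show "x \<in> {x. (\<Sum>j\<in>UNIV. x $ j) = real r \<and> x $ i = 0}"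
            using nonneg[of x i] sum_eq[of x] x by auto
        qed
        from thin_subset[OF thin_slice[OF card_ge] this] show ?thesis ..
      next
        case (5 U T)
        then have "{x \<in> D. chain_fun F x \<noteq> 0} = {}" using leD[of F _ U T] by (fastforce simp: coord_sum_UNIV)
        then show ?thesis by (simp only: thin_empty simp_thms)
      next
        case (6 p q)
        \<comment> \<open>If the smaller set carries the larger or equal threshold, its condition
          implies the other one by monotonicity. Otherwise the two sets coincide, and the lower
          threshold, that of \<open>p\<close>, is redundant.\<close>
        have *: ?thesis if "p \<in> F" "q \<in> F" "p \<noteq> q" "\<not> (fst p \<subset> fst q \<and> snd p < snd q)" "fst p \<subseteq> fst q" for p q
        proof (cases "snd q \<le> snd p")
          case True
          show ?thesis
          proof (rule remove[of "fst q" "snd q"])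
            fix x assume x: "x \<in> D" "chain_fun (F - {(fst q, snd q)}) x \<noteq> 0"
            from leD[OF this(2), of "fst p" "snd p"] that have "real_of_int (snd p) \<le> coord_sum x (fst p)"
              by auto
            with coord_sum_mono[OF x(1) that(5)] True show "real_of_int (snd q) \<le> coord_sum x (fst q)" by linarith
          qed (use that in simp)
        next
          case False
          with that have eq: "fst p = fst q" by auto
          show ?thesis
          proof (rule remove[of "fst p" "snd p"])
            fix x assume x: "x \<in> D" "chain_fun (F - {(fst p, snd p)}) x \<noteq> 0"
            from leD[OF this(2), of "fst q" "snd q"] that have "real_of_int (snd q) \<le> coord_sum x (fst q)"
              by auto
            with eq False show "real_of_int (snd p) \<le> coord_sum x (fst p)" by simp
          qed (use that in simp)
        qed
        have "fst p \<subseteq> fst q \<or> fst q \<subseteq> fst p" using psubset.prems 6 by (auto simp: is_chain_def)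
        then show ?thesis using *[of p q] *[of q p] 6 by auto
      qed
    qed auto
  qed
qed

text \<open>Lumps and positions are the successive differences of the sets and thresholds of the
  chain, completed at both ends; the partial sums of the plate telescope back to the chain.\<close>

lemma strict_chain_plate:
  assumes "strict_chain r F"
  shows "\<exists>f\<in>plates r. \<forall>x\<in>D. chain_fun F x = f x"
proof -
  \<comment> \<open>The two added pairs, the empty union with 0 and the full set with the total
    \<open>r\<close>, are the ends of the telescoping sums.\<close>
  define G where "G = insert ({}, 0) (insert (UNIV, int r) F)"
  have finG: "finite G" using assms by (simp add: G_def strict_chain_def)
  have cmp: "fst p \<subset> fst q \<and> snd p < snd q \<or> fst q \<subset> fst p \<and> snd q < snd p"
    if "p \<in> G" "q \<in> G" "p \<noteq> q" for p q
    using that assms pos unfolding G_def strict_chain_def by fastforce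
  have inj: "inj_on snd G"
    using cmp by (intro inj_onI) (metis less_irrefl)
  \<comment> \<open>Sorting by threshold also sorts the sets by inclusion, since by
    \<open>cmp\<close> the two orders agree on \<open>G\<close>.\<close>
  define L where "L = map (inv_into G snd) (sorted_list_of_set (snd ` G))"
  have setL: "set L = G"
    using inj finG by (simp add: L_def image_image inv_into_image_cancel[OF inj])
  have nth_snd: "snd (L ! j) = sorted_list_of_set (snd ` G) ! j" if "j < length L" for j
    using that finG nth_mem[of j "sorted_list_of_set (snd ` G)"]
    by (auto simp: L_def f_inv_into_f)
  have nth_G: "L ! j \<in> G" if "j < length L" for j using that setL nth_mem by blast
  have less: "fst (L ! i) \<subset> fst (L ! j) \<and> snd (L ! i) < snd (L ! j)" if "i < j" "j < length L" for i j
  proof -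
    have "snd (L ! i) < snd (L ! j)"
      using that nth_snd[of i] nth_snd[of j] sorted_wrt_nth_less[OF strict_sorted_list_of_set, of i j "snd ` G"]
      by (simp add: L_def)
    moreover have "L ! i \<in> G" "L ! j \<in> G" using nth_G that by auto
    ultimately show ?thesis using cmp[of "L ! i" "L ! j"] by force
  qed
  \<comment> \<open>\<open>L\<close> has one entry more than there are lumps, each lump being a
    difference of neighbours.\<close>
  define k where "k = length L - 1"
  have "card G = length L" using setL finG inj by (simp add: L_def card_image)
  moreover have "card {({} :: 'n set, 0), (UNIV, int r)} \<le> card G"
    using finG by (intro card_mono) (auto simp: G_def)
  ultimately have len: "length L = Suc k" and "k \<ge> 1" by (auto simp: k_def)
  have L0: "L ! 0 = ({}, 0)"
  proof -
    have "({}, 0) \<in> set L" by (simp add: setL G_def)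
    then obtain m where m: "m < length L" "L ! m = ({}, 0)" by (auto simp: in_set_conv_nth)
    with less[of 0 m] show ?thesis by (cases "m = 0") auto
  qed
  have Lk: "L ! k = (UNIV, int r)"
  proof -
    have "(UNIV, int r) \<in> set L" by (simp add: setL G_def)
    then obtain m where m: "m < length L" "L ! m = (UNIV, int r)" by (auto simp: in_set_conv_nth)
    with less[of m k] len show ?thesis by (cases "m = k") auto
  qed
  define U where "U = (\<lambda>j. fst (L ! j))"
  define T where "T = (\<lambda>j. snd (L ! j))"
  have U_less: "U i \<subset> U j" and T_less: "T i < T j" if "i < j" "j \<le> k" for i j
    using less[of i j] that len by (auto simp: U_def T_def)
  have U_le: "U i \<subseteq> U j" if "i \<le> j" "j \<le> k" for i j
    using U_less[of i j] that by (cases "i = j") auto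
  have U0: "U 0 = {}" and T0: "T 0 = 0" and Uk: "U k = UNIV" and Tk: "T k = int r"
    by (simp_all add: U_def T_def L0 Lk)
  define Ss where "Ss = map (\<lambda>j. U (Suc j) - U j) [0..<k]"
  define s where "s = map (\<lambda>j. nat (T (Suc j) - T j)) [0..<k]"
  have UN: "(\<Union>i<j. U (Suc i) - U i) = U j" if "j \<le> k" for j
    using that
  proof (induction j)
    case (Suc j)
    then show ?case using U_le[of j "Suc j"] by (auto simp: lessThan_Suc)
  qed (simp add: U0)
  have Usum: "(\<Sum>i<j. coord_sum x (Ss ! i)) = coord_sum x (U j)" if "j \<le> k" for j x
    using that
  proof (induction j)
    case (Suc j)
    then show ?case using U_le[of j "Suc j"]
      by (simp add: Ss_def coord_sum_def sum.subset_diff[of "U j" "U (Suc j)"])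
  qed (simp add: U0)
  have Tsum: "int (\<Sum>i<j. s ! i) = T j" if "j \<le> k" for j
    using that
  proof (induction j)
    case (Suc j)
    then show ?case using T_less[of j "Suc j"] by (simp add: s_def)
  qed (simp add: T0)
  have [simp]: "length Ss = k" "length s = k" by (simp_all add: Ss_def s_def)
  have "ordered_set_partition Ss"
    unfolding ordered_set_partition_def
  proof (intro conjI allI impI ballI)
    fix S assume "S \<in> set Ss"
    then obtain j where "j < k" "S = U (Suc j) - U j" by (auto simp: Ss_def)
    then show "S \<noteq> {}" using U_less[of j "Suc j"] by auto
  next
    show "\<Union> (set Ss) = UNIV"
      using UN[of k] by (simp add: Ss_def Uk atLeast0LessThan)
    show "Ss ! i \<inter> Ss ! j = {}" if "i < j" "j < length Ss" for i j
      using that U_le[of "Suc i" j] by (auto simp: Ss_def)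
  qed
  moreover have "\<forall>t\<in>set s. t > 0"
    using T_less[of j "Suc j" for j] by (auto simp: s_def)
  moreover have "sum_list s = r"
  proof -
    have "int (sum_list s) = int r"
      using Tsum[of k] by (simp add: sum_list_sum_nth atLeast0LessThan Tk)
    then show ?thesis by simp
  qed
  ultimately have "plate Ss s \<in> plates r"
    unfolding plates_def by (intro CollectI exI[of _ Ss] exI[of _ s]) simp
  moreover have "chain_fun F x = plate Ss s x" if x: "x \<in> D" for x
  proof -
    \<comment> \<open>Indices 0 and \<open>k\<close> belong to the added ends. The indices in
      between enumerate \<open>F\<close> and are also the range of \<open>j\<close> in
      \<open>plate_set\<close>.\<close>
    have F: "F = (\<lambda>j. (U j, T j)) ` {1..<k}"
    proof
      show "F \<subseteq> (\<lambda>j. (U j, T j)) ` {1..<k}"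
      proof
        fix p assume p: "p \<in> F"
        then have "p \<in> set L" by (simp add: setL G_def)
        then obtain j where j: "j < length L" "L ! j = p" by (auto simp: in_set_conv_nth)
        have "fst p \<noteq> {}" "fst p \<noteq> UNIV" using p assms by (auto simp: strict_chain_def)
        then have "j \<noteq> 0" "j \<noteq> k" using j L0 Lk by auto
        with j len show "p \<in> (\<lambda>j. (U j, T j)) ` {1..<k}" by (auto simp: U_def T_def intro!: image_eqI[of _ _ j])
      qed
      show "(\<lambda>j. (U j, T j)) ` {1..<k} \<subseteq> F"
      proof safe
        fix j assume j: "j \<in> {1..<k}"
        then have "L ! j \<in> G" using nth_G len by auto
        moreover have "L ! j \<noteq> L ! 0" "L ! j \<noteq> L ! k" using less[of 0 j] less[of j k] j len by auto
        ultimately show "(U j, T j) \<in> F" by (auto simp: G_def L0 Lk U_def T_def)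
      qed
    qed
    have "real (\<Sum>i<j. s ! i) = real_of_int (T j)" if "j \<le> k" for j
      using Tsum[OF that] by (metis of_int_of_nat_eq)
    then have "x \<in> plate_set Ss s \<longleftrightarrow> (\<forall>j\<in>{1..<k}. real_of_int (T j) \<le> coord_sum x (U j))"
      using x by (simp add: plate_set_def Usum Uk Tk coord_sum_UNIV del: of_nat_sum) auto
    then show ?thesis by (simp add: plate_def chain_fun_def F indicator_def)
  qed
  ultimately show ?thesis by blast
qed

text \<open>Unions of initial lumps form a chain. The index stops before the last lump because the
  closing equality of the plate holds on all of \<open>D\<close>.\<close>

lemma plate_chain:
  assumes "f \<in> plates r"
  shows "\<exists>F. is_chain F \<and> (\<forall>x\<in>D. f x = chain_fun F x)"
proof -
  from assms obtain Ss s where f: "f = plate Ss s" and part: "ordered_set_partition Ss"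
    and len: "length s = length Ss" and s: "sum_list s = r" by (auto simp: plates_def)
  define U where "U = (\<lambda>j. \<Union>i<j. Ss ! i)"
  define F where "F = (\<lambda>j. (U j, int (\<Sum>i<j. s ! i))) ` {1..<length Ss}"
  have "U i \<subseteq> U j" if "i \<le> j" for i j using that by (force simp: U_def)
  then have "is_chain F" unfolding F_def is_chain_def by (auto simp del: of_nat_sum) (meson nle_le subsetD)
  have Usum: "(\<Sum>i<j. coord_sum x (Ss ! i)) = coord_sum x (U j)" if "j \<le> length Ss" for j x
    unfolding coord_sum_def U_def
  proof (rule sum.UNION_disjoint[symmetric])
    show "\<forall>i\<in>{..<j}. \<forall>i'\<in>{..<j}. i \<noteq> i' \<longrightarrow> Ss ! i \<inter> Ss ! i' = {}"
      using part that unfolding ordered_set_partition_def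
      by (metis inf_commute lessThan_iff linorder_neqE_nat order_less_le_trans)
  qed auto
  have UL: "U (length Ss) = UNIV"
    using part by (auto simp: U_def ordered_set_partition_def set_conv_nth)
  have total: "(\<Sum>i<length Ss. s ! i) = r"
    using s len by (simp add: sum_list_sum_nth atLeast0LessThan)
  have "f x = chain_fun F x" if "x \<in> D" for x
  proof -
    have "x \<in> plate_set Ss s \<longleftrightarrow> (\<forall>j\<in>{1..<length Ss}. real (\<Sum>i<j. s ! i) \<le> coord_sum x (U j))"
      using that by (simp add: plate_set_def Usum UL total coord_sum_UNIV del: of_nat_sum) auto
    then show ?thesis by (simp add: f plate_def chain_fun_def F_def indicator_def del: of_nat_sum)
  qed
  with \<open>is_chain F\<close> show ?thesis by blast
qed

section \<open>Plate spaces described by chain functions\<close>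

lemma submodule_cls_chain_span: "submodule (cls ` chain_span) complex_ring Q"
proof (rule complex_submoduleI)
  show "Module.module complex_ring Q" by (rule representationD(2)[OF representation_Q])
  show "\<zero>\<^bsub>Q\<^esub> \<in> cls ` chain_span" by (auto simp: zero_cls intro: chain_span_zero)
  show "a \<oplus>\<^bsub>Q\<^esub> b \<in> cls ` chain_span" if "a \<in> cls ` chain_span" "b \<in> cls ` chain_span" for a b
    using that by (auto simp: add_cls intro!: imageI chain_span.add)
  show "c \<odot>\<^bsub>Q\<^esub> a \<in> cls ` chain_span" if "a \<in> cls ` chain_span" for a c
    using that by (auto simp: smult_cls intro!: imageI chain_span.scale)
qed (auto simp: carrier_cls)

text \<open>Replaces plates by a spanning family that is stable under translation and under cutting
  to cubes. On \<open>D\<close> each plate agrees with a chain function, and each chain function is,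
  modulo null functions, a plate or zero.\<close>

lemma lin_span_plates: "lin_span Q (cls ` plates r) = cls ` chain_span"
proof
  have "cls ` plates r \<subseteq> cls ` chain_span"
  proof
    fix w assume "w \<in> cls ` plates r"
    then obtain f where f: "f \<in> plates r" "w = cls f" by auto
    from plate_chain[OF f(1)] obtain F where "is_chain F" "\<And>x. x \<in> D \<Longrightarrow> f x = chain_fun F x" by blast
    then show "w \<in> cls ` chain_span" using f by (auto intro!: image_eqI[of _ _ "chain_fun F"] cls_cong chain_span.chain)
  qed
  from lin_span_minimal[OF submodule_cls_chain_span this] show "lin_span Q (cls ` plates r) \<subseteq> cls ` chain_span" .
  have "Module.module complex_ring Q" by (rule representationD(2)[OF representation_Q])
  then have sub: "submodule (lin_span Q (cls ` plates r)) complex_ring Q"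
    by (rule submodule_lin_span) (auto simp: carrier_cls)
  note subD = complex_submoduleD[OF sub]
  have "cls f \<in> lin_span Q (cls ` plates r)" if "f \<in> chain_span" for f
    using that
  proof (induction rule: chain_span.induct)
    case (chain F)
    from thin_or_strict_chain[OF this] show ?case
    proof (elim disjE exE conjE)
      assume "thin {x \<in> D. chain_fun F x \<noteq> 0}"
      then have "cls (chain_fun F) = \<zero>\<^bsub>Q\<^esub>" by (simp add: zero_cls cls_eq_iff)
      with subD(2) show ?thesis by simp
    next
      fix G assume "strict_chain r G" and FG: "\<forall>x\<in>D. chain_fun F x = chain_fun G x"
      from strict_chain_plate[OF this(1)] obtain f where f: "f \<in> plates r" "\<forall>x\<in>D. chain_fun G x = f x" by blast
      then have "cls (chain_fun F) = cls f" using FG by (intro cls_cong) auto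
      with f(1) lin_span_superset[of "cls ` plates r" Q] show ?thesis by auto
    qed
  next
    case (add f g)
    from subD(3)[OF add.IH] show ?case by (simp add: add_cls)
  next
    case (scale f c)
    from subD(4)[OF scale.IH, of c] show ?case by (simp add: smult_cls)
  qed
  then show "cls ` chain_span \<subseteq> lin_span Q (cls ` plates r)" by auto
qed

lemma Pl_eq: "Pl D r = Q\<lparr>carrier := cls ` chain_span\<rparr>"
proof -
  have "{null_functions D +>\<^bsub>function_rep D\<^esub> restrict f D | f. f \<in> plates r} = cls ` plates r"
    by (auto simp: cls_def)
  then show ?thesis by (simp add: Pl_def Let_def lin_span_plates)
qed

lemma representation_Pl: "representation Sym_group (Pl D r)"
  unfolding Pl_eq
proof (rule representation_subrep[OF representation_Q])
  show "subrep Sym_group Q (cls ` chain_span)"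
    using submodule_cls_chain_span
    by (auto simp: subrep_def carrier_Sym_group act_cls bij_imp_bij_inv intro!: imageI chain_span_permute)
qed

lemma Pl_simps:
  shows carrier_Pl: "carrier (Pl D r) = cls ` chain_span"
    and zero_Pl: "\<zero>\<^bsub>Pl D r\<^esub> = cls (\<lambda>x. 0)"
    and add_Pl: "cls f \<oplus>\<^bsub>Pl D r\<^esub> cls g = cls (\<lambda>x. f x + g x)"
    and smult_Pl: "c \<odot>\<^bsub>Pl D r\<^esub> cls f = cls (\<lambda>x. c * f x)"
    and act_Pl: "bij \<sigma> \<Longrightarrow> act (Pl D r) \<sigma> (cls f) = cls (\<lambda>x. f (permute_coords (inv_into UNIV \<sigma>) x))"
  by (simp_all add: Pl_eq zero_cls add_cls smult_cls act_cls)

end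

section \<open>The monomial basis of a symmetric power\<close>

text \<open>Multiplication of a polynomial, given by its coefficients \<open>p\<close>, by the
  linear form with coefficients \<open>v\<close>; exponent vectors are encoded as multisets.\<close>

definition mono_step :: "complex ^ 'n::finite \<Rightarrow> ('n multiset \<Rightarrow> complex) \<Rightarrow> 'n multiset \<Rightarrow> complex" where
  "mono_step v p M = (\<Sum>i\<in>UNIV. if i \<in># M then v $ i * p (M - {#i#}) else 0)"

text \<open>\<open>mono_coef vs M\<close> is the coefficient of the monomial with exponents \<open>M\<close> in the product of the
  linear forms \<open>\<Sum>i. (v $ i) * X i\<close> for \<open>v\<close> in \<open>vs\<close>.\<close>

definition mono_coef :: "(complex ^ 'n::finite) list \<Rightarrow> 'n multiset \<Rightarrow> complex" where
  "mono_coef vs = foldr mono_step vs (\<lambda>M. of_bool (M = {#}))"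

lemma mono_coef_Nil [simp]: "mono_coef [] M = of_bool (M = {#})"
  and mono_coef_Cons: "mono_coef (v # vs) M = mono_step v (mono_coef vs) M"
  by (simp_all add: mono_coef_def)

text \<open>Both sides sum over ordered pairs of variables removed from \<open>M\<close>, and
  exchanging the two sums exchanges \<open>u\<close> and \<open>v\<close>.\<close>

lemma mono_step_commute: "mono_step u (mono_step v p) = mono_step v (mono_step u p)"
proof
  fix M
  have eq: "mono_step u (mono_step v p) M =
    (\<Sum>i\<in>UNIV. \<Sum>j\<in>UNIV. if {#i, j#} \<subseteq># M then u $ i * v $ j * p (M - {#i, j#}) else 0)" for u v
    unfolding mono_step_def
    by (auto simp: insert_subset_eq_iff sum_distrib_left mult.assoc add_mset_commute intro!: sum.cong)
  show "mono_step u (mono_step v p) M = mono_step v (mono_step u p) M"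
    unfolding eq by (subst sum.swap, intro sum.cong refl) (simp add: add_mset_commute mult.commute)
qed

lemma mono_coef_mset:
  assumes "mset vs = mset ws"
  shows "mono_coef vs = mono_coef ws"
proof -
  have "fold mono_step (rev vs) (\<lambda>M. of_bool (M = {#})) = fold mono_step (rev ws) (\<lambda>M. of_bool (M = {#}))"
    using assms by (intro fold_permuted_eq[where P = "\<lambda>_. True"]) (auto intro: mono_step_commute)
  then show ?thesis by (simp add: mono_coef_def foldr_conv_fold)
qed

lemma mono_coef_update_add:
  "i < length vs \<Longrightarrow> mono_coef (vs[i := v + w]) M = mono_coef (vs[i := v]) M + mono_coef (vs[i := w]) M"
proof (induction vs arbitrary: i M)
  case (Cons u vs)
  then show ?case
    by (cases i) (auto simp: mono_coef_Cons mono_step_def algebra_simps simp flip: sum.distrib intro!: sum.cong)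
qed simp

lemma mono_coef_update_scale:
  "i < length vs \<Longrightarrow> mono_coef (vs[i := c *s v]) M = c * mono_coef (vs[i := v]) M"
proof (induction vs arbitrary: i M)
  case (Cons u vs)
  then show ?case
    by (cases i) (auto simp: mono_coef_Cons mono_step_def algebra_simps sum_distrib_left intro!: sum.cong)
qed simp

text \<open>Permuting the variables moves exponents along \<sigma>, so coefficients are pulled back
  along the inverse; the sums over the variables match after reindexing.\<close>

lemma mono_coef_permute:
  assumes "bij \<sigma>"
  shows "mono_coef (map (permute_coords \<sigma>) vs) M = mono_coef vs (image_mset (inv_into UNIV \<sigma>) M)"
proof (induction vs arbitrary: M)
  case (Cons v vs)
  have bij: "bij (inv_into UNIV \<sigma>)" by (rule bij_imp_bij_inv[OF assms])
  have mem: "inv_into UNIV \<sigma> i \<in># image_mset (inv_into UNIV \<sigma>) M \<longleftrightarrow> i \<in># M" for i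
    using bij by (auto simp: bij_def inj_eq)
  show ?case
    unfolding mono_coef_Cons mono_step_def list.map
    by (subst (2) sum.reindex_bij_betw[OF bij, symmetric])
      (auto simp: mem Cons.IH image_mset_Diff inj_eq[OF bij_is_inj[OF bij]] simp del: in_image_mset intro!: sum.cong)
qed simp

lemma axis_one_nth: "axis i 1 $ j = (of_bool (j = i) :: complex)"
  by (simp add: axis_def)

text \<open>The source of the linear independence of monomials: the coefficient functionals are dual
  to them.\<close>

lemma mono_coef_axis: "mono_coef (map (\<lambda>i. axis i 1) is) M = of_bool (mset is = M)"
proof (induction "is" arbitrary: M)
  case Nil
  show ?case by auto
next
  case (Cons i "is")
  have "mono_coef (map (\<lambda>i. axis i 1) (i # is)) M =
    (\<Sum>j\<in>UNIV. if j = i then of_bool (i \<in># M \<and> mset is = M - {#i#}) else 0)"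
    unfolding mono_coef_Cons mono_step_def list.map
    by (intro sum.cong refl) (simp add: axis_one_nth Cons.IH)
  also have "\<dots> = of_bool (i \<in># M \<and> mset is = M - {#i#})" by simp
  also have "i \<in># M \<and> mset is = M - {#i#} \<longleftrightarrow> mset (i # is) = M" by auto
  finally show ?case .
qed

lemma standard_rep_simps [simp]:
  "carrier standard_rep = UNIV" "\<zero>\<^bsub>standard_rep\<^esub> = 0"
  "v \<oplus>\<^bsub>standard_rep\<^esub> w = v + w" "c \<odot>\<^bsub>standard_rep\<^esub> v = c *s v"
  "act standard_rep \<sigma> = permute_coords \<sigma>"
  by (simp_all add: standard_rep_def)

lemma sym_free_simps [simp]:
  "carrier (sym_free V k) = {f. Poly_Mapping.keys f \<subseteq> sym_generators V k}"
  "\<zero>\<^bsub>sym_free V k\<^esub> = 0"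
  "f \<oplus>\<^bsub>sym_free V k\<^esub> g = f + g"
  "c \<odot>\<^bsub>sym_free V k\<^esub> f = Poly_Mapping.map ((*) c) f"
  by (simp_all add: sym_free_def)

lemma sym_relations_kernel: "a \<in> sym_relations V k \<Longrightarrow> a \<in> sym_kernel V k"
  unfolding sym_kernel_def by (rule subsetD[OF lin_span_superset])

lemma minus_sym_free:
  "Poly_Mapping.keys f \<subseteq> sym_generators V k \<Longrightarrow> Poly_Mapping.keys g \<subseteq> sym_generators V k \<Longrightarrow>
    f \<ominus>\<^bsub>sym_free V k\<^esub> g = f - g"
  by (simp add: sym_free_def minus_free_rep)

lemma lext_act_sym_free: "lext \<phi> (act (sym_free V k) g f) = lext (\<lambda>vs. \<phi> (map (act V g) vs)) f"
  by (simp add: sym_free_def lext_act_free_rep)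

lemma free_carrier_map_times:
  "Poly_Mapping.keys f \<subseteq> X \<Longrightarrow> Poly_Mapping.keys (Poly_Mapping.map ((*) c) f) \<subseteq> X"
  for f :: "'x \<Rightarrow>\<^sub>0 complex"
  by (auto simp: in_keys_iff)

text \<open>The dummy parameter \<open>ty\<close> carries the coordinate type, which
  \<open>k\<close> does not determine.\<close>

locale standard_sym =
  fixes k :: int and ty :: "'n::finite itself"
begin

sublocale rep_quotient Sym_group "sym_free (standard_rep :: ('n \<Rightarrow> 'n, complex ^ 'n) rep) k"
    "sym_kernel (standard_rep :: ('n \<Rightarrow> 'n, complex ^ 'n) rep) k"
  by (rule rep_quotient_sym[OF representation_standard_rep])

abbreviation "gens \<equiv> sym_generators (standard_rep :: ('n \<Rightarrow> 'n, complex ^ 'n) rep) k"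

lemma gens_iff: "vs \<in> gens \<longleftrightarrow> int (length vs) = k"
  by (simp add: sym_generators_def)

lemma lext_sym_kernel:
  assumes "f \<in> sym_kernel (standard_rep :: ('n \<Rightarrow> 'n, complex ^ 'n) rep) k"
  shows "lext (\<lambda>vs. mono_coef vs M) f = 0"
  using assms sym_relations_carrier[OF representation_standard_rep]
  unfolding sym_kernel_def sym_free_def
proof (rule lext_lin_span_eq_0)
  fix a assume "a \<in> sym_relations (standard_rep :: ('n \<Rightarrow> 'n, complex ^ 'n) rep) k"
  then show "lext (\<lambda>vs. mono_coef vs M) a = 0"
  proof (cases rule: sym_relations_cases)
    case (1 vs ws)
    then show ?thesis by (simp add: lext_diff mono_coef_mset[OF 1(3)])
  qed (simp_all add: lext_diff mono_coef_update_add mono_coef_update_scale)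
qed

text \<open>The coefficient functional on classes, evaluated at a chosen representative. By
  \<open>coef_coset\<close> its value is independent of the choice, because the functional kills the
  relations.\<close>

definition coef :: "((complex ^ 'n) list \<Rightarrow>\<^sub>0 complex) set \<Rightarrow> 'n multiset \<Rightarrow> complex" where
  "coef S M = lext (\<lambda>vs. mono_coef vs M) (SOME f. Poly_Mapping.keys f \<subseteq> gens \<and> coset f = S)"

lemma carrier_eq: "carrier Q = coset ` {f. Poly_Mapping.keys f \<subseteq> gens}"
  by (simp add: carrier_Q)

lemma coset_eq:
  assumes "Poly_Mapping.keys f \<subseteq> gens" "Poly_Mapping.keys g \<subseteq> gens"
  shows "coset f = coset g \<longleftrightarrow> f - g \<in> sym_kernel (standard_rep :: ('n \<Rightarrow> 'n, complex ^ 'n) rep) k"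
  using coset_eq_iff[of f g] minus_sym_free[OF assms] assms by simp

lemma coef_coset:
  assumes "Poly_Mapping.keys f \<subseteq> gens"
  shows "coef (coset f) M = lext (\<lambda>vs. mono_coef vs M) f"
proof -
  define g where "g = (SOME g. Poly_Mapping.keys g \<subseteq> gens \<and> coset g = coset f)"
  have "Poly_Mapping.keys g \<subseteq> gens \<and> coset g = coset f"
    unfolding g_def by (rule someI[of _ f]) (use assms in simp)
  with coset_eq[of g f] assms lext_sym_kernel[of "g - f" M] show ?thesis
    by (simp add: coef_def g_def lext_diff)
qed

lemma coef_add: "S \<in> carrier Q \<Longrightarrow> S' \<in> carrier Q \<Longrightarrow> coef (S \<oplus>\<^bsub>Q\<^esub> S') M = coef S M + coef S' M"
  unfolding carrier_eq
  by (auto simp: add_Q coef_coset free_carrier_add lext_add)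

lemma coef_smult: "S \<in> carrier Q \<Longrightarrow> coef (c \<odot>\<^bsub>Q\<^esub> S) M = c * coef S M"
  unfolding carrier_eq
  by (auto simp: smult_Q coef_coset free_carrier_map_times lext_map_times)

lemma coef_act:
  assumes "S \<in> carrier Q" "bij \<sigma>"
  shows "coef (act Q \<sigma> S) M = coef S (image_mset (inv_into UNIV \<sigma>) M)"
proof -
  obtain f where f: "Poly_Mapping.keys f \<subseteq> gens" "S = coset f" using assms by (auto simp: carrier_eq)
  let ?F = "sym_free (standard_rep :: ('n \<Rightarrow> 'n, complex ^ 'n) rep) k"
  have "act ?F \<sigma> f \<in> carrier ?F"
    using f assms by (intro representationD(4)[OF rep]) (auto simp: carrier_Sym_group)
  then have "Poly_Mapping.keys (act ?F \<sigma> f) \<subseteq> gens" by simp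
  moreover have "act Q \<sigma> S = coset (act ?F \<sigma> f)"
    using f assms by (simp add: act_Q carrier_Sym_group)
  ultimately show ?thesis
    using f by (simp add: coef_coset lext_act_sym_free mono_coef_permute[OF assms(2)])
qed

text \<open>All orderings of \<open>M\<close> name the same class by the symmetry relations; one of
  them is fixed by choice.\<close>

definition mono :: "'n multiset \<Rightarrow> ((complex ^ 'n) list \<Rightarrow>\<^sub>0 complex) set" where
  "mono M = coset (basis_elem (map (\<lambda>i. axis i 1) (SOME is. mset is = M)))"

lemma mset_some: "mset (SOME is. mset is = M) = M"
  by (rule someI_ex) (rule ex_mset)

lemma length_some: "length (SOME is. mset is = M) = size M"
  by (metis mset_some size_mset)

lemma mono_carrier: "int (size M) = k \<Longrightarrow> mono M \<in> carrier Q"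
  by (auto simp: mono_def carrier_eq gens_iff length_some intro!: imageI)

lemma coef_mono: "int (size M) = k \<Longrightarrow> coef (mono M) M' = of_bool (M = M')"
  by (simp add: mono_def coef_coset gens_iff length_some mono_coef_axis mset_some)

lemma coset_basis_add:
  assumes "vs \<in> gens" "i < length vs"
  shows "coset (basis_elem (vs[i := v + w])) = coset (basis_elem (vs[i := v])) \<oplus>\<^bsub>Q\<^esub> coset (basis_elem (vs[i := w]))"
proof -
  have g: "vs[i := u] \<in> gens" for u using assms by (simp add: gens_iff)
  have "basis_elem (vs[i := v + w]) - (basis_elem (vs[i := v]) + basis_elem (vs[i := w]))
    \<in> sym_kernel (standard_rep :: ('n \<Rightarrow> 'n, complex ^ 'n) rep) k"
    using sym_relations_kernel[OF sym_relationsI(2)[OF assms, of v w]] by (simp add: diff_diff_eq)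
  then have "coset (basis_elem (vs[i := v + w])) = coset (basis_elem (vs[i := v]) + basis_elem (vs[i := w]))"
    by (subst coset_eq) (simp_all add: g free_carrier_add)
  also have "\<dots> = coset (basis_elem (vs[i := v])) \<oplus>\<^bsub>Q\<^esub> coset (basis_elem (vs[i := w]))"
    by (subst add_Q) (simp_all add: g)
  finally show ?thesis .
qed

lemma coset_single:
  assumes "vs \<in> gens"
  shows "coset (Poly_Mapping.single vs c) = c \<odot>\<^bsub>Q\<^esub> coset (basis_elem vs)"
  using assms by (subst smult_Q) simp_all

lemma coset_basis_scale:
  assumes "vs \<in> gens" "i < length vs"
  shows "coset (basis_elem (vs[i := c *s v])) = c \<odot>\<^bsub>Q\<^esub> coset (basis_elem (vs[i := v]))"
proof -
  have g: "vs[i := u] \<in> gens" for u using assms by (simp add: gens_iff)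
  have "basis_elem (vs[i := c *s v]) - Poly_Mapping.single (vs[i := v]) c
    \<in> sym_kernel (standard_rep :: ('n \<Rightarrow> 'n, complex ^ 'n) rep) k"
    using sym_relations_kernel[OF sym_relationsI(3)[OF assms, of v c]] by simp
  then have "coset (basis_elem (vs[i := c *s v])) = coset (Poly_Mapping.single (vs[i := v]) c)"
    by (subst coset_eq) (simp_all add: g)
  also have "\<dots> = c \<odot>\<^bsub>Q\<^esub> coset (basis_elem (vs[i := v]))" by (rule coset_single[OF g])
  finally show ?thesis .
qed

text \<open>Multilinear expansion: the entries of a list are expanded in standard basis vectors one
  position at a time, until only reorderings of monomials remain. Spanning is phrased through
  submodules to fit \<open>tensor_normal_form\<close>.\<close>

lemma sym_span:
  assumes X: "submodule X complex_ring Q" and mono: "\<And>M. int (size M) = k \<Longrightarrow> mono M \<in> X"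
  shows "X = carrier Q"
proof -
  note XD = complex_submoduleD[OF X]
  \<comment> \<open>The entries from position \<open>j\<close> on are already basis vectors. For
    \<open>j\<close> equal to the length this is no restriction, for \<open>j = 0\<close> it
    concerns every entry.\<close>
  have basis: "coset (basis_elem vs) \<in> X" if "vs \<in> gens" "\<forall>l. j \<le> l \<and> l < length vs \<longrightarrow> vs ! l \<in> range (\<lambda>i. axis i 1)"
    for vs j using that
  proof (induction j arbitrary: vs)
    case 0
    then have "set vs \<subseteq> range (\<lambda>i. axis i 1)" by (auto simp: in_set_conv_nth)
    then obtain "is" where vs: "vs = map (\<lambda>i. axis i 1) is" by (metis ex_map_conv subset_iff rangeE)
    let ?ws = "map (\<lambda>i. axis i 1) (SOME js. mset js = mset is) :: (complex ^ 'n) list"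
    have eq: "mset vs = mset ?ws" by (simp add: vs mset_some)
    then have ws: "?ws \<in> gens" by (rule sym_generators_mset[OF 0(1)])
    have "basis_elem vs - basis_elem ?ws \<in> sym_kernel (standard_rep :: ('n \<Rightarrow> 'n, complex ^ 'n) rep) k"
      by (rule sym_relations_kernel[OF sym_relationsI(1)[OF 0(1) eq]])
    then have "coset (basis_elem vs) = mono (mset is)"
      unfolding mono_def by (subst coset_eq) (use 0 ws in simp_all)
    then show ?case using mono[of "mset is"] 0(1) by (simp add: vs gens_iff)
  next
    case (Suc j)
    show ?case
    proof (cases "j < length vs")
      case True
      have upd: "vs[j := axis i 1] \<in> gens" for i using Suc by (simp add: gens_iff)
      have axis: "coset (basis_elem (vs[j := axis i 1])) \<in> X" for i
        using Suc.prems True upd by (intro Suc.IH) (auto simp: nth_list_update)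
      have scale: "coset (basis_elem (vs[j := c *s v])) \<in> X" if "coset (basis_elem (vs[j := v])) \<in> X" for c v
        using XD(4)[OF that, of c] Suc.prems True by (simp add: coset_basis_scale)
      have "coset (basis_elem (vs[j := \<Sum>i\<in>I. (vs ! j $ i) *s axis i 1])) \<in> X" if "finite I" for I
        using that
      proof (induction I)
        case empty
        \<comment> \<open>The zero vector enters as 0 times a basis vector.\<close>
        show ?case using scale[OF axis, of 0] by simp
      next
        case (insert i I)
        then show ?case
          using XD(3)[OF scale[OF axis] insert.IH] Suc.prems True by (simp add: coset_basis_add)
      qed
      from this[of UNIV] show ?thesis by (simp add: basis_expansion)
    next
      case False
      with Suc.prems show ?thesis by (intro Suc.IH) auto
    qed
  qed
  have "coset f \<in> X" if "Poly_Mapping.keys f \<subseteq> gens" for f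
    using that
  proof (induction rule: free_induct)
    case zero
    then show ?case using XD(2) zero_Q' by simp
  next
    case (single vs c)
    then have "coset (basis_elem vs) \<in> X" by (intro basis[of vs "length vs"]) auto
    with XD(4) show ?case unfolding coset_single[OF single, of c] by blast
  next
    case (add f g)
    from XD(3)[OF add(3,4)] add(1,2) show ?case by (simp add: add_Q)
  qed
  then show ?thesis using XD(1) by (auto simp: carrier_eq)
qed

end

section \<open>Cubes and tensors\<close>

text \<open>The domain is explicit because functions are compared on a hypersimplex, on the simplex
  and on the whole space; the statement over \<open>UNIV\<close> implies the others.\<close>

definition aeq :: "(real ^ 'n::finite) set \<Rightarrow> (real ^ 'n \<Rightarrow> complex) \<Rightarrow> (real ^ 'n \<Rightarrow> complex) \<Rightarrow> bool" where
  "aeq D u v \<longleftrightarrow> thin {x \<in> D. u x \<noteq> v x}"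

lemma aeqI: "(\<And>x. x \<in> D \<Longrightarrow> u x = v x) \<Longrightarrow> aeq D u v"
  by (simp add: aeq_def cong: conj_cong)

lemma aeq_refl [simp]: "aeq D u u"
  by (simp add: aeqI)

lemma aeq_sym: "aeq D u v \<Longrightarrow> aeq D v u"
  unfolding aeq_def by (erule thin_subset) auto

lemma aeq_trans [trans]: "aeq D u v \<Longrightarrow> aeq D v w \<Longrightarrow> aeq D u w"
  unfolding aeq_def by (drule (1) thin_Un, erule thin_subset) auto

lemma aeq_subset: "aeq D u v \<Longrightarrow> D' \<subseteq> D \<Longrightarrow> aeq D' u v"
  unfolding aeq_def by (erule thin_subset) auto

lemma aeq_add: "aeq D u v \<Longrightarrow> aeq D u' v' \<Longrightarrow> aeq D (\<lambda>x. u x + u' x) (\<lambda>x. v x + v' x)"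
  unfolding aeq_def by (drule (1) thin_Un, erule thin_subset) auto

lemma aeq_scale: "aeq D u v \<Longrightarrow> aeq D (\<lambda>x. c * u x) (\<lambda>x. c * v x)"
  unfolding aeq_def by (erule thin_subset) auto

lemma aeq_sum: "(\<And>i. i \<in> I \<Longrightarrow> aeq D (u i) (v i)) \<Longrightarrow> aeq D (\<lambda>x. \<Sum>i\<in>I. u i x) (\<lambda>x. \<Sum>i\<in>I. v i x)"
  by (induction I rule: infinite_finite_induct) (auto intro: aeq_add)

lemma aeq_permute:
  assumes "aeq UNIV u v" "bij \<sigma>"
  shows "aeq UNIV (\<lambda>x. u (permute_coords \<sigma> x)) (\<lambda>x. v (permute_coords \<sigma> x))"
proof -
  have "thin (permute_coords (inv_into UNIV \<sigma>) ` {x. u x \<noteq> v x})"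
    using assms by (intro thin_linear_image linear_permute_coords) (simp add: aeq_def)
  then show ?thesis
    unfolding aeq_def
    by (rule thin_subset) (use assms in \<open>auto intro!: image_eqI[of _ _ "permute_coords \<sigma> x" for x]\<close>)
qed

lemma (in symmetric_domain) cls_eq_iff_aeq: "cls u = cls v \<longleftrightarrow> aeq D u v"
  by (simp add: cls_eq_iff aeq_def)

lemma sum_permute_coords:
  fixes x :: "'a::comm_monoid_add ^ 'n::finite"
  assumes "bij \<sigma>"
  shows "(\<Sum>i\<in>UNIV. permute_coords \<sigma> x $ i) = (\<Sum>i\<in>UNIV. x $ i)"
  using sum.reindex_bij_betw[OF bij_imp_bij_inv[OF assms], of "\<lambda>i. x $ i"] by simp

lemma plate_domain_dilated_simplex:
  assumes "CARD('n::finite) \<ge> 2" "r > 0"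
  shows "plate_domain (dilated_simplex r :: (real ^ 'n) set) r"
  by standard (use assms in \<open>auto simp: dilated_simplex_def sum_permute_coords[simplified]\<close>)

lemma plate_domain_hypersimplex:
  assumes "CARD('n::finite) \<ge> 2" "a > 0"
  shows "plate_domain (hypersimplex a :: (real ^ 'n) set) a"
  by standard (use assms in \<open>auto simp: hypersimplex_def sum_permute_coords[simplified]\<close>)

section \<open>Lattice points and translated hypersimplices\<close>

definition point :: "'n::finite multiset \<Rightarrow> real ^ 'n" where
  "point M = (\<chi> i. real (count M i))"

text \<open>The membership test cuts out both the cube at the lattice point of \<open>M\<close> and
  the level of the coordinate sum, and extends the translate by zero to the whole space.\<close>

definition place :: "nat \<Rightarrow> 'n::finite multiset \<Rightarrow> (real ^ 'n \<Rightarrow> complex) \<Rightarrow> real ^ 'n \<Rightarrow> complex" where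
  "place a M f x = of_bool (x - point M \<in> hypersimplex a) * f (x - point M)"

lemma place_add: "place a M (\<lambda>y. f y + g y) x = place a M f x + place a M g x"
  and place_scale: "place a M (\<lambda>y. c * f y) x = c * place a M f x"
  by (simp_all add: place_def distrib_left)

text \<open>Thin sets stay thin under translation, so up to thin sets \<open>place\<close> depends
  only on the class of its argument on the hypersimplex.\<close>

lemma aeq_place:
  assumes "aeq (hypersimplex a) f g"
  shows "aeq UNIV (place a M f) (place a M g)"
proof -
  have "thin ((+) (point M) ` {y \<in> hypersimplex a. f y \<noteq> g y})"
    using assms by (intro thin_translation) (simp add: aeq_def)
  then show ?thesis
    unfolding aeq_def
    by (rule thin_subset) (auto simp: place_def intro!: image_eqI[of _ _ "x - point M" for x])
qed

text \<open>The equation avoids truncated subtraction: for \<open>a > r\<close> the set is empty, in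
  agreement with the vanishing symmetric power of negative degree.\<close>

definition expo :: "nat \<Rightarrow> nat \<Rightarrow> 'n::finite multiset set" where
  "expo r a = {M. size M + a = r}"

lemma finite_expo [simp]: "finite (expo r a :: 'n::finite multiset set)"
proof -
  have "finite (multisets_of_size (UNIV :: 'n set) (r - a))" by (intro finite_multisets_of_size) simp
  then show ?thesis by (rule finite_subset[rotated]) (auto simp: expo_def multisets_of_size_def)
qed

lemma sum_count: "(\<Sum>i\<in>UNIV. count M i) = size M"
  for M :: "'n::finite multiset"
  unfolding size_multiset_overloaded_eq by (rule sum.mono_neutral_right) (auto simp: count_eq_zero_iff)

lemma sum_point: "(\<Sum>i\<in>UNIV. point M $ i) = real (size M)"
  by (simp add: point_def flip: sum_count)

text \<open>Translating and cutting to the half-open cube stays in the span. On the simplex the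
  closed cube differs from it only on the upper walls \<open>x_i = z_i + 1\<close>, which are thin
  slices.\<close>

lemma place_chain:
  fixes f :: "real ^ 'n::finite \<Rightarrow> complex"
  assumes f: "f \<in> chain_span" and M: "M \<in> expo r a" and card: "CARD('n) \<ge> 2"
  shows "\<exists>u\<in>chain_span. aeq (dilated_simplex r) (place a M f) u"
proof -
  let ?c = "\<lambda>i. int (count M i)"
  have "(\<lambda>x. f (x + - point M)) \<in> chain_span"
    using f by (rule chain_span_translate[where a = "\<lambda>i. - ?c i"]) (simp add: point_def)
  from chain_span_mult_box[OF this, of ?c]
  have u: "(\<lambda>x. of_bool (\<forall>i. real_of_int (?c i) \<le> x $ i \<and> x $ i < real_of_int (?c i + 1)) * f (x - point M)) \<in> chain_span"
    (is "?u \<in> _") by simp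
  have "thin (\<Union>i\<in>UNIV. {x :: real ^ 'n. (\<Sum>j\<in>UNIV. x $ j) = real r \<and> x $ i = real (count M i) + 1})"
    by (intro thin_UN thin_slice card) simp
  then have "aeq (dilated_simplex r) (place a M f) ?u"
    unfolding aeq_def
  proof (rule thin_subset, intro subsetI)
    fix x assume x: "x \<in> {x \<in> dilated_simplex r. place a M f x \<noteq> ?u x}"
    then have sum: "(\<Sum>j\<in>UNIV. x $ j) = real r" by (simp add: dilated_simplex_def)
    \<comment> \<open>On the simplex the level condition of the hypersimplex is automatic, since
      \<open>size M + a = r\<close>; the cube conditions remain.\<close>
    have "(\<Sum>j\<in>UNIV. (x - point M) $ j) = real a"
      using M by (simp add: sum_subtractf sum_point sum expo_def flip: of_nat_add)
    then have "x - point M \<in> hypersimplex a \<longleftrightarrow> (\<forall>i. 0 \<le> (x - point M) $ i \<and> (x - point M) $ i \<le> 1)"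
      unfolding hypersimplex_def by blast
    also have "\<dots> \<longleftrightarrow> (\<forall>i. real (count M i) \<le> x $ i \<and> x $ i \<le> real (count M i) + 1)"
      by (auto simp: point_def algebra_simps)
    finally have "x - point M \<in> hypersimplex a \<longleftrightarrow> (\<forall>i. real (count M i) \<le> x $ i \<and> x $ i \<le> real (count M i) + 1)" .
    with x have "\<exists>i. x $ i = real (count M i) + 1"
      by (auto simp: place_def of_bool_def add.commute split: if_splits) (meson order_le_less)+
    with sum show "x \<in> (\<Union>i\<in>UNIV. {x. (\<Sum>j\<in>UNIV. x $ j) = real r \<and> x $ i = real (count M i) + 1})" by auto
  qed
  with u show ?thesis by blast
qed

lemma count_image_mset_inj: "inj f \<Longrightarrow> count (image_mset f M) (f x) = count M x"
  by (induction M) (auto simp: inj_eq)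

text \<open>The inverse permutation carries the cube at \<open>M\<close> to the cube at the image
  multiset and maps the hypersimplex to itself.\<close>

lemma place_permute:
  assumes "bij \<sigma>"
  shows "place a M (\<lambda>y. f (permute_coords (inv_into UNIV \<sigma>) y)) x =
    place a (image_mset (inv_into UNIV \<sigma>) M) f (permute_coords (inv_into UNIV \<sigma>) x)"
proof -
  let ?p = "inv_into UNIV \<sigma>"
  have "count (image_mset ?p M) i = count M (\<sigma> i)" for i
  proof -
    have "count (image_mset ?p M) (?p (\<sigma> i)) = count M (\<sigma> i)"
      using bij_imp_bij_inv[OF assms] by (intro count_image_mset_inj) (simp add: bij_def)
    then show ?thesis using assms by (simp add: bij_is_inj)
  qed
  then have eq: "permute_coords ?p x - point (image_mset ?p M) = permute_coords ?p (x - point M)"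
    using assms by (simp add: vec_eq_iff point_def inv_inv_eq)
  have "permute_coords ?p (x - point M) \<in> hypersimplex a \<longleftrightarrow> x - point M \<in> hypersimplex a"
  proof -
    have closed: "permute_coords \<tau> y \<in> hypersimplex a" if "bij \<tau>" "y \<in> hypersimplex a" for \<tau> and y :: "real ^ 'a"
      using that by (auto simp: hypersimplex_def sum_permute_coords[simplified])
    show ?thesis
      using closed[OF bij_imp_bij_inv[OF assms], of "x - point M"] closed[OF assms, of "permute_coords ?p (x - point M)"]
        assms by auto
  qed
  then show ?thesis by (simp add: place_def eq)
qed

section \<open>Normal forms in tensor products\<close>

lemma map_times_sum: "Poly_Mapping.map ((*) c) (\<Sum>i\<in>I. f i) = (\<Sum>i\<in>I. Poly_Mapping.map ((*) c) (f i))"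
  for f :: "'i \<Rightarrow> 'x \<Rightarrow>\<^sub>0 complex"
  by (induction I rule: infinite_finite_induct) (auto simp: map_times_add)

lemma map_times_single [simp]: "Poly_Mapping.map ((*) c) (Poly_Mapping.single x d) = Poly_Mapping.single x (c * d)"
  for c d :: complex
  by (rule poly_mapping_eqI) (simp add: lookup_single when_def)

lemma tensor_free_simps [simp]:
  "carrier (tensor_free V W) = {f. Poly_Mapping.keys f \<subseteq> carrier V \<times> carrier W}"
  "\<zero>\<^bsub>tensor_free V W\<^esub> = 0"
  "f \<oplus>\<^bsub>tensor_free V W\<^esub> g = f + g"
  "c \<odot>\<^bsub>tensor_free V W\<^esub> f = Poly_Mapping.map ((*) c) f"
  by (simp_all add: tensor_free_def)

lemma minus_tensor_free:
  "Poly_Mapping.keys f \<subseteq> carrier V \<times> carrier W \<Longrightarrow> Poly_Mapping.keys g \<subseteq> carrier V \<times> carrier W \<Longrightarrow>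
    f \<ominus>\<^bsub>tensor_free V W\<^esub> g = f - g"
  by (simp add: tensor_free_def minus_free_rep)

lemma lext_act_tensor_free:
  "lext \<phi> (act (tensor_free V W) g f) = lext (\<lambda>x. \<phi> (act V g (fst x), act W g (snd x))) f"
  by (simp add: tensor_free_def lext_act_free_rep case_prod_beta)

lemma tensor_relations_kernel: "a \<in> tensor_relations V W \<Longrightarrow> a \<in> tensor_kernel V W"
  unfolding tensor_kernel_def by (rule subsetD[OF lin_span_superset])

locale tensor_reps =
  fixes G :: "'g monoid" and V :: "('g, 'v) rep" and W :: "('g, 'w) rep"
  assumes V: "representation G V" and W: "representation G W"
begin

sublocale T: rep_quotient G "tensor_free V W" "tensor_kernel V W"
  by (rule rep_quotient_tensor[OF V W])

abbreviation "N \<equiv> tensor_kernel V W"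

definition tens :: "'v \<Rightarrow> 'w \<Rightarrow> ('v \<times> 'w \<Rightarrow>\<^sub>0 complex) set" where
  "tens v w = T.coset (basis_elem (v, w))"

lemma N_zero: "0 \<in> N" and N_add: "f \<in> N \<Longrightarrow> g \<in> N \<Longrightarrow> f + g \<in> N"
  using complex_submoduleD(2-3)[OF T.sub] by simp_all

lemma N_sum: "(\<And>i. i \<in> I \<Longrightarrow> f i \<in> N) \<Longrightarrow> (\<Sum>i\<in>I. f i) \<in> N"
  by (induction I rule: infinite_finite_induct) (auto simp: N_zero N_add)

lemma coset_eq:
  assumes "Poly_Mapping.keys f \<subseteq> carrier V \<times> carrier W" "Poly_Mapping.keys g \<subseteq> carrier V \<times> carrier W"
  shows "T.coset f = T.coset g \<longleftrightarrow> f - g \<in> N"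
  using T.coset_eq_iff[of f g] minus_tensor_free[OF assms] assms by simp

lemma carrier_eq: "carrier T.Q = T.coset ` {f. Poly_Mapping.keys f \<subseteq> carrier V \<times> carrier W}"
  by (simp add: T.carrier_Q)

lemma coset_add:
  "Poly_Mapping.keys f \<subseteq> carrier V \<times> carrier W \<Longrightarrow> Poly_Mapping.keys g \<subseteq> carrier V \<times> carrier W \<Longrightarrow>
    T.coset (f + g) = T.coset f \<oplus>\<^bsub>T.Q\<^esub> T.coset g"
  by (simp add: T.add_Q)

lemma tens_add_left:
  assumes "v \<in> carrier V" "v' \<in> carrier V" "w \<in> carrier W"
  shows "tens (v \<oplus>\<^bsub>V\<^esub> v') w = tens v w \<oplus>\<^bsub>T.Q\<^esub> tens v' w"
proof -
  have "tens (v \<oplus>\<^bsub>V\<^esub> v') w = T.coset (basis_elem (v, w) + basis_elem (v', w))"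
    unfolding tens_def
    by (subst coset_eq)
      (use assms tensor_relations_kernel[OF tensor_relationsI(1)[OF assms]] in
        \<open>simp_all add: representation_closed[OF V] free_carrier_add diff_diff_eq\<close>)
  then show ?thesis using assms by (simp add: coset_add tens_def)
qed

lemma single_eq: "v \<in> carrier V \<Longrightarrow> w \<in> carrier W \<Longrightarrow> T.coset (Poly_Mapping.single (v, w) c) = c \<odot>\<^bsub>T.Q\<^esub> tens v w"
  unfolding tens_def by (subst T.smult_Q) simp_all

lemma tens_smult_left:
  assumes "v \<in> carrier V" "w \<in> carrier W"
  shows "tens (c \<odot>\<^bsub>V\<^esub> v) w = c \<odot>\<^bsub>T.Q\<^esub> tens v w"
proof -
  have "tens (c \<odot>\<^bsub>V\<^esub> v) w = T.coset (Poly_Mapping.single (v, w) c)"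
    unfolding tens_def
    by (subst coset_eq)
      (use assms tensor_relations_kernel[OF tensor_relationsI(3)[OF assms, of c]] in
        \<open>simp_all add: representation_closed[OF V]\<close>)
  then show ?thesis using assms by (simp only: single_eq)
qed

text \<open>In the scalar relation with \<open>c = 0\<close> the second term is the zero function,
  so the generator itself lies in the kernel.\<close>

lemma tens_zero_right:
  assumes "v \<in> carrier V"
  shows "basis_elem (v, \<zero>\<^bsub>W\<^esub>) \<in> N"
proof -
  interpret W: Module.module complex_ring W by (rule representationD(2)[OF W])
  have "basis_elem (v, 0 \<odot>\<^bsub>W\<^esub> \<zero>\<^bsub>W\<^esub>) - Poly_Mapping.single (v, \<zero>\<^bsub>W\<^esub>) 0 \<in> N"
    by (rule tensor_relations_kernel[OF tensor_relationsI(4)]) (use assms in auto)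
  then show ?thesis using W.smult_l_null[of "\<zero>\<^bsub>W\<^esub>"] by simp
qed

lemma tens_zero_left:
  assumes "w \<in> carrier W"
  shows "tens \<zero>\<^bsub>V\<^esub> w = \<zero>\<^bsub>T.Q\<^esub>"
proof -
  interpret V: Module.module complex_ring V by (rule representationD(2)[OF V])
  interpret T': Module.module complex_ring T.Q by (rule representationD(2)[OF T.representation_Q])
  have "tens (0 \<odot>\<^bsub>V\<^esub> \<zero>\<^bsub>V\<^esub>) w = 0 \<odot>\<^bsub>T.Q\<^esub> tens \<zero>\<^bsub>V\<^esub> w"
    using assms by (intro tens_smult_left) auto
  moreover have "tens \<zero>\<^bsub>V\<^esub> w \<in> carrier T.Q"
    unfolding carrier_eq tens_def using assms by (intro imageI) simp
  ultimately show ?thesis using V.smult_l_null[of "\<zero>\<^bsub>V\<^esub>"] T'.smult_l_null[of "tens \<zero>\<^bsub>V\<^esub> w"] by simp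
qed

text \<open>Sums of the displayed form constitute a submodule \<open>H\<close>. The vectors
  \<open>v\<close> for which \<open>v \<otimes> w\<close> lies in \<open>H\<close> for all
  \<open>w\<close> form a submodule of \<open>V\<close> containing the family \<open>e\<close>,
  hence all of \<open>V\<close>.\<close>

lemma tensor_normal_form:
  assumes fin: "finite I" and e: "\<And>m. m \<in> I \<Longrightarrow> e m \<in> carrier V"
    and span: "\<And>X. submodule X complex_ring V \<Longrightarrow> e ` I \<subseteq> X \<Longrightarrow> X = carrier V"
    and t: "t \<in> carrier T.Q"
  shows "\<exists>h. (\<forall>m\<in>I. h m \<in> carrier W) \<and> t = T.coset (\<Sum>m\<in>I. basis_elem (e m, h m))"
proof -
  let ?s = "\<lambda>h. \<Sum>m\<in>I. basis_elem (e m, h m)"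
  let ?H = "{T.coset (?s h) | h. \<forall>m\<in>I. h m \<in> carrier W}"
  have keys_sum: "Poly_Mapping.keys (\<Sum>m\<in>J. f m) \<subseteq> carrier V \<times> carrier W"
    if "\<And>m. m \<in> J \<Longrightarrow> Poly_Mapping.keys (f m) \<subseteq> carrier V \<times> carrier W"
    for J and f :: "_ \<Rightarrow> 'v \<times> 'w \<Rightarrow>\<^sub>0 complex"
    using that by (induction J rule: infinite_finite_induct) (auto simp: free_carrier_add simp del: Un_subset_iff)
  have keys: "Poly_Mapping.keys (?s h) \<subseteq> carrier V \<times> carrier W" if "\<forall>m\<in>I. h m \<in> carrier W" for h
    using that e by (intro keys_sum) simp
  note Wc = representation_closed[OF W]
  have sub: "submodule ?H complex_ring T.Q"
  proof (rule complex_submoduleI)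
    show "Module.module complex_ring T.Q" by (rule representationD(2)[OF T.representation_Q])
    show "?H \<subseteq> carrier T.Q" using keys by (auto simp: carrier_eq)
    have "?s (\<lambda>_. \<zero>\<^bsub>W\<^esub>) \<in> N" by (intro N_sum tens_zero_right e)
    then have "T.coset (?s (\<lambda>_. \<zero>\<^bsub>W\<^esub>)) = T.coset 0"
      using keys[of "\<lambda>_. \<zero>\<^bsub>W\<^esub>"] Wc(1) by (subst coset_eq) auto
    then have "T.coset (?s (\<lambda>_. \<zero>\<^bsub>W\<^esub>)) = \<zero>\<^bsub>T.Q\<^esub>" by (simp add: T.zero_Q')
    then show "\<zero>\<^bsub>T.Q\<^esub> \<in> ?H" using Wc(1) by (intro CollectI exI[of _ "\<lambda>_. \<zero>\<^bsub>W\<^esub>"]) simp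
  next
    fix a b assume "a \<in> ?H" "b \<in> ?H"
    then obtain h h' where h: "\<forall>m\<in>I. h m \<in> carrier W" "a = T.coset (?s h)"
      and h': "\<forall>m\<in>I. h' m \<in> carrier W" "b = T.coset (?s h')" by auto
    let ?g = "\<lambda>m. h m \<oplus>\<^bsub>W\<^esub> h' m"
    have g: "\<forall>m\<in>I. ?g m \<in> carrier W" using h h' Wc by auto
    have "(\<Sum>m\<in>I. basis_elem (e m, ?g m) - basis_elem (e m, h m) - basis_elem (e m, h' m)) \<in> N"
      using h h' e by (intro N_sum tensor_relations_kernel tensor_relationsI) auto
    then have "?s ?g - (?s h + ?s h') \<in> N" by (simp add: sum_subtractf sum.distrib diff_diff_eq)
    then have "T.coset (?s ?g) = a \<oplus>\<^bsub>T.Q\<^esub> b"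
      using h h' g keys by (simp add: coset_eq free_carrier_add flip: coset_add)
    then show "a \<oplus>\<^bsub>T.Q\<^esub> b \<in> ?H" using g by (intro CollectI exI[of _ ?g]) simp
  next
    fix a c assume "a \<in> ?H"
    then obtain h where h: "\<forall>m\<in>I. h m \<in> carrier W" "a = T.coset (?s h)" by auto
    let ?g = "\<lambda>m. c \<odot>\<^bsub>W\<^esub> h m"
    have g: "\<forall>m\<in>I. ?g m \<in> carrier W" using h Wc by auto
    have "(\<Sum>m\<in>I. basis_elem (e m, ?g m) - Poly_Mapping.single (e m, h m) c) \<in> N"
      using h e by (intro N_sum tensor_relations_kernel tensor_relationsI) auto
    then have "?s ?g - Poly_Mapping.map ((*) c) (?s h) \<in> N" by (simp add: sum_subtractf map_times_sum)
    moreover have "c \<odot>\<^bsub>T.Q\<^esub> a = T.coset (Poly_Mapping.map ((*) c) (?s h))"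
      using h keys by (simp add: T.smult_Q)
    ultimately have "T.coset (?s ?g) = c \<odot>\<^bsub>T.Q\<^esub> a"
      using h g keys by (simp add: coset_eq free_carrier_map_times)
    then show "c \<odot>\<^bsub>T.Q\<^esub> a \<in> ?H" using g by (intro CollectI exI[of _ ?g]) simp
  qed
  define H where "H = ?H"
  note HD = complex_submoduleD[OF sub, folded H_def]
  let ?X = "{v \<in> carrier V. \<forall>w\<in>carrier W. tens v w \<in> H}"
  have "?X = carrier V"
  proof (rule span)
    show "submodule ?X complex_ring V"
      by (rule complex_submoduleI[OF representationD(2)[OF V]])
        (auto simp: representation_closed[OF V] tens_zero_left tens_add_left tens_smult_left HD(2-4))
    show "e ` I \<subseteq> ?X"
    proof safe
      fix m assume m: "m \<in> I"
      then show "e m \<in> carrier V" by (rule e)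
      fix w assume w: "w \<in> carrier W"
      \<comment> \<open>All entries but the one at \<open>m\<close> are zero; generators with second
        component zero lie in the kernel, so the sum represents
        \<open>e m \<otimes> w\<close>.\<close>
      let ?h = "\<lambda>m'. if m' = m then w else \<zero>\<^bsub>W\<^esub>"
      have h: "\<forall>m\<in>I. ?h m \<in> carrier W" using w Wc(1) by auto
      have "?s ?h = basis_elem (e m, w) + (\<Sum>m'\<in>I - {m}. basis_elem (e m', ?h m'))"
        using fin m by (simp add: sum.remove)
      moreover have "(\<Sum>m'\<in>I - {m}. basis_elem (e m', ?h m')) \<in> N"
        by (intro N_sum) (auto intro: tens_zero_right e)
      ultimately have "?s ?h - basis_elem (e m, w) \<in> N" by simp
      then have "T.coset (?s ?h) = tens (e m) w"
        unfolding tens_def using keys[OF h] w e[OF m] by (subst coset_eq) simp_all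
      then show "tens (e m) w \<in> H"
        unfolding H_def using h by (intro CollectI exI[of _ ?h]) simp
    qed
  qed
  then have tens_H: "tens v w \<in> H" if "v \<in> carrier V" "w \<in> carrier W" for v w
    using that by blast
  have "T.coset f \<in> H" if "Poly_Mapping.keys f \<subseteq> carrier V \<times> carrier W" for f
    using that
  proof (induction rule: free_induct)
    case zero
    from HD(2) show ?case by (simp only: T.zero_Q' tensor_free_simps)
  next
    case (single x c)
    then obtain v w where "x = (v, w)" "v \<in> carrier V" "w \<in> carrier W" by auto
    with HD(4)[OF tens_H[of v w], of c] show ?case by (simp only: single_eq)
  next
    case (add f g)
    from HD(3)[OF add(3,4)] add(1,2) show ?case by (simp only: coset_add)
  qed
  with t have "t \<in> H" unfolding carrier_eq by blast
  then show ?thesis unfolding H_def by blast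
qed

end

section \<open>The contribution of one hypersimplex\<close>

text \<open>The setting of a single summand: \<open>B\<close> is the hypersimplex, \<open>E\<close>
  the simplex, and \<open>S\<close> the symmetric power of degree \<open>r - a\<close>, which may be
  negative.\<close>

locale piece =
  fixes r a :: nat and ty :: "'n::finite itself"
  assumes card_ge: "CARD('n) \<ge> 2" and a_pos: "a > 0" and r_pos: "r > 0"
begin

sublocale B: plate_domain "hypersimplex a :: (real ^ 'n) set" a
  by (rule plate_domain_hypersimplex[OF card_ge a_pos])

sublocale E: plate_domain "dilated_simplex r :: (real ^ 'n) set" r
  by (rule plate_domain_dilated_simplex[OF card_ge r_pos])

sublocale S: standard_sym "int r - int a" ty .

abbreviation "W \<equiv> Pl (hypersimplex a :: (real ^ 'n) set) a"

sublocale tensor_reps Sym_group S.Q W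
  by standard (rule S.representation_Q B.representation_Pl)+

abbreviation "X \<equiv> expo r a :: 'n multiset set"

lemma expo_size: "M \<in> X \<Longrightarrow> int (size M) = int r - int a"
  by (auto simp: expo_def)

text \<open>A representative defined on the whole space, so that it can be translated. The choice
  need not be linear in \<open>w\<close>, so linearity is recovered only up to thin sets.\<close>

definition chain_rep :: "(real ^ 'n \<Rightarrow> complex) set \<Rightarrow> real ^ 'n \<Rightarrow> complex" where
  "chain_rep w = (SOME f. f \<in> chain_span \<and> B.cls f = w)"

lemma chain_rep:
  assumes "w \<in> carrier W"
  shows "chain_rep w \<in> chain_span" "B.cls (chain_rep w) = w"
proof -
  from assms have "\<exists>f. f \<in> chain_span \<and> B.cls f = w" by (auto simp: B.carrier_Pl)
  from someI_ex[OF this] show "chain_rep w \<in> chain_span" "B.cls (chain_rep w) = w" by (simp_all add: chain_rep_def)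
qed

text \<open>The rule \<open>X^z \<otimes> f \<mapsto> f(x - z)\<close>, extended linearly in the
  first factor by means of the coefficients so that it applies to arbitrary classes.\<close>

definition simple_tensor_fun :: "((complex ^ 'n) list \<Rightarrow>\<^sub>0 complex) set \<times> (real ^ 'n \<Rightarrow> complex) set \<Rightarrow> real ^ 'n \<Rightarrow> complex" where
  "simple_tensor_fun p x = (\<Sum>M\<in>X. S.coef (fst p) M * place a M (chain_rep (snd p)) x)"

lemma aeq_simple_tensor_fun:
  assumes "w \<in> carrier W" "B.cls u = w"
  shows "aeq UNIV (simple_tensor_fun (s, w)) (\<lambda>x. \<Sum>M\<in>X. S.coef s M * place a M u x)"
proof -
  have "aeq (hypersimplex a) (chain_rep w) u"
    using chain_rep(2)[OF assms(1)] assms(2) by (simp flip: B.cls_eq_iff_aeq)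
  then show ?thesis unfolding simple_tensor_fun_def fst_conv snd_conv by (intro aeq_sum aeq_scale aeq_place)
qed

definition free_fun :: "(((complex ^ 'n) list \<Rightarrow>\<^sub>0 complex) set \<times> (real ^ 'n \<Rightarrow> complex) set \<Rightarrow>\<^sub>0 complex)
    \<Rightarrow> real ^ 'n \<Rightarrow> complex" where
  "free_fun g x = lext (\<lambda>p. simple_tensor_fun p x) g"

lemma free_fun_zero: "free_fun 0 x = 0"
  and free_fun_add: "free_fun (f + g) x = free_fun f x + free_fun g x"
  and free_fun_diff: "free_fun (f - g) x = free_fun f x - free_fun g x"
  and free_fun_scale: "free_fun (Poly_Mapping.map ((*) c) f) x = c * free_fun f x"
  and free_fun_single: "free_fun (Poly_Mapping.single p c) x = c * simple_tensor_fun p x"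
  and free_fun_sum: "free_fun (\<Sum>i\<in>I. h i) x = (\<Sum>i\<in>I. free_fun (h i) x)"
  by (simp_all add: free_fun_def lext_add lext_diff lext_map_times lext_sum)

text \<open>Relations in the first factor hold pointwise because coefficients are linear. Those in
  the second hold up to a thin set, because chosen representatives are additive and homogeneous only
  modulo null functions.\<close>

lemma free_fun_relations:
  assumes "g \<in> tensor_relations S.Q W"
  shows "aeq UNIV (free_fun g) (\<lambda>x. 0)"
  using assms
proof (cases rule: tensor_relations_cases)
  case (1 v v' w)
  then show ?thesis
    by (intro aeqI) (simp add: free_fun_diff free_fun_single simple_tensor_fun_def S.coef_add distrib_right sum.distrib)
next
  case (2 v w w')
  let ?u = "\<lambda>y. chain_rep w y + chain_rep w' y"
  have "B.cls ?u = w \<oplus>\<^bsub>W\<^esub> w'" using 2 by (simp add: chain_rep flip: B.add_Pl)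
  then have "aeq UNIV (simple_tensor_fun (v, w \<oplus>\<^bsub>W\<^esub> w')) (\<lambda>x. \<Sum>M\<in>X. S.coef v M * place a M ?u x)"
    using 2 by (intro aeq_simple_tensor_fun) (simp_all add: representation_closed[OF B.representation_Pl])
  then have "aeq UNIV (simple_tensor_fun (v, w \<oplus>\<^bsub>W\<^esub> w')) (\<lambda>x. simple_tensor_fun (v, w) x + simple_tensor_fun (v, w') x)"
    by (simp add: simple_tensor_fun_def place_add distrib_left sum.distrib)
  then show ?thesis unfolding aeq_def by (rule thin_subset) (auto simp: 2 free_fun_diff free_fun_single)
next
  case (3 c v w)
  then show ?thesis
    by (intro aeqI) (simp add: free_fun_diff free_fun_single simple_tensor_fun_def S.coef_smult sum_distrib_left mult.assoc)
next
  case (4 c v w)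
  let ?u = "\<lambda>y. c * chain_rep w y"
  have "B.cls ?u = c \<odot>\<^bsub>W\<^esub> w" using 4 by (simp add: chain_rep flip: B.smult_Pl)
  then have "aeq UNIV (simple_tensor_fun (v, c \<odot>\<^bsub>W\<^esub> w)) (\<lambda>x. \<Sum>M\<in>X. S.coef v M * place a M ?u x)"
    using 4 by (intro aeq_simple_tensor_fun) (simp_all add: representation_closed[OF B.representation_Pl])
  then have "aeq UNIV (simple_tensor_fun (v, c \<odot>\<^bsub>W\<^esub> w)) (\<lambda>x. c * simple_tensor_fun (v, w) x)"
    by (simp add: simple_tensor_fun_def place_scale sum_distrib_left mult.left_commute)
  then show ?thesis unfolding aeq_def by (rule thin_subset) (auto simp: 4 free_fun_diff free_fun_single)
qed

lemma free_fun_kernel: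
  assumes "g \<in> N"
  shows "aeq UNIV (free_fun g) (\<lambda>x. 0)"
proof -
  have g: "g \<in> lin_span (tensor_free S.Q W) (tensor_relations S.Q W)"
    using assms by (simp add: tensor_kernel_def)
  have mod: "Module.module complex_ring (tensor_free S.Q W)" by (rule representationD(2)[OF T.rep])
  have carr: "tensor_relations S.Q W \<subseteq> carrier (tensor_free S.Q W)"
    by (rule tensor_relations_carrier[OF S.representation_Q B.representation_Pl])
  show ?thesis
    using g mod carr
  proof (induction rule: lin_span_induct)
    case zero
    show ?case by (simp add: free_fun_zero[abs_def])
  next
    case (base f)
    then show ?case by (rule free_fun_relations)
  next
    case (add f g)
    from aeq_add[OF add(3,4)] show ?case by (simp add: free_fun_add[abs_def])
  next
    case (smult c f)
    from aeq_scale[OF smult(2), of c] show ?case by (simp add: free_fun_scale[abs_def])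
  qed
qed

abbreviation "free \<equiv> {g. Poly_Mapping.keys g \<subseteq> carrier S.Q \<times> carrier W}"

text \<open>A function rather than a class: the contributions of different \<open>a\<close> are
  added as functions before classes on the simplex are taken.\<close>

definition tensor_fun :: "(((complex ^ 'n) list \<Rightarrow>\<^sub>0 complex) set \<times> (real ^ 'n \<Rightarrow> complex) set \<Rightarrow>\<^sub>0 complex) set
    \<Rightarrow> real ^ 'n \<Rightarrow> complex" where
  "tensor_fun t = free_fun (SOME g. g \<in> free \<and> T.coset g = t)"

lemma tensor_fun_coset:
  assumes "g \<in> free"
  shows "aeq UNIV (tensor_fun (T.coset g)) (free_fun g)"
proof -
  define f where "f = (SOME f. f \<in> free \<and> T.coset f = T.coset g)"
  have "f \<in> free \<and> T.coset f = T.coset g"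
    unfolding f_def by (rule someI[of _ g]) (use assms in simp)
  with assms coset_eq[of f g] have "f - g \<in> N" by auto
  from free_fun_kernel[OF this] have "aeq UNIV (free_fun f) (free_fun g)"
    by (simp add: aeq_def free_fun_diff)
  then show ?thesis by (simp add: tensor_fun_def f_def)
qed

lemma tensor_fun_add:
  assumes "t \<in> carrier T.Q" "t' \<in> carrier T.Q"
  shows "aeq UNIV (tensor_fun (t \<oplus>\<^bsub>T.Q\<^esub> t')) (\<lambda>x. tensor_fun t x + tensor_fun t' x)"
proof -
  obtain g g' where g: "g \<in> free" "t = T.coset g" "g' \<in> free" "t' = T.coset g'"
    using assms unfolding carrier_eq by blast
  have "aeq UNIV (tensor_fun (t \<oplus>\<^bsub>T.Q\<^esub> t')) (free_fun (g + g'))"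
    using tensor_fun_coset[of "g + g'"] g by (simp add: free_carrier_add coset_add)
  moreover have "aeq UNIV (\<lambda>x. tensor_fun t x + tensor_fun t' x) (free_fun (g + g'))"
    using aeq_add[OF tensor_fun_coset[OF g(1)] tensor_fun_coset[OF g(3)]] by (simp add: g free_fun_add[abs_def])
  ultimately show ?thesis by (meson aeq_sym aeq_trans)
qed

lemma tensor_fun_smult:
  assumes "t \<in> carrier T.Q"
  shows "aeq UNIV (tensor_fun (c \<odot>\<^bsub>T.Q\<^esub> t)) (\<lambda>x. c * tensor_fun t x)"
proof -
  obtain g where g: "g \<in> free" "t = T.coset g"
    using assms unfolding carrier_eq by blast
  have "aeq UNIV (tensor_fun (c \<odot>\<^bsub>T.Q\<^esub> t)) (free_fun (Poly_Mapping.map ((*) c) g))"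
    using tensor_fun_coset[of "Poly_Mapping.map ((*) c) g"] g by (simp add: free_carrier_map_times T.smult_Q)
  moreover have "aeq UNIV (\<lambda>x. c * tensor_fun t x) (free_fun (Poly_Mapping.map ((*) c) g))"
    using aeq_scale[OF tensor_fun_coset[OF g(1)], of c] by (simp add: g free_fun_scale[abs_def])
  ultimately show ?thesis by (meson aeq_sym aeq_trans)
qed

lemma image_expo:
  assumes "bij \<sigma>"
  shows "bij_betw (image_mset \<sigma>) X X"
proof (rule bij_betw_byWitness[where f' = "image_mset (inv_into UNIV \<sigma>)"])
  have "inv_into UNIV \<sigma> \<circ> \<sigma> = id" "\<sigma> \<circ> inv_into UNIV \<sigma> = id"
    using assms by (auto simp: bij_is_inj bij_is_surj surj_f_inv_f)
  then show "\<forall>M\<in>X. image_mset (inv_into UNIV \<sigma>) (image_mset \<sigma> M) = M"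
    "\<forall>M\<in>X. image_mset \<sigma> (image_mset (inv_into UNIV \<sigma>) M) = M"
    by (simp_all add: multiset.map_comp)
qed (auto simp: expo_def)

text \<open>Coefficients and placements are both pulled back along the inverse permutation, so the
  sum over exponents is only reindexed by the induced bijection of \<open>X\<close>.\<close>

lemma simple_tensor_fun_act:
  assumes \<sigma>: "bij \<sigma>" and s: "s \<in> carrier S.Q" and w: "w \<in> carrier W"
  shows "aeq UNIV (simple_tensor_fun (act S.Q \<sigma> s, act W \<sigma> w)) (\<lambda>x. simple_tensor_fun (s, w) (permute_coords (inv_into UNIV \<sigma>) x))"
proof -
  let ?p = "inv_into UNIV \<sigma>"
  let ?u = "\<lambda>y. chain_rep w (permute_coords ?p y)"
  have "B.cls ?u = act W \<sigma> w" using w \<sigma> by (simp add: chain_rep flip: B.act_Pl)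
  moreover have "act W \<sigma> w \<in> carrier W"
    using \<sigma> w by (intro representationD(4)[OF B.representation_Pl]) (simp_all add: carrier_Sym_group)
  ultimately have "aeq UNIV (simple_tensor_fun (act S.Q \<sigma> s, act W \<sigma> w))
      (\<lambda>x. \<Sum>M\<in>X. S.coef (act S.Q \<sigma> s) M * place a M ?u x)"
    by (intro aeq_simple_tensor_fun)
  moreover have "(\<Sum>M\<in>X. S.coef (act S.Q \<sigma> s) M * place a M ?u x) = simple_tensor_fun (s, w) (permute_coords ?p x)" for x
  proof -
    have "(\<Sum>M\<in>X. S.coef (act S.Q \<sigma> s) M * place a M ?u x) =
        (\<Sum>M\<in>X. S.coef s (image_mset ?p M) * place a (image_mset ?p M) (chain_rep w) (permute_coords ?p x))"
      using s \<sigma> by (simp add: S.coef_act place_permute)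
    also have "\<dots> = simple_tensor_fun (s, w) (permute_coords ?p x)"
      unfolding simple_tensor_fun_def fst_conv snd_conv
      by (rule sum.reindex_bij_betw[OF image_expo[OF bij_imp_bij_inv[OF \<sigma>]]])
    finally show ?thesis .
  qed
  ultimately show ?thesis by simp
qed

lemma tensor_fun_act:
  assumes t: "t \<in> carrier T.Q" and \<sigma>: "bij \<sigma>"
  shows "aeq UNIV (tensor_fun (act T.Q \<sigma> t)) (\<lambda>x. tensor_fun t (permute_coords (inv_into UNIV \<sigma>) x))"
proof -
  let ?p = "inv_into UNIV \<sigma>" and ?F = "tensor_free S.Q W"
  obtain g where g: "g \<in> free" "t = T.coset g"
    using t unfolding carrier_eq by blast
  have \<sigma>G: "\<sigma> \<in> carrier Sym_group" using \<sigma> by (simp add: carrier_Sym_group)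
  have "act ?F \<sigma> g \<in> carrier ?F"
    using g \<sigma>G by (intro representationD(4)[OF T.rep]) simp_all
  then have "aeq UNIV (tensor_fun (act T.Q \<sigma> t)) (free_fun (act ?F \<sigma> g))"
    using tensor_fun_coset[of "act ?F \<sigma> g"] g \<sigma>G by (simp add: T.act_Q)
  moreover have "aeq UNIV (free_fun (act ?F \<sigma> g)) (\<lambda>x. free_fun g (permute_coords ?p x))"
  proof -
    have "free_fun (act ?F \<sigma> g) = (\<lambda>x. \<Sum>p\<in>Poly_Mapping.keys g.
        Poly_Mapping.lookup g p * simple_tensor_fun (act S.Q \<sigma> (fst p), act W \<sigma> (snd p)) x)"
      by (simp add: fun_eq_iff free_fun_def lext_act_tensor_free) (simp add: lext_def)
    moreover have "aeq UNIV (simple_tensor_fun (act S.Q \<sigma> (fst p), act W \<sigma> (snd p))) (\<lambda>x. simple_tensor_fun p (permute_coords ?p x))"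
      if "p \<in> Poly_Mapping.keys g" for p
      using that g(1) simple_tensor_fun_act[OF \<sigma>, of "fst p" "snd p"] by auto
    ultimately show ?thesis
      by (simp add: free_fun_def[of g, unfolded lext_def]) (intro aeq_sum aeq_scale)
  qed
  moreover have "aeq UNIV (\<lambda>x. free_fun g (permute_coords ?p x)) (\<lambda>x. tensor_fun t (permute_coords ?p x))"
    using aeq_permute[OF aeq_sym[OF tensor_fun_coset[OF g(1)]] bij_imp_bij_inv[OF \<sigma>]] g by simp
  ultimately show ?thesis by (meson aeq_trans)
qed

text \<open>Coefficients are dual to monomials, so each term of a normal form contributes to exactly
  one cube.\<close>

lemma free_fun_normal:
  assumes "\<And>M. M \<in> X \<Longrightarrow> h M \<in> carrier W"
  shows "free_fun (\<Sum>M\<in>X. basis_elem (S.mono M, h M)) x = (\<Sum>M\<in>X. place a M (chain_rep (h M)) x)"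
proof -
  have "simple_tensor_fun (S.mono M, h M) x = place a M (chain_rep (h M)) x" if M: "M \<in> X" for M
  proof -
    have "simple_tensor_fun (S.mono M, h M) x = (\<Sum>M'\<in>X. if M = M' then place a M' (chain_rep (h M)) x else 0)"
      unfolding simple_tensor_fun_def fst_conv snd_conv
      by (intro sum.cong refl) (use M in \<open>simp add: S.coef_mono expo_size\<close>)
    then show ?thesis using M by simp
  qed
  then show ?thesis by (simp add: free_fun_sum free_fun_single)
qed

lemma free_fun_normal_ext:
  assumes "\<And>M. M \<in> X \<Longrightarrow> h M \<in> carrier W"
  shows "free_fun (\<Sum>M\<in>X. basis_elem (S.mono M, h M)) = (\<lambda>x. \<Sum>M\<in>X. place a M (chain_rep (h M)) x)"
  using free_fun_normal[OF assms] by (rule ext)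

lemma normal_free:
  assumes "\<And>M. M \<in> X \<Longrightarrow> h M \<in> carrier W"
  shows "(\<Sum>M\<in>X. basis_elem (S.mono M, h M)) \<in> free"
proof -
  have "Poly_Mapping.keys (\<Sum>M\<in>J. basis_elem (S.mono M, h M)) \<subseteq> carrier S.Q \<times> carrier W" if "J \<subseteq> X" for J
  proof -
    have "finite J" using that by (rule finite_subset) simp
    then show ?thesis using that
      by (induction J) (simp_all add: free_carrier_add assms S.mono_carrier expo_size)
  qed
  then show ?thesis by simp
qed

text \<open>Exports the normal form of \<open>t\<close> as functions, so that the cubes of different
  \<open>a\<close> can be separated outside this locale. The last implication is the injectivity
  statement for one summand: null entries in the normal form give the zero tensor.\<close>

lemma tensor_decompose:
  assumes t: "t \<in> carrier T.Q"
  shows "\<exists>h. (\<forall>M\<in>X. h M \<in> chain_span) \<and> aeq UNIV (tensor_fun t) (\<lambda>x. \<Sum>M\<in>X. place a M (h M) x) \<and>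
    ((\<forall>M\<in>X. aeq (hypersimplex a) (h M) (\<lambda>x. 0)) \<longrightarrow> t = \<zero>\<^bsub>T.Q\<^esub>)"
proof -
  have "\<exists>h. (\<forall>M\<in>X. h M \<in> carrier W) \<and> t = T.coset (\<Sum>M\<in>X. basis_elem (S.mono M, h M))"
  proof (rule tensor_normal_form[OF _ _ _ t])
    show "finite X" by simp
    show "S.mono M \<in> carrier S.Q" if "M \<in> X" for M using that by (intro S.mono_carrier expo_size)
    fix Y assume Y: "submodule Y complex_ring S.Q" "S.mono ` X \<subseteq> Y"
    show "Y = carrier S.Q"
    proof (rule S.sym_span[OF Y(1)])
      fix M :: "'n multiset" assume "int (size M) = int r - int a"
      then have "M \<in> X" by (simp add: expo_def)
      with Y(2) show "S.mono M \<in> Y" by blast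
    qed
  qed
  then obtain h where h: "\<And>M. M \<in> X \<Longrightarrow> h M \<in> carrier W"
    and t_eq: "t = T.coset (\<Sum>M\<in>X. basis_elem (S.mono M, h M))" by blast
  show ?thesis
  proof (intro exI[of _ "\<lambda>M. chain_rep (h M)"] conjI ballI impI)
    show "chain_rep (h M) \<in> chain_span" if "M \<in> X" for M using chain_rep(1)[OF h[OF that]] .
    show "aeq UNIV (tensor_fun t) (\<lambda>x. \<Sum>M\<in>X. place a M (chain_rep (h M)) x)"
      using tensor_fun_coset[OF normal_free[OF h]] by (simp add: t_eq free_fun_normal_ext[OF h])
    assume null: "\<forall>M\<in>X. aeq (hypersimplex a) (chain_rep (h M)) (\<lambda>x. 0)"
    have "h M = \<zero>\<^bsub>W\<^esub>" if "M \<in> X" for M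
      using bspec[OF null that] chain_rep(2)[OF h[OF that]] by (simp add: B.zero_Pl flip: B.cls_eq_iff_aeq)
    then have "(\<Sum>M\<in>X. basis_elem (S.mono M, h M)) = (\<Sum>M\<in>X. basis_elem (S.mono M, \<zero>\<^bsub>W\<^esub>))"
      by (intro sum.cong) auto
    also have "\<dots> \<in> N" by (intro N_sum tens_zero_right S.mono_carrier expo_size)
    finally show "t = \<zero>\<^bsub>T.Q\<^esub>"
      using T.coset_eq_zero_iff normal_free[OF h] by (simp add: t_eq T.zero_Q)
  qed
qed

text \<open>The witness is a normal form whose entries are the classes of the functions prescribed
  on the cubes.\<close>

lemma tensor_compose:
  assumes "\<And>M. M \<in> X \<Longrightarrow> h M \<in> chain_span"
  obtains t where "t \<in> carrier T.Q" "aeq UNIV (tensor_fun t) (\<lambda>x. \<Sum>M\<in>X. place a M (h M) x)"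
proof -
  let ?g = "\<Sum>M\<in>X. basis_elem (S.mono M, B.cls (h M))"
  have h: "B.cls (h M) \<in> carrier W" if "M \<in> X" for M using assms[OF that] by (simp add: B.carrier_Pl)
  show thesis
  proof
    show "T.coset ?g \<in> carrier T.Q" unfolding carrier_eq by (intro imageI normal_free h)
    have "aeq UNIV (tensor_fun (T.coset ?g)) (free_fun ?g)" by (intro tensor_fun_coset normal_free h)
    also have "aeq UNIV (free_fun ?g) (\<lambda>x. \<Sum>M\<in>X. place a M (h M) x)"
    proof -
      have "free_fun ?g = (\<lambda>x. \<Sum>M\<in>X. place a M (chain_rep (B.cls (h M))) x)"
        by (rule free_fun_normal_ext) (rule h)
      moreover have "aeq (hypersimplex a) (chain_rep (B.cls (h M))) (h M)" if "M \<in> X" for M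
        using chain_rep(2)[OF h[OF that]] by (simp flip: B.cls_eq_iff_aeq)
      ultimately show ?thesis by (simp add: aeq_sum aeq_place)
    qed
    finally show "aeq UNIV (tensor_fun (T.coset ?g)) (\<lambda>x. \<Sum>M\<in>X. place a M (h M) x)" .
  qed
qed

text \<open>The normal form splits the function into finitely many cubes, each of which yields a
  chain function on the simplex; this places the image in the span of the plates.\<close>

lemma tensor_fun_chain:
  assumes "t \<in> carrier T.Q"
  shows "\<exists>u\<in>chain_span. aeq (dilated_simplex r) (tensor_fun t) u"
proof -
  obtain h where h: "\<And>M. M \<in> X \<Longrightarrow> h M \<in> chain_span"
    and tensor_fun: "aeq UNIV (tensor_fun t) (\<lambda>x. \<Sum>M\<in>X. place a M (h M) x)"
    using tensor_decompose[OF assms] by blast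
  have "\<forall>M\<in>X. \<exists>u\<in>chain_span. aeq (dilated_simplex r) (place a M (h M)) u"
    using place_chain[OF h _ card_ge] by blast
  then obtain u where u: "\<And>M. M \<in> X \<Longrightarrow> u M \<in> chain_span"
      "\<And>M. M \<in> X \<Longrightarrow> aeq (dilated_simplex r) (place a M (h M)) (u M)"
    by metis
  have "aeq (dilated_simplex r) (tensor_fun t) (\<lambda>x. \<Sum>M\<in>X. u M x)"
    using aeq_trans[OF aeq_subset[OF tensor_fun] aeq_sum[OF u(2)]] by simp
  moreover have "(\<lambda>x. \<Sum>M\<in>X. u M x) \<in> chain_span" by (intro chain_span_sum u)
  ultimately show ?thesis by blast
qed

end

section \<open>Assembling the isomorphism\<close>

lemma isomorphic_repsI:
  assumes V: "representation G V" and W: "representation G W"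
    and closed: "\<And>v. v \<in> carrier V \<Longrightarrow> \<phi> v \<in> carrier W"
    and add: "\<And>v w. v \<in> carrier V \<Longrightarrow> w \<in> carrier V \<Longrightarrow> \<phi> (v \<oplus>\<^bsub>V\<^esub> w) = \<phi> v \<oplus>\<^bsub>W\<^esub> \<phi> w"
    and smult: "\<And>c v. v \<in> carrier V \<Longrightarrow> \<phi> (c \<odot>\<^bsub>V\<^esub> v) = c \<odot>\<^bsub>W\<^esub> \<phi> v"
    and act: "\<And>g v. g \<in> carrier G \<Longrightarrow> v \<in> carrier V \<Longrightarrow> \<phi> (act V g v) = act W g (\<phi> v)"
    and kernel: "\<And>v. v \<in> carrier V \<Longrightarrow> \<phi> v = \<zero>\<^bsub>W\<^esub> \<Longrightarrow> v = \<zero>\<^bsub>V\<^esub>"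
    and surj: "\<And>w. w \<in> carrier W \<Longrightarrow> \<exists>v\<in>carrier V. \<phi> v = w"
  shows "isomorphic_reps G V W"
proof -
  interpret V: Module.module complex_ring V by (rule representationD(2)[OF V])
  interpret W: Module.module complex_ring W by (rule representationD(2)[OF W])
  have "inj_on \<phi> (carrier V)"
  proof (rule inj_onI)
    fix v w assume v: "v \<in> carrier V" and w: "w \<in> carrier V" and eq: "\<phi> v = \<phi> w"
    have minus: "\<ominus>\<^bsub>V\<^esub> w = (-1) \<odot>\<^bsub>V\<^esub> w" and minus': "\<ominus>\<^bsub>W\<^esub> \<phi> w = (-1) \<odot>\<^bsub>W\<^esub> \<phi> w"
      using V.smult_l_minus[of 1 w] V.smult_one[of w] W.smult_l_minus[of 1 "\<phi> w"] W.smult_one[of "\<phi> w"] w closed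
      by auto
    have "\<phi> (v \<oplus>\<^bsub>V\<^esub> \<ominus>\<^bsub>V\<^esub> w) = \<phi> w \<oplus>\<^bsub>W\<^esub> \<ominus>\<^bsub>W\<^esub> \<phi> w"
      unfolding minus minus' using v w by (simp add: add smult eq)
    also have "\<dots> = \<zero>\<^bsub>W\<^esub>" using w closed by (simp add: W.r_neg)
    finally have "v \<oplus>\<^bsub>V\<^esub> \<ominus>\<^bsub>V\<^esub> w = \<zero>\<^bsub>V\<^esub>" using v w by (intro kernel) auto
    then have "\<ominus>\<^bsub>V\<^esub> (\<ominus>\<^bsub>V\<^esub> w) = v" using v w by (intro V.minus_equality) auto
    then show "v = w" using w by simp
  qed
  then have "bij_betw \<phi> (carrier V) (carrier W)"
    using closed surj by (fastforce simp: bij_betw_def)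
  then show ?thesis
    unfolding isomorphic_reps_def using V W add smult act by blast
qed

text \<open>Without integer coordinates the corner of the cube is the vector of floors of
  \<open>x\<close>, whatever \<open>a\<close> is.\<close>

lemma cube_unique:
  assumes "\<And>i. x $ i \<notin> \<int>" "x - point M \<in> hypersimplex a" "x - point M' \<in> hypersimplex a'"
  shows "M = M'"
proof -
  have floor: "\<lfloor>x $ i\<rfloor> = int (count M i)" if "x - point M \<in> hypersimplex a" for M a i
  proof -
    have "real (count M i) \<le> x $ i" "x $ i \<le> real (count M i) + 1"
      using that by (auto simp: hypersimplex_def point_def algebra_simps)
    moreover have "x $ i \<noteq> real (count M i) + 1" using assms(1)[of i] by (metis Ints_1 Ints_add Ints_of_nat)
    ultimately show ?thesis by (intro floor_unique) auto
  qed
  show ?thesis using floor[OF assms(2)] floor[OF assms(3)] by (intro multiset_eqI) simp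
qed

text \<open>The floors give the corner and the fractional parts give the point of the hypersimplex.
  Excluding integer coordinates makes the bounds on the sum of the fractional parts strict, which
  rules out \<open>a = 0\<close> and \<open>a = CARD('n)\<close>.\<close>

lemma cube_exists:
  fixes x :: "real ^ 'n::finite"
  assumes x: "x \<in> dilated_simplex r" and ni: "\<And>i. x $ i \<notin> \<int>"
  shows "\<exists>a\<in>{1..CARD('n) - 1}. \<exists>M\<in>expo r a. x - point M \<in> hypersimplex a"
proof -
  define M where "M = Abs_multiset (\<lambda>i. nat \<lfloor>x $ i\<rfloor>)"
  have count: "count M i = nat \<lfloor>x $ i\<rfloor>" for i
    unfolding M_def by (subst count_Abs_multiset) auto
  have nn: "0 \<le> x $ i" for i using x by (simp add: dilated_simplex_def)
  have pt: "(x - point M) $ i = frac (x $ i)" for i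
    using nn[of i] by (simp add: point_def count frac_def)
  have pos: "0 < frac (x $ i)" for i using ni[of i] by (simp add: frac_gt_0_iff)
  have sum: "(\<Sum>i\<in>UNIV. frac (x $ i)) = real r - real (size M)"
    using x by (simp add: sum_subtractf sum_point dilated_simplex_def flip: pt)
  have "0 < (\<Sum>i\<in>UNIV. frac (x $ i))" by (rule sum_pos) (simp_all add: pos ni)
  moreover have "(\<Sum>i\<in>UNIV. frac (x $ i)) < (\<Sum>i\<in>(UNIV :: 'n set). 1)"
    by (rule sum_strict_mono) (auto simp: frac_lt_1)
  ultimately have less: "size M < r" "r - size M < CARD('n)" using sum by auto
  define a where "a = r - size M"
  have "a \<in> {1..CARD('n) - 1}" "M \<in> expo r a" using less by (auto simp: a_def expo_def)
  moreover have "x - point M \<in> hypersimplex a"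
    unfolding hypersimplex_def using sum less pos frac_lt_1[of "x $ i" for i]
    by (auto simp: pt a_def less_imp_le simp del: vector_minus_component)
  ultimately show ?thesis by blast
qed

text \<open>The point \<open>x\<close> determines \<open>M\<close>, and the size of \<open>M\<close>
  determines \<open>a\<close>, so a single term of the double sum survives.\<close>

lemma cube_sum:
  fixes x :: "real ^ 'n::finite"
  assumes ni: "\<And>i. x $ i \<notin> \<int>" and a: "a \<in> I" "finite I" and M: "M \<in> expo r a" and x: "x - point M \<in> hypersimplex a"
  shows "(\<Sum>a\<in>I. \<Sum>M\<in>expo r a. place a M (h a M) x) = h a M (x - point M)"
proof -
  have "(\<Sum>M'\<in>expo r a'. place a' M' (h a' M') x) = (if a' = a then h a M (x - point M) else 0)" for a'
  proof -
    have "place a' M' (h a' M') x = (if M' = M then if a' = a then h a M (x - point M) else 0 else 0)"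
      if M': "M' \<in> expo r a'" for M'
    proof (cases "x - point M' \<in> hypersimplex a'")
      case True
      then have "M' = M" by (rule cube_unique[OF ni _ x])
      moreover from this have "a' = a" using M M' by (simp add: expo_def)
      ultimately show ?thesis using x by (simp add: place_def)
    next
      case False
      then show ?thesis using x by (auto simp: place_def)
    qed
    then have "(\<Sum>M'\<in>expo r a'. place a' M' (h a' M') x) =
      (\<Sum>M'\<in>expo r a'. if M' = M then if a' = a then h a M (x - point M) else 0 else 0)"
      by (intro sum.cong) auto
    then show ?thesis using M by (cases "a' = a") simp_all
  qed
  then show ?thesis using a by simp
qed

text \<open>Coordinates on the simplex lie between 0 and \<open>r\<close>, so finitely many integer
  values, and hence finitely many slices, occur.\<close>

lemma thin_integer_coordinate:
  assumes "CARD('n::finite) \<ge> 2"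
  shows "thin {x \<in> (dilated_simplex r :: (real ^ 'n) set). \<exists>i. x $ i \<in> \<int>}"
proof -
  have "thin (\<Union>i\<in>UNIV. \<Union>m\<in>{0..int r}. {x :: real ^ 'n. (\<Sum>j\<in>UNIV. x $ j) = real r \<and> x $ i = real_of_int m})"
    by (intro thin_UN thin_slice assms) auto
  then show ?thesis
  proof (rule thin_subset, intro subsetI)
    fix x :: "real ^ 'n" assume "x \<in> {x \<in> dilated_simplex r. \<exists>i. x $ i \<in> \<int>}"
    then obtain i m where x: "x \<in> dilated_simplex r" "x $ i = real_of_int m" by (auto elim: Ints_cases)
    then have "0 \<le> real_of_int m" "real_of_int m \<le> real r" by (auto simp: dilated_simplex_def simp flip: x(2))
    then have "m \<in> {0..int r}" by auto
    with x show "x \<in> (\<Union>i\<in>UNIV. \<Union>m\<in>{0..int r}. {x. (\<Sum>j\<in>UNIV. x $ j) = real r \<and> x $ i = real_of_int m})"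
      by (intro UN_I[of i] UN_I[of m]) (auto simp: dilated_simplex_def)
  qed
qed

text \<open>Off the walls the sum at \<open>y + point M\<close> is the single value
  \<open>h a M y\<close>. Translating the exceptional set of the sum together with the walls back by
  the corner therefore covers the points where \<open>h a M\<close> is nonzero.\<close>

lemma aeq_cube_sum_zero:
  fixes h :: "nat \<Rightarrow> 'n::finite multiset \<Rightarrow> real ^ 'n \<Rightarrow> complex"
  assumes card: "CARD('n) \<ge> 2" and I: "finite I"
    and zero: "aeq (dilated_simplex r) (\<lambda>x. \<Sum>a\<in>I. \<Sum>M\<in>expo r a. place a M (h a M) x) (\<lambda>x. 0)"
    and a: "a \<in> I" and M: "M \<in> expo r a"
  shows "aeq (hypersimplex a) (h a M) (\<lambda>x. 0)"
proof -
  let ?S = "\<lambda>x. \<Sum>a\<in>I. \<Sum>M\<in>expo r a. place a M (h a M) x"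
  let ?Z = "{x \<in> dilated_simplex r. ?S x \<noteq> 0} \<union> {x \<in> dilated_simplex r. \<exists>i. x $ i \<in> \<int>}"
  have "thin ((+) (- point M) ` ?Z)"
    using zero thin_integer_coordinate[OF card] by (intro thin_translation thin_Un) (simp_all add: aeq_def)
  moreover have "{y \<in> hypersimplex a. h a M y \<noteq> 0} \<subseteq> (+) (- point M) ` ?Z"
  proof
    fix y assume y: "y \<in> {y \<in> hypersimplex a. h a M y \<noteq> 0}"
    let ?x = "y + point M"
    have nn: "0 \<le> ?x $ i" for i using y by (simp add: hypersimplex_def point_def)
    have sum: "(\<Sum>i\<in>UNIV. ?x $ i) = real r"
      using y M by (simp add: sum.distrib sum_point hypersimplex_def expo_def flip: of_nat_add)
    have "?x $ i \<le> real r" for i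
      unfolding sum[symmetric] by (rule member_le_sum) (use nn in auto)
    with nn sum have x: "?x \<in> dilated_simplex r" by (simp add: dilated_simplex_def)
    have "?S ?x \<noteq> 0" if "\<And>i. ?x $ i \<notin> \<int>"
      using cube_sum[OF that a I M, of h] y by simp
    with x have "?x \<in> ?Z" by blast
    then show "y \<in> (+) (- point M) ` ?Z" by (intro image_eqI[of _ _ ?x]) auto
  qed
  ultimately show ?thesis unfolding aeq_def by (rule thin_subset)
qed

text \<open>At a generic point exactly one cube contributes, and there the shift by
  \<open>point M\<close> undoes the one in \<open>place\<close>.\<close>

lemma aeq_cube_sum:
  fixes f :: "real ^ 'n::finite \<Rightarrow> complex"
  assumes card: "CARD('n) \<ge> 2"
  shows "aeq (dilated_simplex r)
    (\<lambda>x. \<Sum>a\<in>{1..CARD('n) - 1}. \<Sum>M\<in>expo r a. place a M (\<lambda>y. f (y + point M)) x) f"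
proof -
  have "(\<Sum>a\<in>{1..CARD('n) - 1}. \<Sum>M\<in>expo r a. place a M (\<lambda>y. f (y + point M)) x) = f x"
    if x: "x \<in> dilated_simplex r" "\<And>i. x $ i \<notin> \<int>" for x
  proof -
    obtain a M where "a \<in> {1..CARD('n) - 1}" "M \<in> expo r a" "x - point M \<in> hypersimplex a"
      using cube_exists[OF x] by blast
    from cube_sum[OF x(2) this(1) _ this(2,3), of "\<lambda>a M y. f (y + point M)"] show ?thesis by simp
  qed
  then show ?thesis
    unfolding aeq_def by (intro thin_subset[OF thin_integer_coordinate[OF card, of r]]) auto
qed

theorem theorem9:
  fixes r :: nat
  assumes "CARD('n::finite) \<ge> 2" and "r \<ge> 1"
  shows "isomorphic_reps (Sym_group :: ('n \<Rightarrow> 'n) monoid)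
           (Pl (dilated_simplex r) r)
           (direct_sum {1..CARD('n) - 1}
              (\<lambda>a. tensor_rep (sym_power standard_rep (int r - int a)) (Pl (hypersimplex a) a)))"
proof -
  define I where "I = {1..CARD('n) - 1}"
  have finI: "finite I" by (simp add: I_def)
  let ?D = "dilated_simplex r :: (real ^ 'n) set"
  let ?T = "\<lambda>a. tensor_rep (sym_power standard_rep (int r - int a)) (Pl (hypersimplex a :: (real ^ 'n) set) a)"
  let ?V = "direct_sum I ?T"
  interpret E: plate_domain ?D r
    by (rule plate_domain_dilated_simplex) (use assms in auto)
  have P: "piece TYPE('n) r a" if "a \<in> I" for a
    using that assms by unfold_locales (auto simp: I_def)
  \<comment> \<open>The index \<open>a\<close> stays an argument, so that functions coming from
    different instances of the locale can be added.\<close>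
  define tensor_fun :: "nat \<Rightarrow> _ \<Rightarrow> real ^ 'n \<Rightarrow> complex" where "tensor_fun = piece.tensor_fun r"
  note fold = sym_power_eq tensor_rep_eq
  have rep: "representation Sym_group (?T a)" if "a \<in> I" for a
  proof -
    interpret piece r a "TYPE('n)" by (rule P[OF that])
    show ?thesis using T.representation_Q by (simp add: fold)
  qed
  have V: "representation Sym_group ?V"
    using rep by (intro representation_direct_sum group_BijGroup)
  have carrier_V: "f \<in> carrier ?V \<longleftrightarrow> f \<in> extensional I \<and> (\<forall>a\<in>I. f a \<in> carrier (?T a))" for f
    by (auto simp: direct_sum_def PiE_def finI)
  have tensor_fun_add: "aeq ?D (tensor_fun a (t \<oplus>\<^bsub>?T a\<^esub> t')) (\<lambda>x. tensor_fun a t x + tensor_fun a t' x)"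
    if "a \<in> I" "t \<in> carrier (?T a)" "t' \<in> carrier (?T a)" for a t t'
    using piece.tensor_fun_add[OF P[OF that(1)]] that(2,3) unfolding tensor_fun_def fold by (blast intro: aeq_subset)
  have tensor_fun_smult: "aeq ?D (tensor_fun a (c \<odot>\<^bsub>?T a\<^esub> t)) (\<lambda>x. c * tensor_fun a t x)"
    if "a \<in> I" "t \<in> carrier (?T a)" for a t c
    using piece.tensor_fun_smult[OF P[OF that(1)]] that(2) unfolding tensor_fun_def fold by (blast intro: aeq_subset)
  have tensor_fun_act: "aeq ?D (tensor_fun a (act (?T a) \<sigma> t)) (\<lambda>x. tensor_fun a t (permute_coords (inv_into UNIV \<sigma>) x))"
    if "a \<in> I" "t \<in> carrier (?T a)" "bij \<sigma>" for a t \<sigma>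
    using piece.tensor_fun_act[OF P[OF that(1)]] that(2,3) unfolding tensor_fun_def fold by (blast intro: aeq_subset)
  have tensor_fun_chain: "\<exists>u\<in>chain_span. aeq ?D (tensor_fun a t) u" if "a \<in> I" "t \<in> carrier (?T a)" for a t
    using piece.tensor_fun_chain[OF P[OF that(1)]] that(2) unfolding tensor_fun_def fold by blast
  \<comment> \<open>Because functions are added before the class is taken, each property of the map
    reduces to a statement up to thin sets about single summands.\<close>
  define \<Theta> where "\<Theta> = (\<lambda>f. E.cls (\<lambda>x. \<Sum>a\<in>I. tensor_fun a (f a) x))"
  have "isomorphic_reps Sym_group ?V (Pl ?D r)"
  proof (rule isomorphic_repsI[where \<phi> = \<Theta>, OF V E.representation_Pl])
    fix f assume f: "f \<in> carrier ?V"
    then have fa: "f a \<in> carrier (?T a)" if "a \<in> I" for a using that by (simp add: carrier_V)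
    have "\<forall>a\<in>I. \<exists>u\<in>chain_span. aeq ?D (tensor_fun a (f a)) u" using tensor_fun_chain fa by blast
    then obtain u where u: "\<And>a. a \<in> I \<Longrightarrow> u a \<in> chain_span" "\<And>a. a \<in> I \<Longrightarrow> aeq ?D (tensor_fun a (f a)) (u a)"
      by metis
    have "\<Theta> f = E.cls (\<lambda>x. \<Sum>a\<in>I. u a x)"
      unfolding \<Theta>_def E.cls_eq_iff_aeq by (intro aeq_sum u)
    then show "\<Theta> f \<in> carrier (Pl ?D r)"
      unfolding E.carrier_Pl by (auto intro!: imageI chain_span_sum u)
    show "\<Theta> (c \<odot>\<^bsub>?V\<^esub> f) = c \<odot>\<^bsub>Pl ?D r\<^esub> \<Theta> f" for c
      unfolding \<Theta>_def E.smult_Pl E.cls_eq_iff_aeq sum_distrib_left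
      by (intro aeq_sum) (use tensor_fun_smult fa in \<open>simp add: direct_sum_def\<close>)
    show "\<Theta> (act ?V \<sigma> f) = act (Pl ?D r) \<sigma> (\<Theta> f)" if "\<sigma> \<in> carrier Sym_group" for \<sigma>
    proof -
      have \<sigma>: "bij \<sigma>" using that by (simp add: carrier_Sym_group)
      show ?thesis
        unfolding \<Theta>_def E.act_Pl[OF \<sigma>] E.cls_eq_iff_aeq
        by (intro aeq_sum) (use tensor_fun_act fa \<sigma> in \<open>simp add: direct_sum_def\<close>)
    qed
    show "\<Theta> (f \<oplus>\<^bsub>?V\<^esub> g) = \<Theta> f \<oplus>\<^bsub>Pl ?D r\<^esub> \<Theta> g" if g: "g \<in> carrier ?V" for g
    proof -
      have "g a \<in> carrier (?T a)" if "a \<in> I" for a using that g by (simp add: carrier_V)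
      then show ?thesis
        unfolding \<Theta>_def E.add_Pl E.cls_eq_iff_aeq sum.distrib[symmetric]
        by (intro aeq_sum) (use tensor_fun_add fa in \<open>simp add: direct_sum_def\<close>)
    qed
    show "f = \<zero>\<^bsub>?V\<^esub>" if "\<Theta> f = \<zero>\<^bsub>Pl ?D r\<^esub>"
    proof -
      \<comment> \<open>All summands have to be decomposed together: only the total over
        \<open>a\<close> is known to vanish, and \<open>aeq_cube_sum_zero\<close> then isolates each
        cube.\<close>
      have "\<forall>a\<in>I. \<exists>h. (\<forall>M\<in>expo r a. h M \<in> chain_span) \<and>
          aeq UNIV (tensor_fun a (f a)) (\<lambda>x. \<Sum>M\<in>expo r a. place a M (h M) x) \<and>
          ((\<forall>M\<in>expo r a. aeq (hypersimplex a) (h M) (\<lambda>x. 0)) \<longrightarrow> f a = \<zero>\<^bsub>?T a\<^esub>)"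
        using piece.tensor_decompose[OF P] fa unfolding tensor_fun_def fold by blast
      from bchoice[OF this] obtain h where H: "\<forall>a\<in>I. (\<forall>M\<in>expo r a. h a M \<in> chain_span) \<and>
          aeq UNIV (tensor_fun a (f a)) (\<lambda>x. \<Sum>M\<in>expo r a. place a M (h a M) x) \<and>
          ((\<forall>M\<in>expo r a. aeq (hypersimplex a) (h a M) (\<lambda>x. 0)) \<longrightarrow> f a = \<zero>\<^bsub>?T a\<^esub>)" ..
      have h: "aeq UNIV (tensor_fun a (f a)) (\<lambda>x. \<Sum>M\<in>expo r a. place a M (h a M) x)" if "a \<in> I" for a
        using bspec[OF H that] by (elim conjE)
      have h0: "f a = \<zero>\<^bsub>?T a\<^esub>"
        if "a \<in> I" "\<forall>M\<in>expo r a. aeq (hypersimplex a) (h a M) (\<lambda>x. 0)" for a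
        using bspec[OF H that(1)] that(2) by (elim conjE) (rule mp)
      have "aeq ?D (\<lambda>x. \<Sum>a\<in>I. tensor_fun a (f a) x) (\<lambda>x. \<Sum>a\<in>I. \<Sum>M\<in>expo r a. place a M (h a M) x)"
        by (intro aeq_sum aeq_subset[OF h]) auto
      moreover have "aeq ?D (\<lambda>x. \<Sum>a\<in>I. tensor_fun a (f a) x) (\<lambda>x. 0)"
        using that by (simp add: \<Theta>_def E.zero_Pl E.cls_eq_iff_aeq)
      ultimately have zero: "aeq ?D (\<lambda>x. \<Sum>a\<in>I. \<Sum>M\<in>expo r a. place a M (h a M) x) (\<lambda>x. 0)"
        by (meson aeq_sym aeq_trans)
      have "f a = \<zero>\<^bsub>?T a\<^esub>" if "a \<in> I" for a
        by (rule h0[OF that]) (intro ballI aeq_cube_sum_zero[OF assms(1) _ zero that] finI)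
      moreover have "f \<in> extensional I" using f unfolding carrier_V by blast
      ultimately show ?thesis by (intro extensionalityI[of _ I]) (simp_all add: direct_sum_def)
    qed
  next
    fix w assume "w \<in> carrier (Pl ?D r)"
    then obtain p where p: "p \<in> chain_span" "w = E.cls p" by (auto simp: E.carrier_Pl)
    \<comment> \<open>Moving \<open>p\<close> back by the corner of a cube gives a chain function
      whose placement at \<open>M\<close> is \<open>p\<close> cut to that cube.\<close>
    have shift: "(\<lambda>y. p (y + point M)) \<in> chain_span" for M
      using p(1) by (rule chain_span_translate[where a = "\<lambda>i. int (count M i)"]) (simp add: point_def)
    have "\<exists>t\<in>carrier (?T a). aeq UNIV (tensor_fun a t) (\<lambda>x. \<Sum>M\<in>expo r a. place a M (\<lambda>y. p (y + point M)) x)"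
      if a: "a \<in> I" for a
    proof (rule piece.tensor_compose[OF P[OF a], folded fold, of "\<lambda>M y. p (y + point M)"])
      show "(\<lambda>y. p (y + point M)) \<in> chain_span" for M by (rule shift)
    qed (unfold tensor_fun_def, blast)
    then have "\<forall>a\<in>I. \<exists>t. t \<in> carrier (?T a) \<and>
        aeq UNIV (tensor_fun a t) (\<lambda>x. \<Sum>M\<in>expo r a. place a M (\<lambda>y. p (y + point M)) x)" by blast
    from bchoice[OF this] obtain t where T: "\<forall>a\<in>I. t a \<in> carrier (?T a) \<and>
        aeq UNIV (tensor_fun a (t a)) (\<lambda>x. \<Sum>M\<in>expo r a. place a M (\<lambda>y. p (y + point M)) x)" ..
    then have t: "\<And>a. a \<in> I \<Longrightarrow> t a \<in> carrier (?T a)"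
      "\<And>a. a \<in> I \<Longrightarrow> aeq UNIV (tensor_fun a (t a)) (\<lambda>x. \<Sum>M\<in>expo r a. place a M (\<lambda>y. p (y + point M)) x)"
      by simp_all
    let ?f = "restrict t I"
    have "aeq ?D (\<lambda>x. \<Sum>a\<in>I. tensor_fun a (?f a) x) (\<lambda>x. \<Sum>a\<in>I. \<Sum>M\<in>expo r a. place a M (\<lambda>y. p (y + point M)) x)"
      by (intro aeq_sum) (use aeq_subset[OF t(2)] in simp)
    also have "aeq ?D \<dots> p" unfolding I_def by (rule aeq_cube_sum[OF assms(1)])
    finally have "\<Theta> ?f = w" by (simp add: \<Theta>_def p E.cls_eq_iff_aeq)
    moreover have "?f \<in> carrier ?V" using t by (simp add: carrier_V)
    ultimately show "\<exists>f\<in>carrier ?V. \<Theta> f = w" by blast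
  qed
  then show ?thesis unfolding I_def by (rule isomorphic_reps_sym)
qed

end
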